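(* Fix $a>0$ and $\beta_1\in(0,1)$, and put $\rho^*:=\rho^*_{\mathrm{2-side}}(a,\beta_1)$, where $$\rho^*_{\mathrm{2-side}}(a,\beta)^2:=\begin{cases} p^{(a-(1-2\beta))/2} & a\le 1-2\beta,\\ (a-(1-2\beta))\log p & 1-2\beta<a\le 1-4\beta/3,\\ 2(\sqrt{1-a}-\sqrt{1-a-\beta})^2\log p & 1-4\beta/3<a\le 1-\beta,\\ p^{a-(1-\beta)} & a>1-\beta.\end{cases}$$ Let $\beta\in(0,1)$ and let $n=n_p$, $s=s_p$ satisfy $\log\log\log n\sim a\log p$ and $s\sim p^{1-\beta}$ as $p\to\infty$. (1) (Lower bound) If $\beta>\beta_1$, then $\mathcal R_{\mathrm{2-side}}(p,n,\rho^*,s)\not\to0$. (2) (Upper bound) If $\beta<\beta_1$, then $\mathcal R_{\mathrm{2-side}}(p,n,\rho^*,s)\to0$.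
   Context: Observation model: $X=\theta+E\in\mathbb R^{p\times n}$, $E$ with i.i.d. $N(0,1)$ entries. Null class $\Theta_0(p,n)=\{\theta:\text{each row of }\theta\text{ is constant}\}$. Two-sided alternative class $\Theta_1^{\mathrm{2-side}}(p,n,\rho,s)$: the set of $\theta$ for which there exist $t^*\in[n-1]$, reals $\mu_{j1},\mu_{j2}$ ($j\in[p]$) and $S\subseteq[p]$ with $|S|\ge s$ such that $\theta_{ji}=\mu_{j1}$ for $i\le t^*$, $\theta_{ji}=\mu_{j2}$ for $i>t^*$, and $\sqrt{t^*(n-t^* )/n}\,|\mu_{j1}-\mu_{j2}|\ge\rho$ for all $j\in S$. $\mathcal R_{\mathrm{2-side}}(p,n,\rho,s)=\inf_\psi\big[\sup_{\theta\in\Theta_0}\mathbb E_\theta\psi(X)+\sup_{\theta\in\Theta_1^{\mathrm{2-side}}(p,n,\rho,s)}\mathbb E_\theta(1-\psi(X))\big]$ over measurable tests $\psi:\mathbb R^{p\times n}\to\{0,1\}$. $a_p\sim b_p$ means $a_p/b_p\to1$. *)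

theory Defs
  imports "HOL-Probability.Probability" "HOL-Library.Landau_Symbols"
begin

text \<open>Matrices in R^{p x n} are functions on index pairs (j,i), j in [p] = {1..p}, i in [n] = {1..n}.\<close>

definition idx :: "nat \<Rightarrow> nat \<Rightarrow> (nat \<times> nat) set" where
  "idx p n = {1..p} \<times> {1..n}"

definition obs_model :: "nat \<Rightarrow> nat \<Rightarrow> (nat \<times> nat \<Rightarrow> real) \<Rightarrow> (nat \<times> nat \<Rightarrow> real) measure" where
  "obs_model p n \<theta> = PiM (idx p n) (\<lambda>ji. density lborel (normal_density (\<theta> ji) 1))"

definition tests :: "nat \<Rightarrow> nat \<Rightarrow> ((nat \<times> nat \<Rightarrow> real) \<Rightarrow> real) set" where
  "tests p n = {\<psi>. \<psi> \<in> borel_measurable (PiM (idx p n) (\<lambda>_. borel)) \<and>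
      (\<forall>x \<in> space (PiM (idx p n) (\<lambda>_. (borel :: real measure))). \<psi> x \<in> {0, 1})}"

definition Theta0 :: "nat \<Rightarrow> nat \<Rightarrow> (nat \<times> nat \<Rightarrow> real) set" where
  "Theta0 p n = {\<theta>. \<forall>j\<in>{1..p}. \<forall>i\<in>{1..n}. \<forall>i'\<in>{1..n}. \<theta> (j, i) = \<theta> (j, i')}"

definition Theta1_2side :: "nat \<Rightarrow> nat \<Rightarrow> real \<Rightarrow> nat \<Rightarrow> (nat \<times> nat \<Rightarrow> real) set" where
  "Theta1_2side p n \<rho> s = {\<theta>. \<exists>t\<in>{1..n-1}. \<exists>\<mu>1 \<mu>2 :: nat \<Rightarrow> real. \<exists>S \<subseteq> {1..p}.
      card S \<ge> s \<and>
      (\<forall>j\<in>{1..p}. \<forall>i\<in>{1..n}. \<theta> (j, i) = (if i \<le> t then \<mu>1 j else \<mu>2 j)) \<and>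
      (\<forall>j\<in>S. sqrt (real t * (real n - real t) / real n) * \<bar>\<mu>1 j - \<mu>2 j\<bar> \<ge> \<rho>)}"

definition risk_2side :: "nat \<Rightarrow> nat \<Rightarrow> real \<Rightarrow> nat \<Rightarrow> real" where
  "risk_2side p n \<rho> s =
     (INF \<psi> \<in> tests p n.
        (SUP \<theta> \<in> Theta0 p n. integral\<^sup>L (obs_model p n \<theta>) \<psi>)
      + (SUP \<theta> \<in> Theta1_2side p n \<rho> s. integral\<^sup>L (obs_model p n \<theta>) (\<lambda>x. 1 - \<psi> x)))"

definition rho_star_sq :: "real \<Rightarrow> real \<Rightarrow> nat \<Rightarrow> real" where
  "rho_star_sq a \<beta> p =
    (if a \<le> 1 - 2*\<beta> then real p powr ((a - (1 - 2*\<beta>)) / 2)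
     else if a \<le> 1 - 4*\<beta>/3 then (a - (1 - 2*\<beta>)) * ln (real p)
     else if a \<le> 1 - \<beta> then 2 * (sqrt (1 - a) - sqrt (1 - a - \<beta>))^2 * ln (real p)
     else real p powr (a - (1 - \<beta>)))"

definition rho_star :: "real \<Rightarrow> real \<Rightarrow> nat \<Rightarrow> real" where
  "rho_star a \<beta> p = sqrt (rho_star_sq a \<beta> p)"

end

theory Submission
  imports Defs "HOL-Real_Asymp.Real_Asymp"
begin

text \<open>Upper bound: in every regime one scans a geometric grid of about log n change-point locations
  and rejects if, at some location, too many rows have a CUSUM statistic exceeding a threshold
  \<tau>. Chernoff bounds make the null error at one location beat the union bound, whose cost is
  log log n = p^(a+o(1)). Only \<tau> depends on the regime: it is constant for dense signals,
  2 \<rho> and sqrt(2 (1-a) log p) in the two logarithmic regimes, and of order \<rho> for strong signals.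

  Lower bound: the locations t = 2^(pk) yield exp(p^(a-o(1))) nearly orthogonal alternatives.
  Let L be the likelihood ratio at one location, averaged over a random support (one row from each of
  s blocks) and random signs. The average over locations, with L truncated at a fraction of the number
  of locations, is close to 1 in L2 as soon as a moment of order 1 + h of L is below exp(p^(a-\<delta>)),
  and since blocks are independent, this moment is a power of a one-block moment. Taking h = 1 works
  except in the third regime, where h = y / (x - y) with x^2 = 1 - a and y^2 = 1 - a - \<beta>1
  is the minimiser of the exponent.\<close>

section \<open>Gaussian row statistics\<close>

text \<open>Both bounds compare exponents of p. If pq null exceedances are expected at a location
  and the alternative adds E, the Chernoff exponent is of order min(E, E^2/(pq)): linear when
  exceedances are rare, quadratic when they are frequent. It has to beat p^a. With signal r sqrt(2
  log p) and threshold x sqrt(2 log p), E is about p^(1-\<beta>-(x-r)^2) and pq about p^(1-x^2). The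
  quadratic exponent is maximal at x = 2r, which gives the second regime. Once 2r passes sqrt(1-a),
  x stays at sqrt(1-a), where p^a null exceedances are expected and, at the critical signal, both
  exponents equal p^a; this is the third regime, and 2r = sqrt(1-a) is the boundary a = 1 -
  4\<beta>/3. Dually, the log of the moment of order 1 + h is about
  p^(1-\<beta>-\<beta>h+h(1+h)r^2), to be kept below p^a. Its minimiser in h is at most 1 exactly
  beyond the same boundary. There the second moment is dominated by rare huge values of L, which is
  the obstacle that forces truncation and h < 1.\<close>

lemma prob_space_normal: "prob_space (density lborel (normal_density m 1))"
  by (rule prob_space_normal_density) simp

lemma space_obs_model: "space (obs_model p n \<theta>) = PiE (idx p n) (\<lambda>_. UNIV)"
  by (simp add: obs_model_def space_PiM)

lemma sets_obs_model [measurable_cong]: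
  "sets (obs_model p n \<theta>) = sets (PiM (idx p n) (\<lambda>_. borel))"
  unfolding obs_model_def by (intro sets_PiM_cong) auto

lemma prob_space_obs_model: "prob_space (obs_model p n \<theta>)"
  unfolding obs_model_def by (intro prob_space_PiM prob_space_normal)

lemma finite_idx [simp]: "finite (idx p n)"
  by (simp add: idx_def)

lemma distr_obs_model_component:
  assumes "k \<in> idx p n"
  shows "distr (obs_model p n \<theta>) borel (\<lambda>x. x k) = density lborel (normal_density (\<theta> k) 1)"
proof -
  interpret product_prob_space "\<lambda>k. density lborel (normal_density (\<theta> k) 1)" "idx p n"
    by (simp add: product_prob_space_def product_prob_space_axioms_def product_sigma_finite_def
        prob_space_normal prob_space_imp_sigma_finite)
  have "distr (obs_model p n \<theta>) (density lborel (normal_density (\<theta> k) 1)) (\<lambda>x. x k)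
      = density lborel (normal_density (\<theta> k) 1)"
    unfolding obs_model_def by (rule PiM_component[OF assms])
  moreover have "distr (obs_model p n \<theta>) (density lborel (normal_density (\<theta> k) 1)) (\<lambda>x. x k)
      = distr (obs_model p n \<theta>) borel (\<lambda>x. x k)"
    by (rule distr_cong) auto
  ultimately show ?thesis by simp
qed

lemma indep_vars_obs_model:
  "prob_space.indep_vars (obs_model p n \<theta>) (\<lambda>_. borel) (\<lambda>k x. x k) (idx p n)"
proof (cases "idx p n = {}")
  case True
  interpret prob_space "obs_model p n \<theta>" by (rule prob_space_obs_model)
  show ?thesis by (simp add: True indep_vars_def indep_sets_def)
next
  case False
  interpret prob_space "obs_model p n \<theta>" by (rule prob_space_obs_model)
  \<comment> \<open>Independence is checked as equality of the joint law with the product of the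
    marginals. That criterion assumes a nonempty index set, hence the case split.\<close>
  have "distr (obs_model p n \<theta>) (PiM (idx p n) (\<lambda>_. borel)) (\<lambda>x. \<lambda>i\<in>idx p n. x i)
     = distr (obs_model p n \<theta>) (obs_model p n \<theta>) (\<lambda>x. x)"
    by (rule distr_cong) (auto simp: sets_obs_model space_obs_model)
  also have "\<dots> = obs_model p n \<theta>" by (rule distr_id)
  also have "\<dots> = PiM (idx p n) (\<lambda>k. distr (obs_model p n \<theta>) borel (\<lambda>x. x k))"
    unfolding obs_model_def[of p n]
    by (rule PiM_cong) (auto simp: distr_obs_model_component[unfolded obs_model_def])
  finally show ?thesis
    by (subst indep_vars_iff_distr_eq_PiM'[OF False]) (auto simp: sets_obs_model)
qed

text \<open>Different rows read disjoint sets of coordinates. Allowing a subset of columns and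
  general weights covers both the CUSUM statistics of the upper bound and the partial sums of the
  lower bound.\<close>

lemma indep_vars_row_statistic:
  assumes A: "A \<subseteq> {1..n}"
  shows "prob_space.indep_vars (obs_model p n \<theta>) (\<lambda>_. borel) (\<lambda>j x. \<Sum>i\<in>A. w i * x (j, i)) {1..p}"
proof -
  interpret prob_space "obs_model p n \<theta>" by (rule prob_space_obs_model)
  have "indep_vars (\<lambda>j. PiM ({j} \<times> A) (\<lambda>_. borel)) (\<lambda>j x. restrict (\<lambda>k. x k) ({j} \<times> A)) {1..p}"
    by (rule indep_vars_restrict[OF indep_vars_obs_model])
       (use A in \<open>auto simp: idx_def disjoint_family_on_def\<close>)
  then have "indep_vars (\<lambda>_. borel)
      (\<lambda>j x. (\<lambda>y. \<Sum>i\<in>A. w i * y (j, i)) (restrict (\<lambda>k. x k) ({j} \<times> A))) {1..p}"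
    by (rule indep_vars_compose2) (auto intro!: borel_measurable_sum borel_measurable_times measurable_component_singleton)
  then show ?thesis by simp
qed

text \<open>The sum runs over a subset A because sum_indep_normal needs positive variances.\<close>

lemma distributed_row_statistic:
  assumes A: "A \<subseteq> {1..n}" "A \<noteq> {}" and w: "\<And>i. i \<in> A \<Longrightarrow> w i \<noteq> 0" "(\<Sum>i\<in>A. (w i)\<^sup>2) = 1"
    and j: "j \<in> {1..p}"
  shows "distributed (obs_model p n \<theta>) lborel (\<lambda>x. \<Sum>i\<in>A. w i * x (j, i))
     (normal_density (\<Sum>i\<in>A. w i * \<theta> (j, i)) 1)"
proof -
  interpret prob_space "obs_model p n \<theta>" by (rule prob_space_obs_model)
  have fin: "finite A" using A finite_subset by blast
  have k: "(j, i) \<in> idx p n" if "i \<in> A" for i using that A j by (auto simp: idx_def)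
  have 1: "distributed (obs_model p n \<theta>) lborel (\<lambda>x. x (j, i)) (normal_density (\<theta> (j, i)) 1)" if "i \<in> A" for i
  proof -
    have "distr (obs_model p n \<theta>) lborel (\<lambda>x. x (j, i)) = distr (obs_model p n \<theta>) borel (\<lambda>x. x (j, i))"
      by (rule distr_cong) auto
    then show ?thesis
      using distr_obs_model_component[OF k[OF that], of \<theta>] k[OF that]
      by (auto simp: distributed_def)
  qed
  have 2: "distributed (obs_model p n \<theta>) lborel (\<lambda>x. w i * x (j, i)) (normal_density (w i * \<theta> (j, i)) \<bar>w i\<bar>)"
    if "i \<in> A" for i
    using normal_density_affine[OF 1[OF that], of "w i" 0] w(1)[OF that] by simp
  have "indep_vars (\<lambda>i. PiM {(j, i)} (\<lambda>_. borel)) (\<lambda>i x. restrict (\<lambda>k. x k) {(j, i)}) A"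
    by (rule indep_vars_restrict[OF indep_vars_obs_model])
       (use k in \<open>auto simp: disjoint_family_on_def\<close>)
  then have "indep_vars (\<lambda>_. borel) (\<lambda>i x. (\<lambda>y. w i * y (j, i)) (restrict (\<lambda>k. x k) {(j, i)})) A"
    by (rule indep_vars_compose2) (auto intro!: borel_measurable_times measurable_component_singleton)
  then have "indep_vars (\<lambda>_. borel) (\<lambda>i x. w i * x (j, i)) A" by simp
  from sum_indep_normal[OF fin A(2) this _ 2] w show ?thesis by simp
qed

section \<open>Gaussian tail probabilities\<close>

text \<open>Two-sided because the sign of a jump is unknown. The law of the number of exceeding rows
  depends on the means only through these probabilities.\<close>

definition exceed_prob :: "real \<Rightarrow> real \<Rightarrow> real" where
  "exceed_prob m \<tau> = measure (density lborel (normal_density m 1)) {y. \<tau> \<le> \<bar>y\<bar>}"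

lemma normal_density_shift: "normal_density m 1 y = std_normal_density (y - m)"
  by (simp add: normal_density_def)

lemma measure_normal_eq_integral:
  assumes "A \<in> sets borel"
  shows "measure (density lborel (normal_density m 1)) A = (\<integral>y. normal_density m 1 y * indicator A y \<partial>lborel)"
    and "integrable lborel (\<lambda>y. normal_density m 1 y * indicator A y)"
proof -
  interpret prob_space "density lborel (normal_density m 1)" by (rule prob_space_normal)
  have "measure (density lborel (normal_density m 1)) A
      = (\<integral>y. indicator A y \<partial>density lborel (normal_density m 1))"
    using assms by simp
  also have "\<dots> = (\<integral>y. normal_density m 1 y *\<^sub>R indicator A y \<partial>lborel)"
    by (rule integral_density) (use assms in auto)
  finally show "measure (density lborel (normal_density m 1)) A = (\<integral>y. normal_density m 1 y * indicator A y \<partial>lborel)"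
    by simp
  show "integrable lborel (\<lambda>y. normal_density m 1 y * indicator A y)"
    using integrable_mult_indicator[of A lborel "normal_density m 1"] assms
    by (simp add: mult.commute)
qed

lemma exceed_prob_uminus: "exceed_prob (- m) \<tau> = exceed_prob m \<tau>"
proof -
  have "(\<integral>y. normal_density (- m) 1 y * indicator {y. \<tau> \<le> \<bar>y\<bar>} y \<partial>lborel)
     = (\<integral>y. normal_density (- m) 1 (- y) * indicator {y. \<tau> \<le> \<bar>y\<bar>} (- y) \<partial>lborel)"
    using lborel_integral_real_affine[of "-1" "\<lambda>y. normal_density (- m) 1 y * indicator {y. \<tau> \<le> \<bar>y\<bar>} y" 0]
    by simp
  also have "(\<lambda>y. normal_density (- m) 1 (- y) * indicator {y. \<tau> \<le> \<bar>y\<bar>} (- y))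
     = (\<lambda>y. normal_density m 1 y * indicator {y. \<tau> \<le> \<bar>y\<bar>} y :: real)"
    by (auto simp: normal_density_def indicator_def power2_eq_square algebra_simps fun_eq_iff)
  finally show ?thesis
    unfolding exceed_prob_def by (subst (1 2) measure_normal_eq_integral) auto
qed

lemma exceed_prob_abs: "exceed_prob \<bar>m\<bar> \<tau> = exceed_prob m \<tau>"
  by (simp add: abs_if exceed_prob_uminus)

text \<open>The normal distribution function up to an additive constant. Only differences of
  \<open>F\<close> are needed, so integrating from 0 over bounded intervals suffices.\<close>

lemma std_normal_density_antiderivative:
  obtains F where "\<And>x. (F has_real_derivative std_normal_density x) (at x)"
proof
  fix x :: real
  have "((\<lambda>u. LBINT y=ereal 0..ereal u. std_normal_density y) has_vector_derivative std_normal_density x)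
      (at x within {- \<bar>x\<bar> - 1..\<bar>x\<bar> + 1})"
    by (rule interval_integral_FTC2) (auto intro!: continuous_intros simp: normal_density_def)
  moreover have "at x within {- \<bar>x\<bar> - 1..\<bar>x\<bar> + 1} = at x"
    by (rule at_within_interior) (auto simp: interior_atLeastAtMost_real)
  ultimately show "((\<lambda>u. LBINT y=ereal 0..ereal u. std_normal_density y) has_real_derivative std_normal_density x) (at x)"
    by (simp add: has_real_derivative_iff_has_vector_derivative)
qed

text \<open>The derivative of the difference is exp x + exp (-x) - 2, nonnegative because each
  exponential lies above its tangent at 0.\<close>

lemma double_le_exp_diff:
  fixes u :: real
  assumes "0 \<le> u"
  shows "2 * u \<le> exp u - exp (- u)"
proof -
  let ?f = "\<lambda>u::real. exp u - exp (- u) - 2 * u"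
  have "?f 0 \<le> ?f u"
  proof (rule DERIV_nonneg_imp_nondecreasing[OF assms, where f="?f"])
    fix x :: real
    have "(?f has_real_derivative exp x + exp (- x) - 2) (at x)"
      by (auto intro!: derivative_eq_intros)
    moreover have "0 \<le> exp x + exp (- x) - 2"
      using exp_ge_add_one_self[of x] exp_ge_add_one_self[of "- x"] by linarith
    ultimately show "\<exists>y. (?f has_real_derivative y) (at x) \<and> 0 \<le> y" by blast
  qed
  then show ?thesis by simp
qed

text \<open>The derivative of the left-hand side in m dominates that of the right-hand side because
  sinh u is at least u.\<close>

lemma exceed_prob_gain:
  assumes \<tau>: "0 \<le> \<tau>"
  shows "exceed_prob 0 \<tau> + 2 * \<tau> * std_normal_density \<tau> * (1 - exp (- (m\<^sup>2) / 2)) \<le> exceed_prob m \<tau>"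
proof -
  obtain F where F: "\<And>x. (F has_real_derivative std_normal_density x) (at x)"
    by (rule std_normal_density_antiderivative) blast
  have eq: "exceed_prob m \<tau> = 1 - (F (\<tau> - m) - F (- \<tau> - m))" for m
  proof -
    let ?M = "density lborel (normal_density m 1)"
    interpret prob_space ?M by (rule prob_space_normal)
    have "{y. \<tau> \<le> \<bar>y\<bar>} = space ?M - {y. \<bar>y\<bar> < \<tau>}" by auto
    then have "exceed_prob m \<tau> = 1 - measure ?M {y. \<bar>y\<bar> < \<tau>}"
      unfolding exceed_prob_def using prob_compl[of "{y. \<bar>y\<bar> < \<tau>}"] by simp
    also have "measure ?M {y. \<bar>y\<bar> < \<tau>} = (\<integral>y. normal_density m 1 y * indicator {y. \<bar>y\<bar> < \<tau>} y \<partial>lborel)"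
      by (rule measure_normal_eq_integral) simp
    also have "\<dots> = (\<integral>y. normal_density m 1 y * indicator {-\<tau>..\<tau>} y \<partial>lborel)"
    proof (rule integral_cong_AE)
      show "AE y in lborel. normal_density m 1 y * indicator {y. \<bar>y\<bar> < \<tau>} y = normal_density m 1 y * indicator {-\<tau>..\<tau>} y"
        using AE_lborel_singleton[of \<tau>] AE_lborel_singleton[of "-\<tau>"]
        by eventually_elim (auto simp: indicator_def)
    qed auto
    also have "\<dots> = F (\<tau> - m) - F (- \<tau> - m)"
    proof (rule integral_FTC_Icc_real[where F="\<lambda>y. F (y - m)"])
      show "((\<lambda>y. F (y - m)) has_real_derivative normal_density m 1 x) (at x)" for x
      proof -
        have "((\<lambda>y. y - m) has_real_derivative 1) (at x)" by (auto intro!: derivative_eq_intros)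
        from DERIV_chain2[OF F this] show ?thesis by (simp add: normal_density_shift[of m])
      qed
      show "isCont (normal_density m 1) x" for x
        unfolding normal_density_def by (auto intro!: continuous_intros)
    qed (use \<tau> in auto)
    finally show ?thesis .
  qed
  \<comment> \<open>The exceedance probability minus the claimed gain. The claim is that
    \<open>D\<close> is smallest at m = 0; since both parts are even in m, monotonicity on m \<ge> 0
    is enough.\<close>
  define D where "D = (\<lambda>m. 1 - (F (\<tau> - m) - F (- \<tau> - m)) - 2 * \<tau> * std_normal_density \<tau> * (1 - exp (- (m\<^sup>2) / 2)))"
  have D': "(D has_real_derivative
      (std_normal_density (\<tau> - m) - std_normal_density (- \<tau> - m) - 2 * \<tau> * std_normal_density \<tau> * (m * exp (- (m\<^sup>2) / 2)))) (at m)" for m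
  proof -
    have 1: "((\<lambda>m. F (c - m)) has_real_derivative - std_normal_density (c - m)) (at m)" for c
    proof -
      have "((\<lambda>m. c - m) has_real_derivative -1) (at m)" by (auto intro!: derivative_eq_intros)
      from DERIV_chain2[OF F this] show ?thesis by simp
    qed
    show ?thesis
      unfolding D_def by (rule derivative_eq_intros 1 refl)+ (auto simp: algebra_simps)
  qed
  have pos: "0 \<le> std_normal_density (\<tau> - m) - std_normal_density (- \<tau> - m) - 2 * \<tau> * std_normal_density \<tau> * (m * exp (- (m\<^sup>2) / 2))"
    if "0 \<le> m" for m
  proof -
    \<comment> \<open>Both shifted densities share the factor
      \<open>std_normal_density \<tau> * exp (- (m\<^sup>2) / 2)\<close>, which also appears in the
      derivative of the gain; what remains is the inequality between 2 \<tau> m and twice sinh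
      (\<tau> m).\<close>
    have a: "std_normal_density (\<tau> - m) = std_normal_density \<tau> * exp (- (m\<^sup>2) / 2) * exp (\<tau> * m)"
      "std_normal_density (- \<tau> - m) = std_normal_density \<tau> * exp (- (m\<^sup>2) / 2) * exp (- (\<tau> * m))"
      by (auto simp: normal_density_def mult_exp_exp power2_eq_square field_simps simp flip: exp_add)
    have "2 * (\<tau> * m) \<le> exp (\<tau> * m) - exp (- (\<tau> * m))"
      using \<tau> that by (intro double_le_exp_diff) auto
    then have "std_normal_density \<tau> * exp (- (m\<^sup>2) / 2) * (2 * (\<tau> * m)) \<le> std_normal_density \<tau> * exp (- (m\<^sup>2) / 2) * (exp (\<tau> * m) - exp (- (\<tau> * m)))"
      by (intro mult_left_mono) auto
    then show ?thesis unfolding a by (simp add: algebra_simps)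
  qed
  have "D 0 \<le> D \<bar>m\<bar>"
    by (rule DERIV_nonneg_imp_nondecreasing[where f=D]) (simp, use D' pos in blast)
  then show ?thesis
    unfolding D_def using eq[of 0] eq[of "\<bar>m\<bar>"] exceed_prob_abs[of m \<tau>] by simp
qed

text \<open>Rows outside the support of the signal may still have arbitrary jumps. They cannot push
  the expected count below its null value.\<close>

lemma exceed_prob_mono_0: "0 \<le> \<tau> \<Longrightarrow> exceed_prob 0 \<tau> \<le> exceed_prob m \<tau>"
proof -
  assume \<tau>: "0 \<le> \<tau>"
  have "0 \<le> 2 * \<tau> * std_normal_density \<tau> * (1 - exp (- (m\<^sup>2) / 2))"
    using \<tau> by (intro mult_nonneg_nonneg) auto
  then show ?thesis using exceed_prob_gain[OF \<tau>, of m] by simp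
qed

text \<open>Here v bounds the distance from mean to threshold. The unit interval starting at
  distance v from the mean lies beyond the threshold, and the density there is at least its value at
  the far end. The loss is subpolynomial in p when v^2 is of order log p.\<close>

lemma exceed_prob_ge_density:
  assumes "0 \<le> v" "\<tau> \<le> \<bar>m\<bar> + v"
  shows "std_normal_density (v + 1) \<le> exceed_prob m \<tau>"
proof -
  let ?m = "\<bar>m\<bar>"
  have "std_normal_density (v + 1) = (\<integral>y. std_normal_density (v + 1) * indicator {?m + v..?m + v + 1} y \<partial>lborel)"
    by simp
  also have "\<dots> \<le> (\<integral>y. normal_density ?m 1 y * indicator {y. \<tau> \<le> \<bar>y\<bar>} y \<partial>lborel)"
  proof (rule integral_mono)
    show "integrable lborel (\<lambda>y. std_normal_density (v + 1) * indicator {?m + v..?m + v + 1} y)" by simp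
    show "integrable lborel (\<lambda>y. normal_density ?m 1 y * indicator {y. \<tau> \<le> \<bar>y\<bar>} y)"
      by (rule measure_normal_eq_integral) simp
    fix y
    show "std_normal_density (v + 1) * indicator {?m + v..?m + v + 1} y \<le> normal_density ?m 1 y * indicator {y. \<tau> \<le> \<bar>y\<bar>} y"
    proof (cases "y \<in> {?m + v..?m + v + 1}")
      case True
      then have "(y - ?m)\<^sup>2 \<le> (v + 1)\<^sup>2" using assms by (intro power_mono) auto
      then have "std_normal_density (v + 1) \<le> normal_density ?m 1 y"
        by (simp add: normal_density_def divide_right_mono)
      moreover have "\<tau> \<le> \<bar>y\<bar>" using True assms by auto
      ultimately show ?thesis using True by (auto simp: indicator_def)
    qed auto
  qed
  also have "\<dots> = exceed_prob ?m \<tau>"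
    unfolding exceed_prob_def by (rule measure_normal_eq_integral(1)[symmetric]) simp
  finally show ?thesis by (simp add: exceed_prob_abs)
qed

text \<open>Completing the square turns the tilted density into a multiple of that of N(c,
  1).\<close>

lemma normal_mgf:
  "integrable lborel (\<lambda>y. std_normal_density y * exp (c * y))"
  "(\<integral>y. std_normal_density y * exp (c * y) \<partial>lborel) = exp (c\<^sup>2 / 2)"
proof -
  have eq: "std_normal_density y * exp (c * y) = exp (c\<^sup>2 / 2) * normal_density c 1 y" for y
    by (simp add: normal_density_def power2_eq_square field_simps flip: exp_add)
  show "integrable lborel (\<lambda>y. std_normal_density y * exp (c * y))"
    unfolding eq by simp
  show "(\<integral>y. std_normal_density y * exp (c * y) \<partial>lborel) = exp (c\<^sup>2 / 2)"
    unfolding eq by simp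
qed

text \<open>Exponential tilting by \<tau> on both tails: on \<bar>y\<bar> \<ge> \<tau> one of exp
  (\<tau> y), exp (-\<tau> y) is at least exp (\<tau>^2).\<close>

lemma exceed_prob_0_le:
  assumes "0 \<le> \<tau>"
  shows "exceed_prob 0 \<tau> \<le> 2 * exp (- (\<tau>\<^sup>2) / 2)"
proof -
  have "exceed_prob 0 \<tau> = (\<integral>y. std_normal_density y * indicator {y. \<tau> \<le> \<bar>y\<bar>} y \<partial>lborel)"
    unfolding exceed_prob_def by (rule measure_normal_eq_integral) simp
  also have "\<dots> \<le> (\<integral>y. exp (- (\<tau>\<^sup>2)) * (std_normal_density y * exp (\<tau> * y) + std_normal_density y * exp ((- \<tau>) * y)) \<partial>lborel)"
  proof (rule integral_mono)
    show "integrable lborel (\<lambda>y. std_normal_density y * indicator {y. \<tau> \<le> \<bar>y\<bar>} y)"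
      by (rule measure_normal_eq_integral) simp
    show "integrable lborel (\<lambda>y. exp (- (\<tau>\<^sup>2)) * (std_normal_density y * exp (\<tau> * y) + std_normal_density y * exp ((- \<tau>) * y)))"
      by (intro integrable_mult_right Bochner_Integration.integrable_add normal_mgf)
    fix y
    have "indicator {y. \<tau> \<le> \<bar>y\<bar>} y \<le> exp (- (\<tau>\<^sup>2)) * (exp (\<tau> * y) + exp ((- \<tau>) * y))"
    proof (cases "\<tau> \<le> \<bar>y\<bar>")
      case True
      have "exp (\<tau>\<^sup>2) \<le> exp (\<tau> * \<bar>y\<bar>)"
        using True assms by (simp add: power2_eq_square mult_left_mono)
      also have "\<dots> \<le> exp (\<tau> * y) + exp ((- \<tau>) * y)"
        by (auto simp: abs_if)
      finally show ?thesis
        using True by (simp add: exp_minus field_simps)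
    qed (simp add: add_nonneg_nonneg)
    then show "std_normal_density y * indicator {y. \<tau> \<le> \<bar>y\<bar>} y
        \<le> exp (- (\<tau>\<^sup>2)) * (std_normal_density y * exp (\<tau> * y) + std_normal_density y * exp ((- \<tau>) * y))"
      using mult_left_mono[of _ _ "std_normal_density y"] by (fastforce simp: algebra_simps)
  qed
  also have "\<dots> = exp (- (\<tau>\<^sup>2)) * (2 * exp (\<tau>\<^sup>2 / 2))"
    by (subst integral_mult_right_zero, subst Bochner_Integration.integral_add)
       (simp_all only: normal_mgf, simp)
  also have "\<dots> = 2 * exp (- (\<tau>\<^sup>2) / 2)"
    by (simp flip: exp_add)
  finally show ?thesis .
qed

lemma exceed_prob_le_1: "exceed_prob m \<tau> \<le> 1" and exceed_prob_nonneg: "0 \<le> exceed_prob m \<tau>"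
proof -
  interpret prob_space "density lborel (normal_density m 1)" by (rule prob_space_normal)
  show "exceed_prob m \<tau> \<le> 1" unfolding exceed_prob_def by simp
qed (simp add: exceed_prob_def)

section \<open>CUSUM statistics and a geometric grid\<close>

text \<open>The unit vector of R^n that is orthogonal to constants and constant on either side of t.
  Hence the statistic has variance 1, mean 0 on constant rows, and, for a jump at t itself, a mean
  whose absolute value is the signal strength in the alternative class.\<close>

definition cusum_weight :: "nat \<Rightarrow> nat \<Rightarrow> nat \<Rightarrow> real" where
  "cusum_weight n t i = sqrt (real t * (real n - real t) / real n) *
     (if i \<le> t then 1 / real t else - 1 / (real n - real t))"

definition cusum :: "nat \<Rightarrow> nat \<Rightarrow> nat \<Rightarrow> (nat \<times> nat \<Rightarrow> real) \<Rightarrow> real" where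
  "cusum n t j x = (\<Sum>i\<in>{1..n}. cusum_weight n t i * x (j, i))"

lemma sum_step:
  fixes a b :: real
  assumes "t \<le> n"
  shows "(\<Sum>i\<in>{1..n}. if i \<le> t then a else b) = real t * a + (real n - real t) * b"
proof -
  have "(\<Sum>i\<in>{1..n}. if i \<le> t then a else b) = (\<Sum>i\<in>{1..n} \<inter> {i. i \<le> t}. a) + (\<Sum>i\<in>{1..n} \<inter> - {i. i \<le> t}. b)"
    by (rule sum.If_cases) simp
  also have "{1..n} \<inter> {i. i \<le> t} = {1..t}" using assms by auto
  also have "{1..n} \<inter> - {i. i \<le> t} = {t<..n}" by auto
  finally show ?thesis using assms by (simp add: of_nat_diff)
qed

text \<open>Each step function is a constant plus a multiple of an indicator of an initial segment,
  and two initial segments intersect in the one ending at the minimum.\<close>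

lemma sum_step_mult:
  fixes A B \<mu> \<nu> :: real
  assumes "t \<le> n" "t' \<le> n"
  shows "(\<Sum>i\<in>{1..n}. (if i \<le> t then A else B) * (if i \<le> t' then \<mu> else \<nu>))
    = real n * B * \<nu> + B * (\<mu> - \<nu>) * real t' + (A - B) * \<nu> * real t + (A - B) * (\<mu> - \<nu>) * real (min t t')"
proof -
  have 1: "(\<Sum>i\<in>{1..n}. if i \<le> k then c else 0) = real k * c" if "k \<le> n" for k and c :: real
    using sum_step[OF that, of c 0] by simp
  have "(\<Sum>i\<in>{1..n}. (if i \<le> t then A else B) * (if i \<le> t' then \<mu> else \<nu>))
    = (\<Sum>i\<in>{1..n}. B * \<nu> + (if i \<le> t' then B * (\<mu> - \<nu>) else 0) + (if i \<le> t then (A - B) * \<nu> else 0)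
        + (if i \<le> min t t' then (A - B) * (\<mu> - \<nu>) else 0))"
    by (rule sum.cong) (auto simp: algebra_simps)
  also have "\<dots> = real n * B * \<nu> + B * (\<mu> - \<nu>) * real t' + (A - B) * \<nu> * real t + (A - B) * (\<mu> - \<nu>) * real (min t t')"
    unfolding sum.distrib using assms by (subst (1 2 3) 1) auto
  finally show ?thesis .
qed

context
  fixes n t :: nat
  assumes t: "t \<in> {1..n-1}"
begin

lemma t_bounds: "0 < real t" "0 < real n - real t" "0 < real n" "t \<le> n"
  using t by auto

lemma cusum_weight_nz: "cusum_weight n t i \<noteq> 0"
  using t_bounds by (simp add: cusum_weight_def)

lemma sum_cusum_weight_sq: "(\<Sum>i\<in>{1..n}. (cusum_weight n t i)\<^sup>2) = 1"
proof -
  have "(\<Sum>i\<in>{1..n}. (cusum_weight n t i)\<^sup>2)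
     = (\<Sum>i\<in>{1..n}. if i \<le> t then (real t * (real n - real t) / real n) * (1 / real t)\<^sup>2
          else (real t * (real n - real t) / real n) * (1 / (real n - real t))\<^sup>2)"
    using t_bounds by (intro sum.cong) (auto simp: cusum_weight_def power_mult_distrib power_divide)
  also have "\<dots> = 1"
  proof -
    have *: "x * (x * v / (x + v) * (1 / x)\<^sup>2) + v * (x * v / (x + v) * (1 / v)\<^sup>2) = 1"
      if "0 < x" "0 < v" for x v :: real
    proof -
      have "x * (x * v / (x + v) * (1 / x)\<^sup>2) = v / (x + v)" "v * (x * v / (x + v) * (1 / v)\<^sup>2) = x / (x + v)"
        using that by (simp_all add: power2_eq_square)
      then have "x * (x * v / (x + v) * (1 / x)\<^sup>2) + v * (x * v / (x + v) * (1 / v)\<^sup>2) = (v + x) / (x + v)"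
        by (simp only: add_divide_distrib)
      then show ?thesis using that by simp
    qed
    show ?thesis
      using *[of "real t" "real n - real t"] t_bounds by (subst sum_step) auto
  qed
  finally show ?thesis .
qed

lemma cusum_step_mean:
  assumes t': "t' \<in> {1..n-1}" and \<theta>: "\<And>i. i \<in> {1..n} \<Longrightarrow> \<theta> (j, i) = (if i \<le> t' then \<mu> else \<nu>)"
  shows "cusum n t j \<theta> = sqrt (real t * (real n - real t) / real n) * (\<mu> - \<nu>)
     * (real n * real (min t t') - real t * real t') / (real t * (real n - real t))"
proof -
  let ?c = "sqrt (real t * (real n - real t) / real n)"
  have "cusum n t j \<theta> = (\<Sum>i\<in>{1..n}. (if i \<le> t then ?c / real t else - ?c / (real n - real t)) * (if i \<le> t' then \<mu> else \<nu>))"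
    unfolding cusum_def by (intro sum.cong) (auto simp: cusum_weight_def \<theta>)
  also have "\<dots> = real n * (- ?c / (real n - real t)) * \<nu> + (- ?c / (real n - real t)) * (\<mu> - \<nu>) * real t'
    + (?c / real t - (- ?c / (real n - real t))) * \<nu> * real t
    + (?c / real t - (- ?c / (real n - real t))) * (\<mu> - \<nu>) * real (min t t')"
    by (rule sum_step_mult) (use t t' in auto)
  also have "\<dots> = ?c * (\<mu> - \<nu>) * (real n * real (min t t') - real t * real t') / (real t * (real n - real t))"
  proof -
    have *: "N * (- c / v) * \<nu> + (- c / v) * (\<mu> - \<nu>) * y + (c / x - (- c / v)) * \<nu> * x + (c / x - (- c / v)) * (\<mu> - \<nu>) * z
       = c * (\<mu> - \<nu>) * (N * z - x * y) / (x * v)"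
      if "0 < x" "0 < v" "N = x + v" for x v N c y z :: real
      using that by (simp add: divide_simps) (simp add: algebra_simps)
    show ?thesis by (rule *) (use t_bounds in auto)
  qed
  finally show ?thesis .
qed

lemma cusum_const_mean:
  assumes "\<And>i. i \<in> {1..n} \<Longrightarrow> \<theta> (j, i) = c"
  shows "cusum n t j \<theta> = 0"
  using cusum_step_mean[OF t, of \<theta> j c c] assms by simp

text \<open>In the coordinate u = t / (n - t), the squared correlation between the statistics at t and t'
  is the ratio of the smaller to the larger coordinate.\<close>

lemma cusum_step_mean_ge:
  assumes t': "t' \<in> {1..n-1}" and \<theta>: "\<And>i. i \<in> {1..n} \<Longrightarrow> \<theta> (j, i) = (if i \<le> t' then \<mu> else \<nu>)"
    and e: "0 \<le> e"
    and near: "real t * (real n - real t') \<le> (1 + e) * (real t' * (real n - real t))"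
      "real t' * (real n - real t) \<le> (1 + e) * (real t * (real n - real t'))"
    and \<rho>: "0 \<le> \<rho>" "\<rho> \<le> sqrt (real t' * (real n - real t') / real n) * \<bar>\<mu> - \<nu>\<bar>"
  shows "\<rho> / sqrt (1 + e) \<le> \<bar>cusum n t j \<theta>\<bar>"
proof -
  have t'b: "0 < real t'" "0 < real n - real t'" using t' by auto
  define d where "d = (\<mu> - \<nu>)\<^sup>2"
  have d: "0 \<le> d" by (simp add: d_def)
  have sq: "(cusum n t j \<theta>)\<^sup>2 = d * (real n * real (min t t') - real t * real t')\<^sup>2 / (real n * (real t * (real n - real t)))"
  proof -
    have *: "(sqrt (x * v / N) * m * w / (x * v))\<^sup>2 = m\<^sup>2 * w\<^sup>2 / (N * (x * v))"
      if "0 < x" "0 < v" "0 < N" for x v N m w :: real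
      using that by (simp add: power_mult_distrib power_divide) (simp add: power2_eq_square field_simps)
    show ?thesis
      using cusum_step_mean[where j=j and \<theta>=\<theta>, OF t' \<theta>] t_bounds by (simp add: * d_def)
  qed
  \<comment> \<open>The claim without square roots: passing from t' to t loses at most a factor 1 +
    e in the squared mean. The order of t and t' decides which half of \<open>near\<close> carries
    the information.\<close>
  have *: "real t' * (real n - real t') / real n * d \<le> (1 + e) * (cusum n t j \<theta>)\<^sup>2"
  proof (cases "t \<le> t'")
    case True
    have "(real n * real (min t t') - real t * real t')\<^sup>2 / (real n * (real t * (real n - real t)))
       = real t * (real n - real t')\<^sup>2 / (real n * (real n - real t))"
    proof -
      have *: "(N * x - x * y)\<^sup>2 / (N * (x * v)) = x * (N - y)\<^sup>2 / (N * v)"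
        if "0 < x" "0 < v" "0 < N" for x y v N :: real
        using that by (simp add: power2_eq_square field_simps)
      show ?thesis
        using *[of "real t" "real n - real t" "real n" "real t'"] True t_bounds by (simp add: min_def)
    qed
    then have c: "(cusum n t j \<theta>)\<^sup>2 = d * (real t * (real n - real t')\<^sup>2 / (real n * (real n - real t)))"
      by (simp only: sq flip: times_divide_eq_right)
    have "real t' * (real n - real t') / real n = (real t' * (real n - real t)) * ((real n - real t') / (real n * (real n - real t)))"
      using t_bounds by (simp add: field_simps)
    also have "\<dots> \<le> ((1 + e) * (real t * (real n - real t'))) * ((real n - real t') / (real n * (real n - real t)))"
      using near(2) t_bounds t'b by (intro mult_right_mono) auto
    also have "\<dots> = (1 + e) * (real t * (real n - real t')\<^sup>2 / (real n * (real n - real t)))"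
      by (simp add: power2_eq_square)
    finally have "real t' * (real n - real t') / real n * d \<le> (1 + e) * (real t * (real n - real t')\<^sup>2 / (real n * (real n - real t))) * d"
      by (rule mult_right_mono[OF _ d])
    then show ?thesis by (simp add: c mult_ac)
  next
    case False
    have "(real n * real (min t t') - real t * real t')\<^sup>2 / (real n * (real t * (real n - real t)))
       = (real t')\<^sup>2 * (real n - real t) / (real n * real t)"
    proof -
      have *: "(N * y - x * y)\<^sup>2 / (N * (x * (N - x))) = y\<^sup>2 * (N - x) / (N * x)"
        if "0 < x" "0 < N - x" "0 < N" for x y N :: real
      proof -
        have "(N * y - x * y)\<^sup>2 = y\<^sup>2 * (N - x) * (N - x)"
          by (simp add: power2_eq_square algebra_simps)
        then show ?thesis using that by simp
      qed
      show ?thesis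
        using *[of "real t" "real n" "real t'"] False t_bounds by (simp add: min_def)
    qed
    then have c: "(cusum n t j \<theta>)\<^sup>2 = d * ((real t')\<^sup>2 * (real n - real t) / (real n * real t))"
      by (simp only: sq flip: times_divide_eq_right)
    have "real t' * (real n - real t') / real n = (real t * (real n - real t')) * (real t' / (real n * real t))"
      using t_bounds by (simp add: field_simps)
    also have "\<dots> \<le> ((1 + e) * (real t' * (real n - real t))) * (real t' / (real n * real t))"
      using near(1) t_bounds t'b by (intro mult_right_mono) auto
    also have "\<dots> = (1 + e) * ((real t')\<^sup>2 * (real n - real t) / (real n * real t))"
      by (simp add: power2_eq_square)
    finally have "real t' * (real n - real t') / real n * d \<le> (1 + e) * ((real t')\<^sup>2 * (real n - real t) / (real n * real t)) * d"
      by (rule mult_right_mono[OF _ d])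
    then show ?thesis by (simp add: c mult_ac)
  qed
  have "\<rho>\<^sup>2 \<le> (sqrt (real t' * (real n - real t') / real n) * \<bar>\<mu> - \<nu>\<bar>)\<^sup>2"
    using \<rho> by (intro power_mono)
  also have "\<dots> = real t' * (real n - real t') / real n * d"
    using t'b t_bounds by (simp add: power_mult_distrib d_def)
  also note *
  finally have "(\<rho> / sqrt (1 + e))\<^sup>2 \<le> (cusum n t j \<theta>)\<^sup>2"
    using e by (simp add: power_divide field_simps)
  then have "\<bar>\<rho> / sqrt (1 + e)\<bar> \<le> \<bar>cusum n t j \<theta>\<bar>" by (simp only: abs_le_square_iff)
  then show ?thesis by linarith
qed

end

text \<open>One representative is chosen in every bin of the logarithm of t / (n - t).\<close>

lemma geometric_grid:
  assumes n: "2 \<le> n" and e: "0 < e"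
  obtains T where "T \<subseteq> {1..n-1}" "real (card T) \<le> 2 * ln (real n) / ln (1 + e) + 2"
    "\<And>t'. t' \<in> {1..n-1} \<Longrightarrow> \<exists>t\<in>T. real t * (real n - real t') \<le> (1 + e) * (real t' * (real n - real t)) \<and>
      real t' * (real n - real t) \<le> (1 + e) * (real t * (real n - real t'))"
proof -
  define L where "L = ln (1 + e)"
  have L: "0 < L" using e by (simp add: L_def)
  \<comment> \<open>Logarithmic odds in units of \<open>L\<close>: locations with equal integer part
    have odds within a factor 1 + e of each other, which is the pair of inequalities asked
    for.\<close>
  define u where "u = (\<lambda>t::nat. ln (real t / (real n - real t)) / L)"
  define b where "b = (\<lambda>t. \<lfloor>u t\<rfloor>)"
  define T where "T = inv_into {1..n-1} b ` b ` {1..n-1}"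
  have "T \<subseteq> {1..n-1}"
    unfolding T_def by (auto intro!: inv_into_into simp del: atLeastAtMost_iff)
  moreover have "real (card T) \<le> 2 * ln (real n) / ln (1 + e) + 2"
  proof -
    define K where "K = ln (real n) / L"
    have K: "0 \<le> K" using n L by (simp add: K_def)
    \<comment> \<open>The odds lie between 1/n and n, so the number of bins is only logarithmic in
      n; this keeps the union bound at cost log log n.\<close>
    have "b ` {1..n-1} \<subseteq> {\<lfloor>- K\<rfloor>..\<lfloor>K\<rfloor>}"
    proof safe
      fix t assume t: "t \<in> {1..n-1}"
      have "real t / (real n - real t) \<le> real n / 1" "1 / real n \<le> real t / (real n - real t)"
        proof -
        have "1 \<le> real n - real t" "real t \<le> real n" "1 \<le> real t" "0 < real n" using t n by auto
        then show "real t / (real n - real t) \<le> real n / 1" "1 / real n \<le> real t / (real n - real t)"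
          by (intro frac_le; simp)+
      qed
      then have "ln (real t / (real n - real t)) \<le> ln (real n)" "ln (1 / real n) \<le> ln (real t / (real n - real t))"
        using t n by (auto intro!: ln_mono simp del: ln_div)
      then have "ln (real t / (real n - real t)) \<le> ln (real n)" "- ln (real n) \<le> ln (real t / (real n - real t))"
        using n by (auto simp: ln_div)
      then have "u t \<le> K" "- K \<le> u t"
        using L divide_right_mono[of "- ln (real n)" "ln (real t / (real n - real t))" L]
        by (auto simp: u_def K_def divide_right_mono)
      then show "b t \<in> {\<lfloor>- K\<rfloor>..\<lfloor>K\<rfloor>}" unfolding b_def by (auto intro!: floor_mono)
    qed
    then have "card (b ` {1..n-1}) \<le> card {\<lfloor>- K\<rfloor>..\<lfloor>K\<rfloor>}" by (intro card_mono) auto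
    then have "card T \<le> card {\<lfloor>- K\<rfloor>..\<lfloor>K\<rfloor>}"
      unfolding T_def using card_image_le[of "b ` {1..n-1}" "inv_into {1..n-1} b"] by simp
    then have "real (card T) \<le> real (nat (\<lfloor>K\<rfloor> - \<lfloor>- K\<rfloor> + 1))" by simp
    also have "\<dots> = of_int (\<lfloor>K\<rfloor> - \<lfloor>- K\<rfloor> + 1)" using K by (intro of_nat_nat) linarith
    also have "\<dots> \<le> 2 * K + 2" by (simp, linarith)
    finally show ?thesis by (simp add: K_def L_def)
  qed
  moreover have "\<exists>t\<in>T. real t * (real n - real t') \<le> (1 + e) * (real t' * (real n - real t)) \<and>
      real t' * (real n - real t) \<le> (1 + e) * (real t * (real n - real t'))" if t': "t' \<in> {1..n-1}" for t'
  proof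
    define t where "t = inv_into {1..n-1} b (b t')"
    show "t \<in> T" using t' by (simp add: T_def t_def)
    have t: "t \<in> {1..n-1}" unfolding t_def using t' by (intro inv_into_into) simp
    have bt: "b t = b t'" unfolding t_def using t' by (intro f_inv_into_f) simp
    have key: "real x * (real n - real y) \<le> (1 + e) * (real y * (real n - real x))"
      if x: "x \<in> {1..n-1}" and y: "y \<in> {1..n-1}" and xy: "b x = b y" for x y
    proof -
      have p: "0 < real x" "0 < real n - real x" "0 < real y" "0 < real n - real y" using x y by auto
      have "u x \<le> 1 + u y" using xy unfolding b_def by linarith
      then have "ln (real x / (real n - real x)) \<le> L + ln (real y / (real n - real y))"
        using L by (simp add: u_def field_simps)
      also have "\<dots> = ln ((1 + e) * (real y / (real n - real y)))"
        using p e by (subst ln_mult_pos) (auto simp: L_def)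
      finally have "real x / (real n - real x) \<le> (1 + e) * (real y / (real n - real y))"
        using p e by (subst (asm) ln_le_cancel_iff) (auto intro!: mult_pos_pos)
      then show ?thesis using p by (simp add: field_simps)
    qed
    show "real t * (real n - real t') \<le> (1 + e) * (real t' * (real n - real t)) \<and>
      real t' * (real n - real t) \<le> (1 + e) * (real t * (real n - real t'))"
      using key[OF t t' bt] key[OF t' t bt[symmetric]] by simp
  qed
  ultimately show thesis by (rule that)
qed

section \<open>Chernoff bounds and scan tests\<close>

text \<open>The count is a sum of independent Bernoulli variables with success probabilities
  \<open>exceed_prob (m j) \<tau>\<close>.\<close>

lemma (in prob_space) exceed_count_mgf:
  fixes X :: "'i \<Rightarrow> 'a \<Rightarrow> real" and c :: real
  assumes I: "finite I" "indep_vars (\<lambda>_. borel) X I"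
    and X: "\<And>j. j \<in> I \<Longrightarrow> distributed M lborel (X j) (normal_density (m j) 1)"
  shows "integrable M (\<lambda>x. exp (c * (\<Sum>j\<in>I. of_bool (\<tau> \<le> \<bar>X j x\<bar>))))"
    and "expectation (\<lambda>x. exp (c * (\<Sum>j\<in>I. of_bool (\<tau> \<le> \<bar>X j x\<bar>)))) = (\<Prod>j\<in>I. 1 + exceed_prob (m j) \<tau> * (exp c - 1))"
proof -
  let ?g = "\<lambda>y::real. exp (c * of_bool (\<tau> \<le> \<bar>y\<bar>))"
  have eq: "exp (c * (\<Sum>j\<in>I. of_bool (\<tau> \<le> \<bar>X j x\<bar>))) = (\<Prod>j\<in>I. ?g (X j x))" for x
    by (simp only: sum_distrib_left exp_sum[OF I(1)])
  have ind: "indep_vars (\<lambda>_. borel) (\<lambda>j x. ?g (X j x)) I"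
    by (rule indep_vars_compose2[OF I(2)]) measurable
  have rv: "random_variable borel (X j)" if "j \<in> I" for j
    using I(2) that by (auto simp: indep_vars_def)
  have int: "integrable M (\<lambda>x. ?g (X j x))" if "j \<in> I" for j
  proof (rule integrable_const_bound[where B="exp \<bar>c\<bar>"])
    show "AE x in M. norm (?g (X j x)) \<le> exp \<bar>c\<bar>" by (auto simp: of_bool_def)
    show "(\<lambda>x. ?g (X j x)) \<in> borel_measurable M" using rv[OF that] by measurable
  qed
  have E: "expectation (\<lambda>x. ?g (X j x)) = 1 + exceed_prob (m j) \<tau> * (exp c - 1)" if j: "j \<in> I" for j
  proof -
    note rv[OF j, measurable]
    have "expectation (\<lambda>x. ?g (X j x)) = expectation (\<lambda>x. 1 + (exp c - 1) * indicator {x\<in>space M. \<tau> \<le> \<bar>X j x\<bar>} x)"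
      by (rule Bochner_Integration.integral_cong) (auto simp: indicator_def)
    also have "\<dots> = 1 + (exp c - 1) * prob {x\<in>space M. \<tau> \<le> \<bar>X j x\<bar>}"
      by (subst Bochner_Integration.integral_add) (auto simp: prob_space less_top[symmetric])
    also have "prob {x\<in>space M. \<tau> \<le> \<bar>X j x\<bar>} = measure (distr M lborel (X j)) {y. \<tau> \<le> \<bar>y\<bar>}"
      by (subst measure_distr) (auto intro!: arg_cong[where f=prob])
    also have "\<dots> = exceed_prob (m j) \<tau>"
      using X[OF j] by (simp add: distributed_def exceed_prob_def)
    finally show ?thesis by (simp add: mult.commute)
  qed
  show "integrable M (\<lambda>x. exp (c * (\<Sum>j\<in>I. of_bool (\<tau> \<le> \<bar>X j x\<bar>))))"
    unfolding eq by (rule indep_vars_integrable[OF I(1) ind int])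
  show "expectation (\<lambda>x. exp (c * (\<Sum>j\<in>I. of_bool (\<tau> \<le> \<bar>X j x\<bar>)))) = (\<Prod>j\<in>I. 1 + exceed_prob (m j) \<tau> * (exp c - 1))"
    unfolding eq by (subst indep_vars_lebesgue_integral[OF I(1) ind int]) (auto intro: prod.cong E)
qed

text \<open>Markov's inequality with 1 + x \<le> exp x, which dominates the count by a Poisson
  variable and leaves only the expected count. The sign of c is free: c > 0 gives the upper tail, c
  < 0 the lower one.\<close>

lemma (in prob_space) exceed_count_tail:
  fixes X :: "'i \<Rightarrow> 'a \<Rightarrow> real" and c k :: real
  assumes I: "finite I" "indep_vars (\<lambda>_. borel) X I"
    and X: "\<And>j. j \<in> I \<Longrightarrow> distributed M lborel (X j) (normal_density (m j) 1)"
  shows "prob {x\<in>space M. c * k \<le> c * (\<Sum>j\<in>I. of_bool (\<tau> \<le> \<bar>X j x\<bar>))}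
    \<le> exp ((\<Sum>j\<in>I. exceed_prob (m j) \<tau>) * (exp c - 1) - c * k)"
proof -
  let ?N = "\<lambda>x. \<Sum>j\<in>I. of_bool (\<tau> \<le> \<bar>X j x\<bar>) :: real"
  have "prob {x\<in>space M. c * k \<le> c * ?N x} = prob {x\<in>space M. exp (c * k) \<le> exp (c * ?N x)}" by simp
  also have "\<dots> \<le> expectation (\<lambda>x. exp (c * ?N x)) / exp (c * k)"
    by (rule integral_Markov_inequality_measure[OF exceed_count_mgf(1)[OF I X] sets.top]) auto
  also have "\<dots> = (\<Prod>j\<in>I. 1 + exceed_prob (m j) \<tau> * (exp c - 1)) / exp (c * k)"
    by (subst exceed_count_mgf(2)[OF I X]) auto
  also have "\<dots> \<le> (\<Prod>j\<in>I. exp (exceed_prob (m j) \<tau> * (exp c - 1))) / exp (c * k)"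
  proof (intro divide_right_mono prod_mono conjI)
    fix j
    have "0 \<le> (1 - exceed_prob (m j) \<tau>) + exceed_prob (m j) \<tau> * exp c"
      using exceed_prob_le_1 exceed_prob_nonneg by (intro add_nonneg_nonneg mult_nonneg_nonneg) auto
    then show "0 \<le> 1 + exceed_prob (m j) \<tau> * (exp c - 1)" by (simp add: algebra_simps)
  qed (auto simp: exp_ge_add_one_self)
  also have "\<dots> = exp ((\<Sum>j\<in>I. exceed_prob (m j) \<tau>) * (exp c - 1) - c * k)"
    using I(1) by (simp add: exp_diff exp_sum sum_distrib_right)
  finally show ?thesis .
qed

section \<open>Risk bounds and the finite-sample scan test\<close>

lemma test_integrable:
  assumes "\<psi> \<in> tests p n"
  shows "integrable (obs_model p n \<theta>) \<psi>"
    and "0 \<le> integral\<^sup>L (obs_model p n \<theta>) \<psi>" and "integral\<^sup>L (obs_model p n \<theta>) \<psi> \<le> 1"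
    and "0 \<le> integral\<^sup>L (obs_model p n \<theta>) (\<lambda>x. 1 - \<psi> x)" and "integral\<^sup>L (obs_model p n \<theta>) (\<lambda>x. 1 - \<psi> x) \<le> 1"
proof -
  interpret prob_space "obs_model p n \<theta>" by (rule prob_space_obs_model)
  have m: "\<psi> \<in> borel_measurable (obs_model p n \<theta>)"
    using assms by (simp add: tests_def measurable_cong_sets[OF sets_obs_model refl])
  have b: "\<psi> x = 0 \<or> \<psi> x = 1" if "x \<in> space (obs_model p n \<theta>)" for x
    using assms that by (auto simp: tests_def space_obs_model space_PiM)
  show int: "integrable (obs_model p n \<theta>) \<psi>"
    by (rule integrable_const_bound[where B=1]) (use b m in fastforce)+
  show 1: "0 \<le> integral\<^sup>L (obs_model p n \<theta>) \<psi>"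
    by (rule Bochner_Integration.integral_nonneg) (use b in fastforce)
  show 2: "integral\<^sup>L (obs_model p n \<theta>) \<psi> \<le> 1"
    by (rule integral_le_const[OF int]) (use b in fastforce)
  show "0 \<le> integral\<^sup>L (obs_model p n \<theta>) (\<lambda>x. 1 - \<psi> x)" "integral\<^sup>L (obs_model p n \<theta>) (\<lambda>x. 1 - \<psi> x) \<le> 1"
    using 1 2 int by (simp_all add: prob_space)
qed

text \<open>The risk consists of infima and suprema of reals, which are meaningful only for bounded
  nonempty sets. Error probabilities in [0, 1] give boundedness; nonemptiness of the alternative
  class is either assumed or comes with the witness. For lower bounds the null supremum is reduced
  to the single point \<theta> = 0.\<close>

lemma risk_2side_nonneg: "Theta1_2side p n \<rho> s \<noteq> {} \<Longrightarrow> 0 \<le> risk_2side p n \<rho> s"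
  and risk_2side_le:
  "\<lbrakk>\<psi> \<in> tests p n; \<And>\<theta>. \<theta> \<in> Theta0 p n \<Longrightarrow> integral\<^sup>L (obs_model p n \<theta>) \<psi> \<le> A;
    \<And>\<theta>. \<theta> \<in> Theta1_2side p n \<rho> s \<Longrightarrow> integral\<^sup>L (obs_model p n \<theta>) (\<lambda>x. 1 - \<psi> x) \<le> B;
    Theta1_2side p n \<rho> s \<noteq> {}\<rbrakk> \<Longrightarrow> risk_2side p n \<rho> s \<le> A + B"
  and risk_2side_ge:
  "\<lbrakk>\<And>\<psi>. \<psi> \<in> tests p n \<Longrightarrow> \<exists>\<theta>\<in>Theta1_2side p n \<rho> s.
       C \<le> integral\<^sup>L (obs_model p n (\<lambda>_. 0)) \<psi> + integral\<^sup>L (obs_model p n \<theta>) (\<lambda>x. 1 - \<psi> x)\<rbrakk>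
    \<Longrightarrow> C \<le> risk_2side p n \<rho> s"
proof -
  let ?A = "\<lambda>\<psi>. SUP \<theta> \<in> Theta0 p n. integral\<^sup>L (obs_model p n \<theta>) \<psi>"
  let ?B = "\<lambda>\<psi>. SUP \<theta> \<in> Theta1_2side p n \<rho> s. integral\<^sup>L (obs_model p n \<theta>) (\<lambda>x. 1 - \<psi> x)"
  have 0: "(\<lambda>_. 0) \<in> Theta0 p n" by (simp add: Theta0_def)
  have ne: "(\<lambda>_. 0) \<in> tests p n" by (simp add: tests_def)
  have bdd: "bdd_above ((\<lambda>\<theta>. integral\<^sup>L (obs_model p n \<theta>) \<psi>) ` \<Theta>)"
    "bdd_above ((\<lambda>\<theta>. integral\<^sup>L (obs_model p n \<theta>) (\<lambda>x. 1 - \<psi> x)) ` \<Theta>)" if "\<psi> \<in> tests p n" for \<psi> \<Theta>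
    using test_integrable[OF that] by (auto intro!: bdd_aboveI[of _ 1])
  have Age: "integral\<^sup>L (obs_model p n (\<lambda>_. 0)) \<psi> \<le> ?A \<psi>" if "\<psi> \<in> tests p n" for \<psi>
    by (rule cSUP_upper[OF 0 bdd(1)[OF that]])
  have Bge: "integral\<^sup>L (obs_model p n \<theta>) (\<lambda>x. 1 - \<psi> x) \<le> ?B \<psi>"
    if "\<psi> \<in> tests p n" "\<theta> \<in> Theta1_2side p n \<rho> s" for \<psi> \<theta>
    by (rule cSUP_upper[OF that(2) bdd(2)[OF that(1)]])
  have nn: "0 \<le> ?A \<psi> + ?B \<psi>" if \<psi>: "\<psi> \<in> tests p n" and ne1: "Theta1_2side p n \<rho> s \<noteq> {}" for \<psi>
  proof -
    obtain \<theta> where "\<theta> \<in> Theta1_2side p n \<rho> s" using ne1 by auto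
    then show ?thesis using Age[OF \<psi>] Bge[OF \<psi>, of \<theta>] test_integrable(2,4)[OF \<psi>] by (smt (verit))
  qed
  show "0 \<le> risk_2side p n \<rho> s" if "Theta1_2side p n \<rho> s \<noteq> {}"
    unfolding risk_2side_def by (rule cINF_greatest) (use nn that ne in auto)
  show "risk_2side p n \<rho> s \<le> A + B"
    if \<psi>: "\<psi> \<in> tests p n" and A: "\<And>\<theta>. \<theta> \<in> Theta0 p n \<Longrightarrow> integral\<^sup>L (obs_model p n \<theta>) \<psi> \<le> A"
      and B: "\<And>\<theta>. \<theta> \<in> Theta1_2side p n \<rho> s \<Longrightarrow> integral\<^sup>L (obs_model p n \<theta>) (\<lambda>x. 1 - \<psi> x) \<le> B"
      and ne1: "Theta1_2side p n \<rho> s \<noteq> {}"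
  proof -
    have "risk_2side p n \<rho> s \<le> ?A \<psi> + ?B \<psi>"
      unfolding risk_2side_def by (rule cINF_lower[OF bdd_belowI[of _ 0] \<psi>]) (use nn ne1 in auto)
    also have "\<dots> \<le> A + B"
      by (intro add_mono cSUP_least) (use 0 A B ne1 in auto)
    finally show ?thesis .
  qed
  show "C \<le> risk_2side p n \<rho> s"
    if *: "\<And>\<psi>. \<psi> \<in> tests p n \<Longrightarrow> \<exists>\<theta>\<in>Theta1_2side p n \<rho> s.
       C \<le> integral\<^sup>L (obs_model p n (\<lambda>_. 0)) \<psi> + integral\<^sup>L (obs_model p n \<theta>) (\<lambda>x. 1 - \<psi> x)"
    unfolding risk_2side_def
  proof (rule cINF_greatest)
    fix \<psi> assume \<psi>: "\<psi> \<in> tests p n"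
    from *[OF this] Age[OF this] Bge[OF this] show "C \<le> ?A \<psi> + ?B \<psi>" by fastforce
  qed (use ne in auto)
qed

lemma Theta1_2side_nonempty:
  assumes "2 \<le> n" "s \<le> p"
  shows "Theta1_2side p n \<rho> s \<noteq> {}"
proof -
  define c where "c = sqrt (real 1 * (real n - real 1) / real n)"
  have c: "0 < c" using assms by (simp add: c_def)
  \<comment> \<open>Every row jumps after the first column, by the height that yields strength
    \<bar>\<rho>\<bar>.\<close>
  have "(\<lambda>(j, i). if i \<le> 1 then \<bar>\<rho>\<bar> / c else 0) \<in> Theta1_2side p n \<rho> s"
    unfolding Theta1_2side_def mem_Collect_eq
    by (rule bexI[of _ 1], rule exI[of _ "\<lambda>_. \<bar>\<rho>\<bar> / c"], rule exI[of _ "\<lambda>_. 0"], rule exI[of _ "{1..p}"])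
       (use assms c c_def in auto)
  then show ?thesis by blast
qed

text \<open>\<open>k\<close> is the critical count, \<open>\<Delta>\<close> the gain in exceedance
  probability of a signal row, and c0, c1 are the Chernoff parameters under the null and the
  alternative. They are kept separate because strong signals require c0 to grow while c1 stays
  fixed.\<close>

lemma risk_2side_count_le:
  fixes p n s :: nat and e \<tau> \<rho> \<Delta> c0 c1 k :: real
  assumes n: "2 \<le> n" and s: "s \<le> p" and e: "0 < e" and \<tau>: "0 \<le> \<tau>" and \<rho>: "0 \<le> \<rho>" and c: "0 \<le> c0" "0 \<le> c1"
    and \<Delta>: "0 \<le> \<Delta>" "\<And>m. \<rho> / sqrt (1 + e) \<le> \<bar>m\<bar> \<Longrightarrow> exceed_prob 0 \<tau> + \<Delta> \<le> exceed_prob m \<tau>"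
  shows "risk_2side p n \<rho> s \<le>
      (2 * ln (real n) / ln (1 + e) + 2) * exp (real p * exceed_prob 0 \<tau> * (exp c0 - 1) - c0 * k)
      + exp (c1 * k - (real p * exceed_prob 0 \<tau> + real s * \<Delta>) * (1 - exp (- c1)))"
proof -
  obtain T where T: "T \<subseteq> {1..n-1}" "real (card T) \<le> 2 * ln (real n) / ln (1 + e) + 2"
    and near: "\<And>t'. t' \<in> {1..n-1} \<Longrightarrow> \<exists>t\<in>T. real t * (real n - real t') \<le> (1 + e) * (real t' * (real n - real t)) \<and>
      real t' * (real n - real t) \<le> (1 + e) * (real t * (real n - real t'))"
    by (rule geometric_grid[OF n e]) blast
  have finT: "finite T" using T(1) finite_subset by blast
  define N where "N = (\<lambda>t x. \<Sum>j\<in>{1..p}. of_bool (\<tau> \<le> \<bar>cusum n t j x\<bar>) :: real)"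
  define \<psi> :: "(nat \<times> nat \<Rightarrow> real) \<Rightarrow> real" where "\<psi> = (\<lambda>x. of_bool (\<exists>t\<in>T. k \<le> N t x))"
  let ?P = "PiM (idx p n) (\<lambda>_. borel :: real measure)"
  have cusum_meas: "cusum n t j \<in> borel_measurable ?P" if "j \<in> {1..p}" for t j
    unfolding cusum_def using that
    by (auto intro!: borel_measurable_sum borel_measurable_times measurable_component_singleton simp: idx_def)
  have N_meas [measurable]: "N t \<in> borel_measurable ?P" for t
  proof -
    have "(\<lambda>x. of_bool (\<tau> \<le> \<bar>cusum n t j x\<bar>) :: real) \<in> borel_measurable ?P" if "j \<in> {1..p}" for j
      using cusum_meas[OF that, of t] by measurable
    then show ?thesis unfolding N_def by (rule borel_measurable_sum)
  qed
  have \<psi>_test: "\<psi> \<in> tests p n"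
  proof -
    have "\<psi> \<in> borel_measurable ?P"
    proof -
      have "(indicator (\<Union>t\<in>T. {x\<in>space ?P. k \<le> N t x}) :: _ \<Rightarrow> real) \<in> borel_measurable ?P"
        using finT by (intro borel_measurable_indicator sets.finite_UN) measurable
      then show ?thesis
        by (rule measurable_cong[THEN iffD1, rotated]) (auto simp: \<psi>_def indicator_def)
    qed
    then show ?thesis by (auto simp: tests_def \<psi>_def)
  qed
  have dist: "distributed (obs_model p n \<theta>) lborel (cusum n t j) (normal_density (cusum n t j \<theta>) 1)"
    if "t \<in> {1..n-1}" "j \<in> {1..p}" for \<theta> t j
    unfolding cusum_def[abs_def]
    by (rule distributed_row_statistic) (use that n cusum_weight_nz sum_cusum_weight_sq in auto)
  have ind: "prob_space.indep_vars (obs_model p n \<theta>) (\<lambda>_. borel) (\<lambda>j. cusum n t j) {1..p}" for \<theta> t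
    unfolding cusum_def[abs_def] by (rule indep_vars_row_statistic) simp
  let ?q = "exceed_prob 0 \<tau>"
  have null: "integral\<^sup>L (obs_model p n \<theta>) \<psi> \<le>
      (2 * ln (real n) / ln (1 + e) + 2) * exp (real p * ?q * (exp c0 - 1) - c0 * k)"
    if \<theta>: "\<theta> \<in> Theta0 p n" for \<theta>
  proof -
    interpret prob_space "obs_model p n \<theta>" by (rule prob_space_obs_model)
    let ?M = "obs_model p n \<theta>"
    have [measurable]: "N t \<in> borel_measurable ?M" for t
      using N_meas by (simp add: measurable_cong_sets[OF sets_obs_model refl])
    have E: "prob {x\<in>space ?M. k \<le> N t x} \<le> exp (real p * ?q * (exp c0 - 1) - c0 * k)" if t: "t \<in> T" for t
    proof -
      have t': "t \<in> {1..n-1}" using t T(1) by auto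
      have z: "cusum n t j \<theta> = 0" if "j \<in> {1..p}" for j
      proof (rule cusum_const_mean[OF t'])
        fix i assume "i \<in> {1..n}"
        moreover have "1 \<in> {1..n}" using n by simp
        ultimately show "\<theta> (j, i) = \<theta> (j, 1)"
          using \<theta> \<open>j \<in> {1..p}\<close> unfolding Theta0_def mem_Collect_eq by blast
      qed
      have "prob {x\<in>space ?M. k \<le> N t x} \<le> prob {x\<in>space ?M. c0 * k \<le> c0 * N t x}"
        by (rule finite_measure_mono) (auto intro: mult_left_mono c)
      also have "\<dots> \<le> exp ((\<Sum>j\<in>{1..p}. exceed_prob (cusum n t j \<theta>) \<tau>) * (exp c0 - 1) - c0 * k)"
        unfolding N_def by (rule exceed_count_tail[OF _ ind dist[OF t']]) auto
      also have "\<dots> = exp (real p * ?q * (exp c0 - 1) - c0 * k)"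
        by (simp add: z)
      finally show ?thesis .
    qed
    have "integral\<^sup>L ?M \<psi> = integral\<^sup>L ?M (indicator (\<Union>t\<in>T. {x\<in>space ?M. k \<le> N t x}))"
      by (rule Bochner_Integration.integral_cong) (auto simp: \<psi>_def indicator_def)
    also have "\<dots> = prob (\<Union>t\<in>T. {x\<in>space ?M. k \<le> N t x})"
      using finT by (auto intro!: arg_cong[where f=prob])
    also have "\<dots> \<le> (\<Sum>t\<in>T. prob {x\<in>space ?M. k \<le> N t x})"
      by (rule finite_measure_subadditive_finite[OF finT]) auto
    also have "\<dots> \<le> (\<Sum>t\<in>T. exp (real p * ?q * (exp c0 - 1) - c0 * k))"
      by (rule sum_mono[OF E])
    also have "\<dots> = real (card T) * exp (real p * ?q * (exp c0 - 1) - c0 * k)" by simp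
    also have "\<dots> \<le> (2 * ln (real n) / ln (1 + e) + 2) * exp (real p * ?q * (exp c0 - 1) - c0 * k)"
      by (rule mult_right_mono[OF T(2)]) simp
    finally show ?thesis .
  qed
  have alt: "integral\<^sup>L (obs_model p n \<theta>) (\<lambda>x. 1 - \<psi> x) \<le> exp (c1 * k - (real p * ?q + real s * \<Delta>) * (1 - exp (- c1)))"
    if \<theta>: "\<theta> \<in> Theta1_2side p n \<rho> s" for \<theta>
  proof -
    interpret prob_space "obs_model p n \<theta>" by (rule prob_space_obs_model)
    let ?M = "obs_model p n \<theta>"
    have [measurable]: "N t \<in> borel_measurable ?M" for t
      using N_meas by (simp add: measurable_cong_sets[OF sets_obs_model refl])
    from \<theta> obtain t' \<mu>1 \<mu>2 S where t': "t' \<in> {1..n-1}" and S: "S \<subseteq> {1..p}" "s \<le> card S"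
      and \<theta>eq: "\<And>j i. j \<in> {1..p} \<Longrightarrow> i \<in> {1..n} \<Longrightarrow> \<theta> (j, i) = (if i \<le> t' then \<mu>1 j else \<mu>2 j)"
      and big: "\<And>j. j \<in> S \<Longrightarrow> \<rho> \<le> sqrt (real t' * (real n - real t') / real n) * \<bar>\<mu>1 j - \<mu>2 j\<bar>"
      unfolding Theta1_2side_def by auto
    \<comment> \<open>Only the grid point near the true location is needed: acceptance forces the
      count there below \<open>k\<close>.\<close>
    obtain t where t: "t \<in> T" and nr: "real t * (real n - real t') \<le> (1 + e) * (real t' * (real n - real t))"
      "real t' * (real n - real t) \<le> (1 + e) * (real t * (real n - real t'))"
      using near[OF t'] by blast
    have tn: "t \<in> {1..n-1}" using t T(1) by auto
    \<comment> \<open>Signal rows gain at least \<open>\<Delta>\<close> each, and all other rows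
      contribute at least their null probability.\<close>
    have mean: "real p * ?q + real s * \<Delta> \<le> (\<Sum>j\<in>{1..p}. exceed_prob (cusum n t j \<theta>) \<tau>)"
    proof -
      have "real p * ?q + real s * \<Delta> \<le> real p * ?q + real (card S) * \<Delta>"
        using S(2) \<Delta>(1) by (intro add_left_mono mult_right_mono) auto
      also have "real (card S) * \<Delta> = (\<Sum>j\<in>{1..p}. if j \<in> S then \<Delta> else 0)"
        using S(1) by (simp add: sum.If_cases Int_absorb1)
      also have "real p * ?q + \<dots> = (\<Sum>j\<in>{1..p}. ?q + (if j \<in> S then \<Delta> else 0))"
        by (simp add: sum.distrib)
      also have "\<dots> \<le> (\<Sum>j\<in>{1..p}. exceed_prob (cusum n t j \<theta>) \<tau>)"
      proof (rule sum_mono)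
        fix j assume j: "j \<in> {1..p}"
        show "?q + (if j \<in> S then \<Delta> else 0) \<le> exceed_prob (cusum n t j \<theta>) \<tau>"
        proof (cases "j \<in> S")
          case True
          have "\<rho> / sqrt (1 + e) \<le> \<bar>cusum n t j \<theta>\<bar>"
            by (rule cusum_step_mean_ge[OF tn t' \<theta>eq[OF j] _ nr \<rho> big[OF True]]) (use e in auto)
          then show ?thesis using True \<Delta>(2) by simp
        qed (simp add: exceed_prob_mono_0[OF \<tau>])
      qed
      finally show ?thesis .
    qed
    have "integral\<^sup>L ?M (\<lambda>x. 1 - \<psi> x) \<le> integral\<^sup>L ?M (indicator {x\<in>space ?M. (- c1) * k \<le> (- c1) * N t x})"
    proof (rule integral_mono)
      show "integrable ?M (\<lambda>x. 1 - \<psi> x)"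
        using test_integrable(1)[OF \<psi>_test] by auto
      fix x assume "x \<in> space ?M"
      then show "1 - \<psi> x \<le> indicator {x\<in>space ?M. (- c1) * k \<le> (- c1) * N t x} x"
      proof (cases "k \<le> N t x")
        case True
        then show ?thesis using t by (auto simp: \<psi>_def)
      next
        case False
        then have "c1 * N t x \<le> c1 * k" using c by (intro mult_left_mono) auto
        then show ?thesis using \<open>x \<in> space ?M\<close> by (simp add: \<psi>_def)
      qed
    qed (auto simp: less_top[symmetric])
    also have "\<dots> = prob {x\<in>space ?M. (- c1) * k \<le> (- c1) * N t x}" by simp
    also have "\<dots> \<le> exp ((\<Sum>j\<in>{1..p}. exceed_prob (cusum n t j \<theta>) \<tau>) * (exp (- c1) - 1) - (- c1) * k)"
      unfolding N_def by (rule exceed_count_tail[OF _ ind dist[OF tn]]) auto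
    also have "\<dots> \<le> exp (c1 * k - (real p * ?q + real s * \<Delta>) * (1 - exp (- c1)))"
      using mult_right_mono[OF mean, of "1 - exp (- c1)"] c by (simp add: algebra_simps)
    finally show ?thesis .
  qed
  show ?thesis
    by (rule risk_2side_le[OF \<psi>_test null alt Theta1_2side_nonempty[OF n s]])
qed

section \<open>Mixtures of likelihood ratios\<close>

text \<open>\<open>J\<close> is the likelihood ratio at one location cut off at T = m/4, and
  \<open>D\<close> its average over locations. Cutting costs at most 1/16 in mean, so E D \<ge>
  15/16, while E D^2 is at most 9/8 from distinct locations plus T/m = 1/4 from the diagonal. Hence
  E (D - D^2/2) \<ge> 15/16 - 11/16 = 1/4.\<close>

lemma (in prob_space) mixture_testing_bound:
  fixes \<Lambda> :: "'k \<Rightarrow> 'w \<Rightarrow> 'a \<Rightarrow> real" and h :: real and \<psi> :: "'a \<Rightarrow> real"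
  assumes K: "finite K" "K \<noteq> {}" and W: "finite W" "W \<noteq> {}" and h: "0 < h"
    and int: "\<And>k w. k \<in> K \<Longrightarrow> w \<in> W \<Longrightarrow> integrable M (\<Lambda> k w)"
    and nonneg: "\<And>k w x. 0 \<le> \<Lambda> k w x"
    and one: "\<And>k w. k \<in> K \<Longrightarrow> w \<in> W \<Longrightarrow> expectation (\<Lambda> k w) = 1"
    and cross: "\<And>k w k' w'. k \<in> K \<Longrightarrow> w \<in> W \<Longrightarrow> k' \<in> K \<Longrightarrow> w' \<in> W \<Longrightarrow> k \<noteq> k' \<Longrightarrow> integrable M (\<lambda>x. \<Lambda> k w x * \<Lambda> k' w' x)"
      "\<And>k w k' w'. k \<in> K \<Longrightarrow> w \<in> W \<Longrightarrow> k' \<in> K \<Longrightarrow> w' \<in> W \<Longrightarrow> k \<noteq> k' \<Longrightarrow> expectation (\<lambda>x. \<Lambda> k w x * \<Lambda> k' w' x) \<le> 9 / 8"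
    and moment: "\<And>k. k \<in> K \<Longrightarrow> integrable M (\<lambda>x. ((\<Sum>w\<in>W. \<Lambda> k w x) / real (card W)) powr (1 + h))"
      "\<And>k. k \<in> K \<Longrightarrow> expectation (\<lambda>x. ((\<Sum>w\<in>W. \<Lambda> k w x) / real (card W)) powr (1 + h)) \<le> (real (card K) / 4) powr h / 16"
    and \<psi>: "\<psi> \<in> borel_measurable M" "\<And>x. x \<in> space M \<Longrightarrow> \<psi> x \<in> {0, 1}"
  shows "\<exists>k\<in>K. \<exists>w\<in>W. 1 / 4 \<le> expectation \<psi> + expectation (\<lambda>x. \<Lambda> k w x * (1 - \<psi> x))"
proof -
  define m where "m = real (card K)"
  define v where "v = real (card W)"
  have m: "0 < m" and v: "0 < v" using K W by (auto simp: m_def v_def card_gt_0_iff)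
  define L where "L = (\<lambda>k x. (\<Sum>w\<in>W. \<Lambda> k w x) / v)"
  define T where "T = m / 4"
  have T: "0 < T" using m by (simp add: T_def)
  define J where "J = (\<lambda>k x. if L k x \<le> T then L k x else 0)"
  define D where "D = (\<lambda>x. (\<Sum>k\<in>K. J k x) / m)"
  have L0: "0 \<le> L k x" for k x using v nonneg by (simp add: L_def sum_nonneg)
  have J0: "0 \<le> J k x" and JT: "J k x \<le> T" and JL: "J k x \<le> L k x" for k x
    using L0 T by (auto simp: J_def)
  have Lint: "integrable M (L k)" and Lone: "expectation (L k) = 1" if "k \<in> K" for k
  proof -
    show "integrable M (L k)"
      unfolding L_def using int[OF that] by auto
    have "expectation (L k) = (\<Sum>w\<in>W. expectation (\<Lambda> k w)) / v"
      unfolding L_def using int[OF that] by (simp add: Bochner_Integration.integral_sum)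
    then show "expectation (L k) = 1" using one[OF that] v by (simp add: v_def)
  qed
  have [measurable]: "L k \<in> borel_measurable M" if "k \<in> K" for k
    using Lint[OF that] by auto
  have Jm [measurable]: "J k \<in> borel_measurable M" if "k \<in> K" for k
    unfolding J_def using that by measurable
  have Jint: "integrable M (J k)" if "k \<in> K" for k
    by (rule integrable_const_bound[where B=T]) (use J0 JT that in auto)
  have JJint: "integrable M (\<lambda>x. J k x * J k' x)" if "k \<in> K" "k' \<in> K" for k k'
    by (rule integrable_const_bound[where B="T * T"])
       (use J0 JT that T in \<open>auto intro!: mult_mono simp: abs_mult\<close>)
  \<comment> \<open>The discarded part is L on the event L > T, where L \<le> L^(1+h) / T^h.\<close>
  have EJ: "15 / 16 \<le> expectation (J k)" if k: "k \<in> K" for k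
  proof -
    have pw: "L k x - J k x \<le> L k x powr (1 + h) / T powr h" for x
    proof (cases "L k x \<le> T")
      case True
      then show ?thesis by (simp add: J_def)
    next
      case False
      then have "1 \<le> (L k x / T) powr h" using T h by (intro ge_one_powr_ge_zero) auto
      then have "L k x * 1 \<le> L k x * (L k x / T) powr h" by (intro mult_left_mono L0)
      also have "\<dots> = L k x powr (1 + h) / T powr h"
        using False T by (simp add: powr_divide powr_add)
      finally show ?thesis using False by (simp add: J_def)
    qed
    have "1 - expectation (J k) = expectation (\<lambda>x. L k x - J k x)"
      using Lint[OF k] Jint[OF k] Lone[OF k] by simp
    also have "\<dots> \<le> expectation (\<lambda>x. L k x powr (1 + h) / T powr h)"
      by (rule integral_mono)
         (use Lint[OF k] Jint[OF k] moment(1)[OF k] pw in \<open>auto simp: L_def v_def\<close>)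
    also have "\<dots> = expectation (\<lambda>x. L k x powr (1 + h)) / T powr h" by simp
    also have "\<dots> \<le> (T powr h / 16) / T powr h"
      using moment(2)[OF k] by (intro divide_right_mono) (auto simp: L_def v_def T_def m_def)
    also have "\<dots> = 1 / 16" using T by simp
    finally show ?thesis by simp
  qed
  \<comment> \<open>Cutting only decreases nonnegative factors, so across locations the uncut
    products suffice; no moment beyond the cross terms is needed.\<close>
  have EJJ: "expectation (\<lambda>x. J k x * J k' x) \<le> 9 / 8" if k: "k \<in> K" "k' \<in> K" "k \<noteq> k'" for k k'
  proof -
    have LL: "L k x * L k' x = (\<Sum>w\<in>W. \<Sum>w'\<in>W. \<Lambda> k w x * \<Lambda> k' w' x) / (v * v)" for x
      by (simp add: L_def sum_product)
    have i: "integrable M (\<lambda>x. L k x * L k' x)"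
      unfolding LL using cross(1)[OF k(1) _ k(2) _ k(3)] by auto
    have "expectation (\<lambda>x. J k x * J k' x) \<le> expectation (\<lambda>x. L k x * L k' x)"
      by (rule integral_mono[OF JJint[OF k(1,2)] i]) (intro mult_mono JL J0 L0)
    also have "\<dots> = (\<Sum>w\<in>W. \<Sum>w'\<in>W. expectation (\<lambda>x. \<Lambda> k w x * \<Lambda> k' w' x)) / (v * v)"
      unfolding LL using cross(1)[OF k(1) _ k(2) _ k(3)] by (simp add: Bochner_Integration.integral_sum)
    also have "\<dots> \<le> (\<Sum>w\<in>W. \<Sum>w'\<in>W. 9 / 8) / (v * v)"
      using cross(2)[OF k(1) _ k(2) _ k(3)] v by (intro divide_right_mono sum_mono) auto
    also have "\<dots> = 9 / 8" using v by (simp add: v_def[symmetric])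
    finally show ?thesis .
  qed
  \<comment> \<open>On the diagonal one factor is bounded by \<open>T\<close> and the other has mean
    at most 1. This replaces the possibly enormous second moment of L.\<close>
  have EJ2: "expectation (\<lambda>x. J k x * J k x) \<le> T" if k: "k \<in> K" for k
  proof -
    have "expectation (\<lambda>x. J k x * J k x) \<le> expectation (\<lambda>x. T * L k x)"
      by (rule integral_mono[OF JJint[OF k k]]) (use Lint[OF k] T in \<open>auto intro!: mult_mono JT JL J0\<close>)
    then show ?thesis using Lone[OF k] by simp
  qed
  have Dint: "integrable M D" unfolding D_def using Jint by auto
  have DD: "D x * D x = (\<Sum>k\<in>K. \<Sum>k'\<in>K. J k x * J k' x) / (m * m)" for x
    by (simp add: D_def sum_product)
  have D2int: "integrable M (\<lambda>x. D x * D x)" unfolding DD using JJint by auto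
  have ED: "15 / 16 \<le> expectation D"
  proof -
    have "expectation D = (\<Sum>k\<in>K. expectation (J k)) / m"
      unfolding D_def using Jint by (simp add: Bochner_Integration.integral_sum)
    moreover have "(\<Sum>k\<in>K. 15 / 16) / m \<le> (\<Sum>k\<in>K. expectation (J k)) / m"
      using m EJ by (intro divide_right_mono sum_mono) auto
    ultimately show ?thesis using m by (simp add: m_def[symmetric])
  qed
  have ED2: "expectation (\<lambda>x. D x * D x) \<le> 11 / 8"
  proof -
    have "expectation (\<lambda>x. D x * D x) = (\<Sum>k\<in>K. \<Sum>k'\<in>K. expectation (\<lambda>x. J k x * J k' x)) / (m * m)"
      unfolding DD using JJint by (simp add: Bochner_Integration.integral_sum)
    also have "\<dots> \<le> (\<Sum>k\<in>K. \<Sum>k'\<in>K. 9 / 8 + (if k' = k then T else 0)) / (m * m)"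
    proof (intro divide_right_mono sum_mono)
      fix k k' assume "k \<in> K" "k' \<in> K"
      then show "expectation (\<lambda>x. J k x * J k' x) \<le> 9 / 8 + (if k' = k then T else 0)"
        using EJJ[of k k'] EJ2[of k] by auto
    qed (use m in simp)
    also have "\<dots> = 9 / 8 + T / m"
    proof -
      have "(\<Sum>k'\<in>K. 9 / 8 + (if k' = k then T else 0)) = 9 / 8 * m + T" if "k \<in> K" for k
        using that K(1) by (simp add: sum.distrib m_def)
      then have "(\<Sum>k\<in>K. \<Sum>k'\<in>K. 9 / 8 + (if k' = k then T else 0)) = m * (9 / 8 * m + T)"
        by (simp add: m_def)
      then show ?thesis using m by (simp add: field_simps)
    qed
    also have "\<dots> = 11 / 8" using m by (simp add: T_def)
    finally show ?thesis .
  qed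
  have \<psi>int: "integrable M \<psi>"
    by (rule integrable_const_bound[where B=1]) (use \<psi> in fastforce)+
  have prod_int: "integrable M (\<lambda>x. f x * (1 - \<psi> x))" if "integrable M f" for f :: "'a \<Rightarrow> real"
  proof (rule Bochner_Integration.integrable_bound[OF that])
    show "AE x in M. norm (f x * (1 - \<psi> x)) \<le> norm (f x)"
      using \<psi>(2) by (intro AE_I2) fastforce
  qed (use \<psi>(1) that in measurable)
  \<comment> \<open>Pointwise, the sum of the two errors is at least min(1, D), which is at least D
    - D^2/2; this avoids absolute values. Afterwards \<open>D\<close> may be replaced by the larger
    uncut average, as 1 - \<psi> is nonnegative.\<close>
  have "1 / 4 \<le> 1 - (1 + (1 - 2 * expectation D + expectation (\<lambda>x. D x * D x))) / 2"
    using ED ED2 by simp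
  also have "\<dots> = expectation (\<lambda>x. 1 - (1 + (1 - 2 * D x + D x * D x)) / 2)"
    using Dint D2int by (simp add: prob_space)
  also have "\<dots> \<le> expectation (\<lambda>x. \<psi> x + D x * (1 - \<psi> x))"
  proof (rule integral_mono)
    fix x assume x: "x \<in> space M"
    have "0 \<le> D x * D x" "2 * D x \<le> 1 + D x * D x"
      using zero_le_square[of "D x - 1"] by (simp_all add: algebra_simps)
    then show "1 - (1 + (1 - 2 * D x + D x * D x)) / 2 \<le> \<psi> x + D x * (1 - \<psi> x)"
      using \<psi>(2)[OF x] by (auto simp: field_simps)
  qed (use Dint D2int \<psi>int prod_int in auto)
  also have "\<dots> = expectation \<psi> + expectation (\<lambda>x. D x * (1 - \<psi> x))"
    using Dint \<psi>int prod_int by auto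
  also have "expectation (\<lambda>x. D x * (1 - \<psi> x)) \<le> expectation (\<lambda>x. (\<Sum>k\<in>K. L k x) / m * (1 - \<psi> x))"
  proof (rule integral_mono)
    show "integrable M (\<lambda>x. (\<Sum>k\<in>K. L k x) / m * (1 - \<psi> x))"
      by (rule prod_int) (use Lint in auto)
    fix x assume x: "x \<in> space M"
    have "D x \<le> (\<Sum>k\<in>K. L k x) / m"
      using m JL by (auto simp: D_def intro!: divide_right_mono sum_mono)
    then show "D x * (1 - \<psi> x) \<le> (\<Sum>k\<in>K. L k x) / m * (1 - \<psi> x)"
      using \<psi>(2)[OF x] by (auto intro: mult_right_mono)
  qed (rule prod_int[OF Dint])
  also have "\<dots> = (\<Sum>k\<in>K. \<Sum>w\<in>W. expectation (\<lambda>x. \<Lambda> k w x * (1 - \<psi> x))) / (m * v)"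
  proof -
    have "(\<Sum>k\<in>K. L k x) / m * (1 - \<psi> x) = (\<Sum>k\<in>K. \<Sum>w\<in>W. \<Lambda> k w x * (1 - \<psi> x)) / (m * v)" for x
      by (simp add: L_def sum_distrib_left[symmetric] sum_divide_distrib[symmetric] mult.commute)
    then show ?thesis using prod_int[OF int] by (simp add: Bochner_Integration.integral_sum)
  qed
  finally have main: "1 / 4 \<le> expectation \<psi> + (\<Sum>k\<in>K. \<Sum>w\<in>W. expectation (\<lambda>x. \<Lambda> k w x * (1 - \<psi> x))) / (m * v)"
    by simp
  show ?thesis
  proof (rule ccontr)
    assume "\<not> ?thesis"
    then have lt: "expectation (\<lambda>x. \<Lambda> k w x * (1 - \<psi> x)) < 1 / 4 - expectation \<psi>" if "k \<in> K" "w \<in> W" for k w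
      using that by fastforce
    have "(\<Sum>k\<in>K. \<Sum>w\<in>W. expectation (\<lambda>x. \<Lambda> k w x * (1 - \<psi> x))) < (\<Sum>k\<in>K. \<Sum>w\<in>W. 1 / 4 - expectation \<psi>)"
      by (intro sum_strict_mono K W lt)
    also have "\<dots> = m * v * (1 / 4 - expectation \<psi>)" by (simp add: m_def v_def)
    finally have "(\<Sum>k\<in>K. \<Sum>w\<in>W. expectation (\<lambda>x. \<Lambda> k w x * (1 - \<psi> x))) / (m * v) < 1 / 4 - expectation \<psi>"
      using m v by (simp add: field_simps)
    then show False using main by simp
  qed
qed

section \<open>Gaussian likelihood ratios against \<theta> = 0\<close>

definition likelihood :: "nat \<Rightarrow> nat \<Rightarrow> (nat \<times> nat \<Rightarrow> real) \<Rightarrow> (nat \<times> nat \<Rightarrow> real) \<Rightarrow> real" where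
  "likelihood p n \<theta> x = exp (\<Sum>k\<in>idx p n. \<theta> k * x k - (\<theta> k)\<^sup>2 / 2)"

lemma likelihood_nonneg: "0 \<le> likelihood p n \<theta> x"
  by (simp add: likelihood_def)

lemma likelihood_measurable [measurable]: "likelihood p n \<theta> \<in> borel_measurable (obs_model p n \<theta>')"
proof -
  have "likelihood p n \<theta> \<in> borel_measurable (PiM (idx p n) (\<lambda>_. borel))"
    unfolding likelihood_def[abs_def] by measurable
  then show ?thesis by (simp add: measurable_cong_sets[OF sets_obs_model refl])
qed

text \<open>A product measure is determined by its values on rectangles; there the integral of the
  likelihood ratio factorises into one-dimensional Gaussian changes of mean.\<close>

lemma obs_model_eq_density: "obs_model p n \<theta> = density (obs_model p n (\<lambda>_. 0)) (likelihood p n \<theta>)"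
proof -
  let ?N = "\<lambda>k. density lborel (normal_density (\<theta> k) 1)"
  let ?Std = "\<lambda>k :: nat \<times> nat. density lborel std_normal_density"
  interpret P: product_sigma_finite ?N
    by (simp add: product_sigma_finite_def prob_space_normal prob_space_imp_sigma_finite)
  interpret P0: product_sigma_finite ?Std
    by (simp add: product_sigma_finite_def prob_space_normal prob_space_imp_sigma_finite)
  have "density (obs_model p n (\<lambda>_. 0)) (likelihood p n \<theta>) = PiM (idx p n) ?N"
  proof (rule P.PiM_eqI)
    show "sets (density (obs_model p n (\<lambda>_. 0)) (likelihood p n \<theta>)) = sets (PiM (idx p n) ?N)"
      using sets_obs_model[of p n "\<lambda>_. 0"] sets_obs_model[of p n \<theta>] by (simp add: obs_model_def)
    fix A :: "nat \<times> nat \<Rightarrow> real set" assume A: "\<And>i. i \<in> idx p n \<Longrightarrow> A i \<in> sets (?N i)"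
    have A': "A i \<in> sets borel" if "i \<in> idx p n" for i using A[OF that] by simp
    have box: "PiE (idx p n) A \<in> sets (obs_model p n (\<lambda>_. 0))"
      unfolding sets_obs_model by (rule sets_PiM_I_finite) (use A' in auto)
    have "emeasure (density (obs_model p n (\<lambda>_. 0)) (likelihood p n \<theta>)) (PiE (idx p n) A)
       = (\<integral>\<^sup>+x. ennreal (likelihood p n \<theta> x) * indicator (PiE (idx p n) A) x \<partial>obs_model p n (\<lambda>_. 0))"
      by (rule emeasure_density) (use box in auto)
    also have "\<dots> = (\<integral>\<^sup>+x. (\<Prod>k\<in>idx p n. ennreal (exp (\<theta> k * x k - (\<theta> k)\<^sup>2 / 2)) * indicator (A k) (x k)) \<partial>obs_model p n (\<lambda>_. 0))"
    proof (rule nn_integral_cong)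
      fix x assume x: "x \<in> space (obs_model p n (\<lambda>_. 0))"
      have i: "indicator (PiE (idx p n) A) x = (\<Prod>k\<in>idx p n. indicator (A k) (x k) :: ennreal)"
      proof (cases "x \<in> PiE (idx p n) A")
        case True
        then show ?thesis by (simp add: PiE_iff)
      next
        case False
        then obtain k where "k \<in> idx p n" "x k \<notin> A k" using x by (auto simp: space_obs_model PiE_iff)
        then have "(\<Prod>k\<in>idx p n. indicator (A k) (x k) :: ennreal) = 0"
          by (intro prod_zero bexI[of _ k]) auto
        then show ?thesis using False by simp
      qed
      show "ennreal (likelihood p n \<theta> x) * indicator (PiE (idx p n) A) x
         = (\<Prod>k\<in>idx p n. ennreal (exp (\<theta> k * x k - (\<theta> k)\<^sup>2 / 2)) * indicator (A k) (x k))"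
        unfolding prod.distrib i likelihood_def by (simp add: exp_sum prod_ennreal)
    qed
    also have "\<dots> = (\<Prod>k\<in>idx p n. \<integral>\<^sup>+y. ennreal (exp (\<theta> k * y - (\<theta> k)\<^sup>2 / 2)) * indicator (A k) y \<partial>?Std k)"
      unfolding obs_model_def by (rule P0.product_nn_integral_prod) (use A' in auto)
    also have "\<dots> = (\<Prod>k\<in>idx p n. emeasure (?N k) (A k))"
    proof (rule prod.cong[OF refl])
      fix k assume k: "k \<in> idx p n"
      have "(\<integral>\<^sup>+y. ennreal (exp (\<theta> k * y - (\<theta> k)\<^sup>2 / 2)) * indicator (A k) y \<partial>?Std k)
         = (\<integral>\<^sup>+y. ennreal (std_normal_density y) * (ennreal (exp (\<theta> k * y - (\<theta> k)\<^sup>2 / 2)) * indicator (A k) y) \<partial>lborel)"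
        by (rule nn_integral_density) (use A'[OF k] in auto)
      also have "\<dots> = (\<integral>\<^sup>+y. ennreal (normal_density (\<theta> k) 1 y) * indicator (A k) y \<partial>lborel)"
      proof (rule nn_integral_cong)
        fix y
        have "std_normal_density y * exp (\<theta> k * y - (\<theta> k)\<^sup>2 / 2) = normal_density (\<theta> k) 1 y"
          by (simp add: normal_density_def power2_eq_square field_simps flip: exp_add)
        then show "ennreal (std_normal_density y) * (ennreal (exp (\<theta> k * y - (\<theta> k)\<^sup>2 / 2)) * indicator (A k) y)
          = ennreal (normal_density (\<theta> k) 1 y) * indicator (A k) y"
          by (simp add: mult.assoc[symmetric] ennreal_mult'[symmetric])
      qed
      also have "\<dots> = emeasure (?N k) (A k)"
        by (rule emeasure_density[symmetric]) (use A'[OF k] in auto)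
      finally show "(\<integral>\<^sup>+y. ennreal (exp (\<theta> k * y - (\<theta> k)\<^sup>2 / 2)) * indicator (A k) y \<partial>?Std k) = emeasure (?N k) (A k)" .
    qed
    finally show "emeasure (density (obs_model p n (\<lambda>_. 0)) (likelihood p n \<theta>)) (PiE (idx p n) A)
      = (\<Prod>k\<in>idx p n. emeasure (?N k) (A k))" .
  qed simp
  then show ?thesis by (simp add: obs_model_def)
qed

lemma integral_obs_model:
  assumes "f \<in> borel_measurable (obs_model p n (\<lambda>_. 0))"
  shows "integral\<^sup>L (obs_model p n \<theta>) f = (\<integral>x. likelihood p n \<theta> x * f x \<partial>obs_model p n (\<lambda>_. 0))"
  unfolding obs_model_eq_density[of p n \<theta>]
  by (subst integral_density) (use assms in \<open>auto simp: likelihood_nonneg\<close>)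

lemma likelihood_integral:
  "integrable (obs_model p n (\<lambda>_. 0)) (likelihood p n \<theta>)"
  "integral\<^sup>L (obs_model p n (\<lambda>_. 0)) (likelihood p n \<theta>) = 1"
proof -
  interpret prob_space "obs_model p n \<theta>" by (rule prob_space_obs_model)
  have "integrable (obs_model p n \<theta>) (\<lambda>_. 1 :: real)" by simp
  then show "integrable (obs_model p n (\<lambda>_. 0)) (likelihood p n \<theta>)"
    unfolding obs_model_eq_density[of p n \<theta>]
    by (subst (asm) integrable_density) (auto simp: likelihood_nonneg)
  have "integral\<^sup>L (obs_model p n \<theta>) (\<lambda>_. 1 :: real) = 1" by (simp add: prob_space)
  then show "integral\<^sup>L (obs_model p n (\<lambda>_. 0)) (likelihood p n \<theta>) = 1"
    by (subst (asm) integral_obs_model) auto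
qed

text \<open>Integrated under \<theta> = 0 this says that the mixed second moment of two likelihood
  ratios is the exponential of the inner product of their means. Nearly orthogonal means therefore
  give nearly uncorrelated ratios.\<close>

lemma likelihood_mult:
  "likelihood p n \<theta> x * likelihood p n \<theta>' x = exp (\<Sum>k\<in>idx p n. \<theta> k * \<theta>' k) * likelihood p n (\<lambda>k. \<theta> k + \<theta>' k) x"
  unfolding likelihood_def exp_add[symmetric] sum.distrib[symmetric]
  by (rule arg_cong[where f=exp], rule sum.cong) (auto simp: power2_eq_square field_simps)

section \<open>Moments of block averages\<close>

text \<open>After division by x + y this is z \<le> z^h on [0, 1], applied to two fractions that add
  up to 1.\<close>

lemma powr_add_le_add_powr:
  fixes x y h :: real
  assumes "0 \<le> x" "0 \<le> y" "0 < h" "h \<le> 1"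
  shows "(x + y) powr h \<le> x powr h + y powr h"
proof (cases "x + y = 0")
  case True
  then show ?thesis using assms by simp
next
  case False
  then have pos: "0 < x + y" using assms by simp
  have *: "z / (x + y) \<le> (z / (x + y)) powr h" if "0 \<le> z" "z \<le> x + y" for z
    using that pos assms powr_mono'[of h 1 "z / (x + y)"] by auto
  have "1 = x / (x + y) + y / (x + y)" using pos by (simp add: add_divide_distrib[symmetric])
  also have "\<dots> \<le> (x / (x + y)) powr h + (y / (x + y)) powr h"
    using * assms by (intro add_mono) auto
  also have "\<dots> = (x powr h + y powr h) / (x + y) powr h"
    using assms by (simp add: powr_divide add_divide_distrib)
  finally show ?thesis using pos by (simp add: field_simps)
qed

text \<open>The concave power lies below its tangent at 1; the proof uses convexity of exp between 0
  and ln y.\<close>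

lemma powr_le_tangent:
  fixes y h :: real
  assumes "0 \<le> y" "0 < h" "h \<le> 1"
  shows "y powr h \<le> 1 - h + h * y"
proof (cases "y = 0")
  case True
  then show ?thesis using assms by simp
next
  case False
  then have y: "0 < y" using assms by simp
  have "exp ((1 - h) *\<^sub>R 0 + h *\<^sub>R ln y) \<le> (1 - h) * exp 0 + h * exp (ln y)"
    by (rule convex_onD[OF exp_convex]) (use assms in auto)
  then show ?thesis using y by (simp add: powr_def mult.commute)
qed

text \<open>A leave-one-out expansion that makes a fractional moment accessible to independence. One
  factor of A^(1+h) = A * A^h is expanded into its summands; in the other, the share of the same
  summand keeps its power and the share of all others is linearised. Only single powers and products
  of two distinct variables remain.\<close>

lemma average_powr_le:
  fixes f :: "'i \<Rightarrow> real"
  assumes R: "finite R" "R \<noteq> {}" and f: "\<And>j. j \<in> R \<Longrightarrow> 0 \<le> f j" and h: "0 < h" "h \<le> 1"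
  defines "b \<equiv> real (card R)"
  shows "((\<Sum>j\<in>R. f j) / b) powr (1 + h)
    \<le> (\<Sum>j\<in>R. f j powr (1 + h) / b powr h + (1 - h) * f j + h * (\<Sum>i\<in>R - {j}. f j * f i) / b) / b"
proof -
  have b: "0 < b" using R by (simp add: b_def card_gt_0_iff)
  define A where "A = (\<Sum>j\<in>R. f j) / b"
  have A0: "0 \<le> A" using f b by (simp add: A_def sum_nonneg)
  have "A powr (1 + h) = A * A powr h" using A0 by (simp add: powr_mult_base)
  also have "\<dots> = (\<Sum>j\<in>R. f j * A powr h) / b" by (simp add: A_def sum_distrib_right)
  also have "\<dots> \<le> (\<Sum>j\<in>R. f j powr (1 + h) / b powr h + (1 - h) * f j + h * (\<Sum>i\<in>R - {j}. f j * f i) / b) / b"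
  proof (intro divide_right_mono sum_mono)
    fix j assume j: "j \<in> R"
    define w where "w = (\<Sum>i\<in>R - {j}. f i) / b"
    have w: "0 \<le> w" using f b unfolding w_def by (intro divide_nonneg_pos sum_nonneg) auto
    have "A = f j / b + w"
      using R(1) j by (simp add: A_def w_def sum.remove[of R j] add_divide_distrib)
    then have "A powr h \<le> (f j / b) powr h + w powr h"
      using powr_add_le_add_powr[of "f j / b" w h] w f[OF j] b h by simp
    also have "\<dots> \<le> (f j / b) powr h + (1 - h + h * w)"
      using powr_le_tangent[OF w h] by simp
    finally have "f j * A powr h \<le> f j * ((f j / b) powr h + (1 - h + h * w))"
      using f[OF j] by (rule mult_left_mono)
    also have "\<dots> = f j powr (1 + h) / b powr h + (1 - h) * f j + h * (\<Sum>i\<in>R - {j}. f j * f i) / b"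
      using f[OF j] b by (simp add: powr_divide powr_mult_base algebra_simps w_def sum_distrib_left)
    finally show "f j * A powr h \<le> f j powr (1 + h) / b powr h + (1 - h) * f j + h * (\<Sum>i\<in>R - {j}. f j * f i) / b" .
  qed (use b in simp)
  finally show ?thesis by (simp add: A_def)
qed

text \<open>Distinct factors have product of mean 1, so the three terms contribute V/b^h, 1 - h and
  h (b-1)/b. For h = 1 this is the usual expansion of the second moment of an average.\<close>

lemma (in prob_space) block_average_moment:
  fixes Y :: "'i \<Rightarrow> 'a \<Rightarrow> real"
  assumes R: "finite R" "R \<noteq> {}" and ind: "indep_vars (\<lambda>_. borel) Y R"
    and Y: "\<And>j x. j \<in> R \<Longrightarrow> 0 \<le> Y j x" "\<And>j. j \<in> R \<Longrightarrow> integrable M (Y j)" "\<And>j. j \<in> R \<Longrightarrow> expectation (Y j) = 1"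
    and h: "0 < h" "h \<le> 1"
    and V: "\<And>j. j \<in> R \<Longrightarrow> integrable M (\<lambda>x. Y j x powr (1 + h))" "\<And>j. j \<in> R \<Longrightarrow> expectation (\<lambda>x. Y j x powr (1 + h)) \<le> V"
  shows "integrable M (\<lambda>x. ((\<Sum>j\<in>R. Y j x) / real (card R)) powr (1 + h))"
    and "expectation (\<lambda>x. ((\<Sum>j\<in>R. Y j x) / real (card R)) powr (1 + h))
      \<le> 1 - h / real (card R) + V / real (card R) powr h"
proof -
  define b where "b = real (card R)"
  have b: "0 < b" using R by (simp add: b_def card_gt_0_iff)
  define u where "u = (\<lambda>j x. Y j x powr (1 + h) / b powr h + (1 - h) * Y j x + h * (\<Sum>i\<in>R - {j}. Y j x * Y i x) / b)"
  define U where "U = (\<lambda>x. (\<Sum>j\<in>R. u j x) / b)"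
  have le: "((\<Sum>j\<in>R. Y j x) / b) powr (1 + h) \<le> U x" for x
    unfolding U_def u_def b_def by (rule average_powr_le[OF R _ h]) (rule Y(1))
  have YY: "integrable M (\<lambda>x. Y j x * Y i x) \<and> expectation (\<lambda>x. Y j x * Y i x) = 1" if "j \<in> R" "i \<in> R - {j}" for i j
  proof -
    have sub: "indep_vars (\<lambda>_. borel) Y {j, i}" by (rule indep_vars_subset[OF ind]) (use that in auto)
    have "integrable M (\<lambda>x. \<Prod>k\<in>{j, i}. Y k x)"
      by (rule indep_vars_integrable[OF _ sub]) (use that Y in auto)
    moreover have "expectation (\<lambda>x. \<Prod>k\<in>{j, i}. Y k x) = (\<Prod>k\<in>{j, i}. expectation (Y k))"
      by (rule indep_vars_lebesgue_integral[OF _ sub]) (use that Y in auto)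
    ultimately show ?thesis using that Y by auto
  qed
  have u: "integrable M (u j)" "expectation (u j) \<le> V / b powr h + (1 - h) + h * (b - 1) / b" if j: "j \<in> R" for j
  proof -
    have 1: "integrable M (\<lambda>x. Y j x powr (1 + h) / b powr h)" using V(1)[OF j] by simp
    have 2: "integrable M (\<lambda>x. (1 - h) * Y j x)" using Y(2)[OF j] by simp
    have 3: "integrable M (\<lambda>x. \<Sum>i\<in>R - {j}. Y j x * Y i x)" using YY[OF j] by (intro Bochner_Integration.integrable_sum) blast
    then have 4: "integrable M (\<lambda>x. h * (\<Sum>i\<in>R - {j}. Y j x * Y i x) / b)" by simp
    show "integrable M (u j)" unfolding u_def by (intro Bochner_Integration.integrable_add 1 2 4)
    have "expectation (\<lambda>x. \<Sum>i\<in>R - {j}. Y j x * Y i x) = (\<Sum>i\<in>R - {j}. 1)"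
      using YY[OF j] by (subst Bochner_Integration.integral_sum) auto
    also have "\<dots> = b - 1" using R j by (simp add: b_def of_nat_diff Suc_leI card_gt_0_iff)
    finally have e3: "expectation (\<lambda>x. h * (\<Sum>i\<in>R - {j}. Y j x * Y i x) / b) = h * (b - 1) / b"
      by simp
    have "expectation (u j) = expectation (\<lambda>x. Y j x powr (1 + h) / b powr h) + expectation (\<lambda>x. (1 - h) * Y j x)
       + expectation (\<lambda>x. h * (\<Sum>i\<in>R - {j}. Y j x * Y i x) / b)"
      unfolding u_def by (subst Bochner_Integration.integral_add[OF Bochner_Integration.integrable_add[OF 1 2] 4],
        subst Bochner_Integration.integral_add[OF 1 2]) simp
    then have "expectation (u j) = expectation (\<lambda>x. Y j x powr (1 + h)) / b powr h + (1 - h) + h * (b - 1) / b"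
      using Y(3)[OF j] e3 by simp
    then show "expectation (u j) \<le> V / b powr h + (1 - h) + h * (b - 1) / b"
      using V(2)[OF j] b by (simp add: divide_right_mono)
  qed
  have Uint: "integrable M U" unfolding U_def using u(1) by auto
  have "expectation U = (\<Sum>j\<in>R. expectation (u j)) / b"
    unfolding U_def using u(1) by simp
  also have "\<dots> \<le> (\<Sum>j\<in>R. V / b powr h + (1 - h) + h * (b - 1) / b) / b"
    using b u(2) by (intro divide_right_mono sum_mono) auto
  also have "\<dots> = 1 - h / b + V / b powr h"
    using b by (simp add: b_def[symmetric] field_simps)
  finally have EU: "expectation U \<le> 1 - h / b + V / b powr h" .
  have m: "(\<lambda>x. ((\<Sum>j\<in>R. Y j x) / b) powr (1 + h)) \<in> borel_measurable M"
    using Y(2) by (intro powr_real_measurable borel_measurable_divide borel_measurable_sum) auto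
  have int: "integrable M (\<lambda>x. ((\<Sum>j\<in>R. Y j x) / b) powr (1 + h))"
    by (rule Bochner_Integration.integrable_bound[OF Uint m])
       (use order.trans[OF le abs_ge_self] in auto)
  then show "integrable M (\<lambda>x. ((\<Sum>j\<in>R. Y j x) / real (card R)) powr (1 + h))" by (simp add: b_def)
  have "expectation (\<lambda>x. ((\<Sum>j\<in>R. Y j x) / b) powr (1 + h)) \<le> expectation U"
    by (rule integral_mono[OF int Uint le])
  with EU show "expectation (\<lambda>x. ((\<Sum>j\<in>R. Y j x) / real (card R)) powr (1 + h))
      \<le> 1 - h / real (card R) + V / real (card R) powr h" by (simp add: b_def)
qed

text \<open>Blocks use disjoint sets of variables, so their averages are independent and the moment
  of the product is the product of the moments.\<close>

lemma (in prob_space) block_product_moment: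
  fixes Y :: "'i \<Rightarrow> 'a \<Rightarrow> real" and R :: "'b \<Rightarrow> 'i set"
  assumes I: "finite I" and R: "\<And>B. B \<in> I \<Longrightarrow> finite (R B)" "\<And>B. B \<in> I \<Longrightarrow> card (R B) = b" "0 < b"
      "\<And>B. B \<in> I \<Longrightarrow> R B \<subseteq> J" "disjoint_family_on R I"
    and ind: "indep_vars (\<lambda>_. borel) Y J"
    and Y: "\<And>j x. j \<in> J \<Longrightarrow> 0 \<le> Y j x" "\<And>j. j \<in> J \<Longrightarrow> integrable M (Y j)" "\<And>j. j \<in> J \<Longrightarrow> expectation (Y j) = 1"
    and h: "0 < h" "h \<le> 1"
    and V: "\<And>j. j \<in> J \<Longrightarrow> integrable M (\<lambda>x. Y j x powr (1 + h))" "\<And>j. j \<in> J \<Longrightarrow> expectation (\<lambda>x. Y j x powr (1 + h)) \<le> V"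
  shows "integrable M (\<lambda>x. (\<Prod>B\<in>I. (\<Sum>j\<in>R B. Y j x) / real b) powr (1 + h))"
    and "expectation (\<lambda>x. (\<Prod>B\<in>I. (\<Sum>j\<in>R B. Y j x) / real b) powr (1 + h)) \<le> (1 - h / real b + V / real b powr h) ^ card I"
proof -
  let ?g = "\<lambda>B x. ((\<Sum>j\<in>R B. Y j x) / real b) powr (1 + h)"
  have ne: "R B \<noteq> {}" if "B \<in> I" for B using R(2)[OF that] R(3) by auto
  have mom: "integrable M (?g B)" "expectation (?g B) \<le> 1 - h / real b + V / real b powr h" if B: "B \<in> I" for B
  proof -
    have *: "j \<in> J" if "j \<in> R B" for j using R(4)[OF B] that by auto
    show "integrable M (?g B)" "expectation (?g B) \<le> 1 - h / real b + V / real b powr h"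
      using block_average_moment[OF R(1)[OF B] ne[OF B] indep_vars_subset[OF ind R(4)[OF B]] Y[OF *] h V[OF *]]
      by (simp_all add: R(2)[OF B])
  qed
  have "indep_vars (\<lambda>B. PiM (R B) (\<lambda>_. borel)) (\<lambda>B x. restrict (\<lambda>j. Y j x) (R B)) I"
    by (rule indep_vars_restrict[OF ind R(4) R(5)])
  then have "indep_vars (\<lambda>_. borel) (\<lambda>B x. (\<lambda>y. ((\<Sum>j\<in>R B. y j) / real b) powr (1 + h)) (restrict (\<lambda>j. Y j x) (R B))) I"
    by (rule indep_vars_compose2)
       (auto intro!: powr_real_measurable borel_measurable_divide borel_measurable_sum measurable_component_singleton)
  then have ind': "indep_vars (\<lambda>_. borel) ?g I" by simp
  have eq: "(\<Prod>B\<in>I. (\<Sum>j\<in>R B. Y j x) / real b) powr (1 + h) = (\<Prod>B\<in>I. ?g B x)" for x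
    by (rule prod_powr_distrib)
  show "integrable M (\<lambda>x. (\<Prod>B\<in>I. (\<Sum>j\<in>R B. Y j x) / real b) powr (1 + h))"
    unfolding eq by (rule indep_vars_integrable[OF I ind' mom(1)])
  have "expectation (\<lambda>x. \<Prod>B\<in>I. ?g B x) = (\<Prod>B\<in>I. expectation (?g B))"
    by (rule indep_vars_lebesgue_integral[OF I ind' mom(1)])
  also have "\<dots> \<le> (\<Prod>B\<in>I. 1 - h / real b + V / real b powr h)"
    by (intro prod_mono conjI mom(2) Bochner_Integration.integral_nonneg) auto
  finally show "expectation (\<lambda>x. (\<Prod>B\<in>I. (\<Sum>j\<in>R B. Y j x) / real b) powr (1 + h)) \<le> (1 - h / real b + V / real b powr h) ^ card I"
    unfolding eq by simp
qed

text \<open>The likelihood ratio against N(0,1) of the mixture of N(r,1) and N(-r,1).\<close>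

definition sym_lr :: "real \<Rightarrow> real \<Rightarrow> real" where
  "sym_lr r z = exp (- (r\<^sup>2) / 2) * cosh (r * z)"

lemma sym_lr_pos: "0 < sym_lr r z"
  by (simp add: sym_lr_def)

lemma sym_lr_measurable [measurable]: "sym_lr r \<in> borel_measurable borel"
  unfolding sym_lr_def cosh_def by measurable

lemma sym_lr_mean:
  "integrable lborel (\<lambda>z. std_normal_density z * sym_lr r z)"
  "(\<integral>z. std_normal_density z * sym_lr r z \<partial>lborel) = 1"
proof -
  have eq: "std_normal_density z * sym_lr r z = exp (- (r\<^sup>2) / 2) / 2 *
     (std_normal_density z * exp (r * z) + std_normal_density z * exp ((- r) * z))" for z
    by (simp add: sym_lr_def cosh_def algebra_simps)
  show "integrable lborel (\<lambda>z. std_normal_density z * sym_lr r z)"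
    unfolding eq by (intro integrable_mult_right Bochner_Integration.integrable_add normal_mgf)
  have "(\<integral>z. std_normal_density z * sym_lr r z \<partial>lborel) = exp (- (r\<^sup>2) / 2) / 2 * (exp (r\<^sup>2 / 2) + exp ((- r)\<^sup>2 / 2))"
    unfolding eq by (subst integral_mult_right_zero, subst Bochner_Integration.integral_add) (simp_all only: normal_mgf)
  also have "\<dots> = 1" by (simp add: exp_minus)
  finally show "(\<integral>z. std_normal_density z * sym_lr r z \<partial>lborel) = 1" .
qed

text \<open>The exact value matters for dense signals: thanks to the random sign, the excess cosh
  (r^2) - 1 is quadratic in r^2, where a fixed sign would give exp (r^2) - 1, which is
  linear.\<close>

lemma sym_lr_second_moment:
  "integrable lborel (\<lambda>z. std_normal_density z * sym_lr r z powr 2)"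
  "(\<integral>z. std_normal_density z * sym_lr r z powr 2 \<partial>lborel) = cosh (r\<^sup>2)"
proof -
  have eq: "std_normal_density z * sym_lr r z powr 2 = exp (- (r\<^sup>2)) / 4 *
     (std_normal_density z * exp ((2 * r) * z) + (std_normal_density z * exp ((- 2 * r) * z) + 2 * std_normal_density z))" for z
  proof -
    have "sym_lr r z powr 2 = (sym_lr r z)\<^sup>2" using sym_lr_pos[of r z] by (simp add: powr_numeral)
    also have "\<dots> = exp (- (r\<^sup>2)) * (cosh (r * z))\<^sup>2"
      by (simp add: sym_lr_def power_mult_distrib flip: exp_double)
    also have "(cosh (r * z))\<^sup>2 = (exp (2 * r * z) + exp (- 2 * r * z) + 2) / 4"
      by (simp add: cosh_def power2_eq_square field_simps flip: exp_add)
    finally show ?thesis by (simp add: field_simps)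
  qed
  have i: "integrable lborel (\<lambda>z. 2 * std_normal_density z)" by simp
  show "integrable lborel (\<lambda>z. std_normal_density z * sym_lr r z powr 2)"
    unfolding eq by (intro integrable_mult_right Bochner_Integration.integrable_add normal_mgf i)
  have "(\<integral>z. std_normal_density z * sym_lr r z powr 2 \<partial>lborel)
     = exp (- (r\<^sup>2)) / 4 * (exp ((2 * r)\<^sup>2 / 2) + (exp ((- 2 * r)\<^sup>2 / 2) + 2))"
    unfolding eq
    by (subst integral_mult_right_zero, subst Bochner_Integration.integral_add, rule normal_mgf,
        intro integrable_mult_right Bochner_Integration.integrable_add normal_mgf i,
        subst Bochner_Integration.integral_add, rule normal_mgf, rule i) (simp only: normal_mgf, simp)
  also have "\<dots> = cosh (r\<^sup>2)"
    by (simp add: cosh_def power_mult_distrib field_simps flip: exp_add)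
  finally show "(\<integral>z. std_normal_density z * sym_lr r z powr 2 \<partial>lborel) = cosh (r\<^sup>2)" .
qed

text \<open>Bounding cosh by the exponential of the absolute value reduces the moment to two tilts
  by (1+h) r. The factor 2 is harmless where the moment is a power of p.\<close>

lemma sym_lr_moment:
  assumes "0 \<le> r" "0 \<le> h"
  shows "integrable lborel (\<lambda>z. std_normal_density z * sym_lr r z powr (1 + h))"
    and "(\<integral>z. std_normal_density z * sym_lr r z powr (1 + h) \<partial>lborel) \<le> 2 * exp (h * (1 + h) * r\<^sup>2 / 2)"
proof -
  let ?U = "\<lambda>z. exp (- ((1 + h) * r\<^sup>2 / 2)) *
     (std_normal_density z * exp (((1 + h) * r) * z) + std_normal_density z * exp ((- ((1 + h) * r)) * z))"
  have le: "std_normal_density z * sym_lr r z powr (1 + h) \<le> ?U z" for z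
  proof -
    have "cosh (r * z) \<le> exp \<bar>r * z\<bar>"
      by (auto simp: cosh_def abs_if)
    then have "cosh (r * z) powr (1 + h) \<le> exp \<bar>r * z\<bar> powr (1 + h)"
      using assms by (intro powr_mono2) auto
    also have "\<dots> = exp ((1 + h) * \<bar>r * z\<bar>)" by (simp add: exp_powr_real mult.commute)
    also have "\<dots> \<le> exp (((1 + h) * r) * z) + exp ((- ((1 + h) * r)) * z)"
      by (auto simp: abs_if mult.assoc)
    finally have "sym_lr r z powr (1 + h) \<le> exp (- ((1 + h) * r\<^sup>2 / 2)) * (exp (((1 + h) * r) * z) + exp ((- ((1 + h) * r)) * z))"
      by (simp add: sym_lr_def powr_mult exp_powr_real mult.commute)
    then have "std_normal_density z * sym_lr r z powr (1 + h)
       \<le> std_normal_density z * (exp (- ((1 + h) * r\<^sup>2 / 2)) * (exp (((1 + h) * r) * z) + exp ((- ((1 + h) * r)) * z)))"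
      by (rule mult_left_mono) simp
    then show ?thesis by (simp add: algebra_simps)
  qed
  have Uint: "integrable lborel ?U"
    by (intro integrable_mult_right Bochner_Integration.integrable_add normal_mgf)
  show int: "integrable lborel (\<lambda>z. std_normal_density z * sym_lr r z powr (1 + h))"
    by (rule Bochner_Integration.integrable_bound[OF Uint]) (use le in \<open>auto intro: order.trans\<close>)
  have "(\<integral>z. std_normal_density z * sym_lr r z powr (1 + h) \<partial>lborel) \<le> integral\<^sup>L lborel ?U"
    by (rule integral_mono[OF int Uint le])
  also have "\<dots> = exp (- ((1 + h) * r\<^sup>2 / 2)) * (exp (((1 + h) * r)\<^sup>2 / 2) + exp ((- ((1 + h) * r))\<^sup>2 / 2))"
    by (subst integral_mult_right_zero, subst Bochner_Integration.integral_add) (simp_all only: normal_mgf)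
  also have "\<dots> = 2 * exp (h * (1 + h) * r\<^sup>2 / 2)"
    by (simp add: power2_eq_square field_simps flip: exp_add)
  finally show "(\<integral>z. std_normal_density z * sym_lr r z powr (1 + h) \<partial>lborel) \<le> 2 * exp (h * (1 + h) * r\<^sup>2 / 2)" .
qed

section \<open>A sparse prior over well separated scales\<close>

definition block :: "nat \<Rightarrow> nat \<Rightarrow> nat set" where
  "block b B = {B * b + 1..B * b + b}"

text \<open>A choice of row and sign in each of s disjoint blocks. Unlike a uniformly random
  s-subset of rows, it makes the averaged likelihood ratio an exact product of independent factors,
  and the support still has exactly s rows.\<close>

definition spike_prior :: "nat \<Rightarrow> nat \<Rightarrow> (nat \<Rightarrow> nat \<times> real) set" where
  "spike_prior s b = PiE {..<s} (\<lambda>B. block b B \<times> {-1, 1})"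

text \<open>Blocks are disjoint, so for w in the prior at most one summand is nonzero: the sign at a
  selected row, and 0 elsewhere.\<close>

definition spike_sign :: "nat \<Rightarrow> (nat \<Rightarrow> nat \<times> real) \<Rightarrow> nat \<Rightarrow> real" where
  "spike_sign s w j = (\<Sum>B<s. if fst (w B) = j then snd (w B) else 0)"

text \<open>A selected row has Euclidean norm r over the first t columns and is zero afterwards. It
  is not centred, so the comparison is with \<theta> = 0, and the jump strength is r sqrt(1 - t/n);
  this is why t/n has to be small.\<close>

definition spike_mean :: "nat \<Rightarrow> real \<Rightarrow> nat \<Rightarrow> (nat \<Rightarrow> nat \<times> real) \<Rightarrow> nat \<times> nat \<Rightarrow> real" where
  "spike_mean s r t w = (\<lambda>(j, i). if i \<le> t then r / sqrt (real t) * spike_sign s w j else 0)"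

text \<open>The only function of row j that enters the likelihood ratio of
  \<open>spike_mean\<close>; standard normal at \<theta> = 0.\<close>

definition segment_stat :: "nat \<Rightarrow> nat \<Rightarrow> (nat \<times> nat \<Rightarrow> real) \<Rightarrow> real" where
  "segment_stat t j x = (\<Sum>i\<in>{1..t}. 1 / sqrt (real t) * x (j, i))"

lemma finite_block [simp]: "finite (block b B)" and card_block [simp]: "card (block b B) = b"
  by (simp_all add: block_def)

lemma block_unique: "j \<in> block b B \<Longrightarrow> j \<in> block b B' \<Longrightarrow> B = B'"
proof -
  have "(j - 1) div b = B" if "j \<in> block b B" for B
    by (rule div_nat_eqI) (use that in \<open>auto simp: block_def mult.commute\<close>)
  then show "j \<in> block b B \<Longrightarrow> j \<in> block b B' \<Longrightarrow> B = B'" by blast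
qed

lemma block_subset:
  assumes "s * b \<le> p" "B < s"
  shows "block b B \<subseteq> {1..p}"
proof -
  have "(B + 1) * b \<le> s * b" using assms by (intro mult_right_mono) auto
  then show ?thesis using assms by (auto simp: block_def)
qed

lemma finite_spike_prior: "finite (spike_prior s b)"
  by (simp add: spike_prior_def finite_PiE)

lemma spike_prior_nonempty: "0 < b \<Longrightarrow> spike_prior s b \<noteq> {}"
  by (auto simp: spike_prior_def PiE_eq_empty_iff block_def)

lemma spike_priorD:
  assumes "w \<in> spike_prior s b" "B < s"
  shows "fst (w B) \<in> block b B" "snd (w B) = -1 \<or> snd (w B) = 1"
  using assms by (auto simp: spike_prior_def PiE_iff mem_Times_iff)

lemma spike_sign_sum:
  assumes w: "w \<in> spike_prior s b" and p: "s * b \<le> p"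
  shows "(\<Sum>j\<in>{1..p}. spike_sign s w j * f j) = (\<Sum>B<s. snd (w B) * f (fst (w B)))"
proof -
  have "(\<Sum>j\<in>{1..p}. spike_sign s w j * f j) = (\<Sum>j\<in>{1..p}. \<Sum>B<s. if fst (w B) = j then snd (w B) * f (fst (w B)) else 0)"
    unfolding spike_sign_def sum_distrib_right by (intro sum.cong) auto
  also have "\<dots> = (\<Sum>B<s. \<Sum>j\<in>{1..p}. if fst (w B) = j then snd (w B) * f (fst (w B)) else 0)"
    by (rule sum.swap)
  also have "\<dots> = (\<Sum>B<s. snd (w B) * f (fst (w B)))"
  proof (rule sum.cong)
    fix B assume "B \<in> {..<s}"
    then have "fst (w B) \<in> {1..p}" using subsetD[OF block_subset[OF p] spike_priorD(1)[OF w]] by blast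
    then show "(\<Sum>j\<in>{1..p}. if fst (w B) = j then snd (w B) * f (fst (w B)) else 0) = snd (w B) * f (fst (w B))"
      by (simp add: sum.delta')
  qed simp
  finally show ?thesis .
qed

lemma spike_sign_at:
  assumes w: "w \<in> spike_prior s b" and B: "B < s"
  shows "spike_sign s w (fst (w B)) = snd (w B)"
proof -
  have "fst (w B') = fst (w B) \<longleftrightarrow> B' = B" if "B' < s" for B'
    using spike_priorD(1)[OF w B] spike_priorD(1)[OF w that] block_unique by metis
  then have "spike_sign s w (fst (w B)) = (\<Sum>B'<s. if B' = B then snd (w B') else 0)"
    unfolding spike_sign_def by (intro sum.cong) auto
  then show ?thesis using B by simp
qed

lemma likelihood_spike_mean:
  assumes w: "w \<in> spike_prior s b" and p: "s * b \<le> p" and t: "1 \<le> t" "t \<le> n"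
  shows "likelihood p n (spike_mean s r t w) x
    = (\<Prod>B<s. exp (r * snd (w B) * segment_stat t (fst (w B)) x - r\<^sup>2 / 2))"
proof -
  let ?\<sigma> = "spike_sign s w"
  have inner: "(\<Sum>i\<in>{1..n}. spike_mean s r t w (j, i) * x (j, i) - (spike_mean s r t w (j, i))\<^sup>2 / 2)
     = ?\<sigma> j * (r * segment_stat t j x - r\<^sup>2 / 2 * ?\<sigma> j)" for j
  proof -
    define c where "c = r / sqrt (real t) * ?\<sigma> j"
    have "(\<Sum>i\<in>{1..n}. spike_mean s r t w (j, i) * x (j, i) - (spike_mean s r t w (j, i))\<^sup>2 / 2)
       = (\<Sum>i\<in>{1..t}. c * x (j, i) - c\<^sup>2 / 2)"
      by (rule sum.mono_neutral_cong_right) (use t in \<open>auto simp: spike_mean_def c_def\<close>)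
    also have "\<dots> = c * (\<Sum>i\<in>{1..t}. x (j, i)) - real t * c\<^sup>2 / 2"
      by (simp add: sum_subtractf sum_distrib_left)
    also have "c * (\<Sum>i\<in>{1..t}. x (j, i)) = r * ?\<sigma> j * segment_stat t j x"
      by (simp add: c_def segment_stat_def sum_divide_distrib[symmetric])
    also have "real t * c\<^sup>2 = r\<^sup>2 * (?\<sigma> j)\<^sup>2"
      using t by (simp add: c_def power_mult_distrib power_divide)
    finally show ?thesis by (simp add: power2_eq_square algebra_simps)
  qed
  have "(\<Sum>k\<in>idx p n. spike_mean s r t w k * x k - (spike_mean s r t w k)\<^sup>2 / 2)
     = (\<Sum>j\<in>{1..p}. \<Sum>i\<in>{1..n}. spike_mean s r t w (j, i) * x (j, i) - (spike_mean s r t w (j, i))\<^sup>2 / 2)"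
    unfolding idx_def sum.cartesian_product by (rule sum.cong) auto
  also have "\<dots> = (\<Sum>j\<in>{1..p}. ?\<sigma> j * (r * segment_stat t j x - r\<^sup>2 / 2 * ?\<sigma> j))"
    by (simp only: inner)
  also have "\<dots> = (\<Sum>B<s. snd (w B) * (r * segment_stat t (fst (w B)) x - r\<^sup>2 / 2 * ?\<sigma> (fst (w B))))"
    by (rule spike_sign_sum[OF w p])
  also have "\<dots> = (\<Sum>B<s. r * snd (w B) * segment_stat t (fst (w B)) x - r\<^sup>2 / 2)"
  proof (rule sum.cong)
    fix B assume "B \<in> {..<s}"
    then show "snd (w B) * (r * segment_stat t (fst (w B)) x - r\<^sup>2 / 2 * ?\<sigma> (fst (w B)))
      = r * snd (w B) * segment_stat t (fst (w B)) x - r\<^sup>2 / 2"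
      using spike_priorD(2)[OF w, of B] spike_sign_at[OF w, of B] by auto
  qed simp
  finally show ?thesis by (simp add: likelihood_def exp_sum)
qed

text \<open>Summing a product over independent choices gives a product of sums, and averaging over
  the sign turns the exponential into the hyperbolic cosine of \<open>sym_lr\<close>.\<close>

lemma average_likelihood_spike:
  assumes b: "0 < b" and p: "s * b \<le> p" and t: "1 \<le> t" "t \<le> n"
  shows "(\<Sum>w\<in>spike_prior s b. likelihood p n (spike_mean s r t w) x) / real (card (spike_prior s b))
    = (\<Prod>B<s. (\<Sum>j\<in>block b B. sym_lr r (segment_stat t j x)) / real b)"
proof -
  let ?g = "\<lambda>y. exp (r * snd y * segment_stat t (fst y) x - r\<^sup>2 / 2)"
  have "(\<Sum>w\<in>spike_prior s b. likelihood p n (spike_mean s r t w) x) = (\<Sum>w\<in>spike_prior s b. \<Prod>B<s. ?g (w B))"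
    by (intro sum.cong likelihood_spike_mean[OF _ p t]) auto
  also have "\<dots> = (\<Prod>B<s. \<Sum>y\<in>block b B \<times> {-1, 1}. ?g y)"
    unfolding spike_prior_def by (rule prod_sum_PiE[symmetric]) auto
  also have "\<dots> = (\<Prod>B<s. 2 * (\<Sum>j\<in>block b B. sym_lr r (segment_stat t j x)))"
  proof (rule prod.cong)
    fix B
    have "(\<Sum>y\<in>block b B \<times> {-1, 1}. ?g y) = (\<Sum>j\<in>block b B. \<Sum>e\<in>{-1, 1}. exp (r * e * segment_stat t j x - r\<^sup>2 / 2))"
      unfolding sum.cartesian_product by (rule sum.cong) auto
    also have "\<dots> = (\<Sum>j\<in>block b B. 2 * sym_lr r (segment_stat t j x))"
    proof (rule sum.cong)
      fix j
      have *: "exp (u - v) = exp (- v) * exp u" for u v :: real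
        by (simp flip: exp_add)
      show "(\<Sum>e\<in>{-1, 1}. exp (r * e * segment_stat t j x - r\<^sup>2 / 2)) = 2 * sym_lr r (segment_stat t j x)"
        by (simp add: * sym_lr_def cosh_def algebra_simps)
    qed simp
    finally show "(\<Sum>y\<in>block b B \<times> {-1, 1}. ?g y) = 2 * (\<Sum>j\<in>block b B. sym_lr r (segment_stat t j x))"
      by (simp add: sum_distrib_left)
  qed simp
  finally have num: "(\<Sum>w\<in>spike_prior s b. likelihood p n (spike_mean s r t w) x)
    = (\<Prod>B<s. 2 * (\<Sum>j\<in>block b B. sym_lr r (segment_stat t j x)))" .
  have den: "real (card (spike_prior s b)) = (\<Prod>B<s. 2 * real b)"
    by (simp add: spike_prior_def card_PiE card_cartesian_product mult.commute)
  show ?thesis unfolding num den prod_dividef[symmetric] using b by simp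
qed

text \<open>Two spikes overlap only in the first t columns, where a common row contributes at most
  r^2 sqrt(t/t'). Bounding the overlap of the supports by s^2 is crude, but the ratio t/t' will be
  exponentially small in p.\<close>

lemma spike_mean_inner_le:
  assumes w: "w \<in> spike_prior s b" "w' \<in> spike_prior s b" and p: "s * b \<le> p"
    and t: "1 \<le> t" "t \<le> t'" "t' \<le> n"
  shows "(\<Sum>k\<in>idx p n. spike_mean s r t w k * spike_mean s r t' w' k) \<le> r\<^sup>2 * (real s)\<^sup>2 * sqrt (real t / real t')"
proof -
  have inner: "(\<Sum>i\<in>{1..n}. spike_mean s r t w (j, i) * spike_mean s r t' w' (j, i))
     = r\<^sup>2 * sqrt (real t / real t') * (spike_sign s w j * spike_sign s w' j)" for j
  proof -
    have "(\<Sum>i\<in>{1..n}. spike_mean s r t w (j, i) * spike_mean s r t' w' (j, i))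
      = (\<Sum>i\<in>{1..t}. (r / sqrt (real t) * spike_sign s w j) * (r / sqrt (real t') * spike_sign s w' j))"
      by (rule sum.mono_neutral_cong_right) (use t in \<open>auto simp: spike_mean_def\<close>)
    also have "\<dots> = r\<^sup>2 * (real t / sqrt (real t) / sqrt (real t')) * (spike_sign s w j * spike_sign s w' j)"
      by (simp add: power2_eq_square field_simps)
    also have "real t / sqrt (real t) / sqrt (real t') = sqrt (real t / real t')"
      by (simp add: real_div_sqrt real_sqrt_divide)
    finally show ?thesis .
  qed
  have "(\<Sum>k\<in>idx p n. spike_mean s r t w k * spike_mean s r t' w' k)
    = (\<Sum>j\<in>{1..p}. \<Sum>i\<in>{1..n}. spike_mean s r t w (j, i) * spike_mean s r t' w' (j, i))"
    unfolding idx_def sum.cartesian_product by (rule sum.cong) auto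
  also have "\<dots> = r\<^sup>2 * sqrt (real t / real t') * (\<Sum>j\<in>{1..p}. spike_sign s w j * spike_sign s w' j)"
    by (simp only: inner sum_distrib_left)
  also have "\<dots> = r\<^sup>2 * sqrt (real t / real t') * (\<Sum>B<s. snd (w B) * spike_sign s w' (fst (w B)))"
    by (simp only: spike_sign_sum[OF w(1) p])
  also have "\<dots> \<le> r\<^sup>2 * sqrt (real t / real t') * (real s)\<^sup>2"
  proof (rule mult_left_mono)
    have "(\<Sum>B<s. snd (w B) * spike_sign s w' (fst (w B))) \<le> (\<Sum>B<s. \<Sum>B'<s. 1)"
    proof (rule sum_mono)
      fix B assume B: "B \<in> {..<s}"
      have "\<bar>snd (w B) * spike_sign s w' (fst (w B))\<bar> = \<bar>spike_sign s w' (fst (w B))\<bar>"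
        using spike_priorD(2)[OF w(1), of B] B by auto
      also have "\<dots> \<le> (\<Sum>B'<s. \<bar>if fst (w' B') = fst (w B) then snd (w' B') else 0\<bar>)"
        unfolding spike_sign_def by (rule sum_abs)
      also have "\<dots> \<le> (\<Sum>B'<s. 1)"
        using spike_priorD(2)[OF w(2)] by (intro sum_mono) fastforce
      finally show "snd (w B) * spike_sign s w' (fst (w B)) \<le> (\<Sum>B'<s. 1)" by linarith
    qed
    then show "(\<Sum>B<s. snd (w B) * spike_sign s w' (fst (w B))) \<le> (real s)\<^sup>2"
      by (simp add: power2_eq_square)
  qed simp
  finally show ?thesis by (simp add: mult_ac)
qed

lemma spike_mean_in_Theta1:
  assumes w: "w \<in> spike_prior s b" and p: "s * b \<le> p" and t: "1 \<le> t" "t < n"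
    and r: "0 \<le> r" "\<rho> \<le> r * sqrt (1 - real t / real n)"
  shows "spike_mean s r t w \<in> Theta1_2side p n \<rho> s"
proof -
  let ?S = "(\<lambda>B. fst (w B)) ` {..<s}"
  have "inj_on (\<lambda>B. fst (w B)) {..<s}"
    using spike_priorD(1)[OF w] block_unique by (intro inj_onI) (metis lessThan_iff)
  then have card: "card ?S = s" by (simp add: card_image)
  have sub: "?S \<subseteq> {1..p}" using spike_priorD(1)[OF w] block_subset[OF p] by auto
  have sg: "\<rho> \<le> sqrt (real t * (real n - real t) / real n) * \<bar>r / sqrt (real t) * spike_sign s w j - 0\<bar>" if "j \<in> ?S" for j
  proof -
    from that obtain B where B: "B < s" "j = fst (w B)" by auto
    have a: "\<bar>spike_sign s w j\<bar> = 1" using spike_priorD(2)[OF w B(1)] spike_sign_at[OF w B(1)] B(2) by auto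
    have "real t * (real n - real t) / real n = real t * (1 - real t / real n)"
      using t by (simp add: field_simps)
    then have "sqrt (real t * (real n - real t) / real n) * \<bar>r / sqrt (real t) * spike_sign s w j - 0\<bar> = r * sqrt (1 - real t / real n)"
      using t r a by (simp add: abs_mult real_sqrt_mult)
    then show ?thesis using r(2) by simp
  qed
  show ?thesis
    unfolding Theta1_2side_def mem_Collect_eq
  proof (intro bexI exI conjI)
    show "t \<in> {1..n - 1}" using t by auto
    show "?S \<subseteq> {1..p}" "s \<le> card ?S" using sub card by auto
    show "\<forall>j\<in>{1..p}. \<forall>i\<in>{1..n}. spike_mean s r t w (j, i)
        = (if i \<le> t then (\<lambda>j. r / sqrt (real t) * spike_sign s w j) j else (\<lambda>_. 0) j)"
      by (simp add: spike_mean_def)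
    show "\<forall>j\<in>?S. \<rho> \<le> sqrt (real t * (real n - real t) / real n) * \<bar>(\<lambda>j. r / sqrt (real t) * spike_sign s w j) j - (\<lambda>_. 0) j\<bar>"
      using sg by blast
  qed
qed

text \<open>At \<theta> = 0 the segment statistics of the rows are independent standard normals, so
  the moment of the product over blocks is governed by one Gaussian integral.\<close>

lemma spike_moment:
  fixes r h V :: real
  assumes b: "0 < b" and p: "s * b \<le> p" and t: "1 \<le> t" "t \<le> n" and r: "0 \<le> r" and h: "0 < h" "h \<le> 1"
    and V: "(\<integral>z. std_normal_density z * sym_lr r z powr (1 + h) \<partial>lborel) \<le> V"
  shows "integrable (obs_model p n (\<lambda>_. 0)) (\<lambda>x. ((\<Sum>w\<in>spike_prior s b. likelihood p n (spike_mean s r t w) x)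
       / real (card (spike_prior s b))) powr (1 + h))"
    and "(\<integral>x. ((\<Sum>w\<in>spike_prior s b. likelihood p n (spike_mean s r t w) x)
       / real (card (spike_prior s b))) powr (1 + h) \<partial>obs_model p n (\<lambda>_. 0)) \<le> (1 - h / real b + V / real b powr h) ^ s"
proof -
  interpret prob_space "obs_model p n (\<lambda>_. 0)" by (rule prob_space_obs_model)
  let ?M = "obs_model p n (\<lambda>_. 0)"
  let ?Y = "\<lambda>j x. sym_lr r (segment_stat t j x)"
  have dist: "distributed ?M lborel (segment_stat t j) std_normal_density" if "j \<in> {1..p}" for j
  proof -
    have "distributed ?M lborel (\<lambda>x. \<Sum>i\<in>{1..t}. 1 / sqrt (real t) * x (j, i))
       (normal_density (\<Sum>i\<in>{1..t}. 1 / sqrt (real t) * 0) 1)"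
      by (rule distributed_row_statistic) (use t that in \<open>auto simp: power_divide\<close>)
    then show ?thesis by (simp add: segment_stat_def[abs_def])
  qed
  have "indep_vars (\<lambda>_. borel) (segment_stat t) {1..p}"
    unfolding segment_stat_def[abs_def] by (rule indep_vars_row_statistic) (use t in auto)
  then have ind: "indep_vars (\<lambda>_. borel) ?Y {1..p}"
    by (rule indep_vars_compose2) measurable
  have Y1: "integrable ?M (?Y j)" "expectation (?Y j) = 1" if "j \<in> {1..p}" for j
    using sym_lr_mean[of r] distributed_integrable[OF dist[OF that], of "sym_lr r"]
      distributed_integral[OF dist[OF that], of "sym_lr r"] by auto
  have Y2: "integrable ?M (\<lambda>x. ?Y j x powr (1 + h))" "expectation (\<lambda>x. ?Y j x powr (1 + h)) \<le> V" if "j \<in> {1..p}" for j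
    using sym_lr_moment(1)[OF r, of h] h V distributed_integrable[OF dist[OF that], of "\<lambda>z. sym_lr r z powr (1 + h)"]
      distributed_integral[OF dist[OF that], of "\<lambda>z. sym_lr r z powr (1 + h)"] by auto
  have dis: "disjoint_family_on (block b) {..<s}"
    using block_unique by (fastforce simp: disjoint_family_on_def)
  note bp = block_product_moment[where I="{..<s}" and R="block b" and J="{1..p}" and Y="?Y" and h=h and V=V and b=b,
      OF finite_lessThan finite_block card_block b _ dis ind _ Y1 h Y2]
  show "integrable ?M (\<lambda>x. ((\<Sum>w\<in>spike_prior s b. likelihood p n (spike_mean s r t w) x)
       / real (card (spike_prior s b))) powr (1 + h))"
    unfolding average_likelihood_spike[OF b p t]
    by (rule bp(1)) (use block_subset[OF p] sym_lr_pos in \<open>auto intro: less_imp_le\<close>)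
  have "(\<integral>x. (\<Prod>B<s. (\<Sum>j\<in>block b B. ?Y j x) / real b) powr (1 + h) \<partial>?M) \<le> (1 - h / real b + V / real b powr h) ^ card {..<s}"
    by (rule bp(2)) (use block_subset[OF p] sym_lr_pos in \<open>auto intro: less_imp_le\<close>)
  then show "(\<integral>x. ((\<Sum>w\<in>spike_prior s b. likelihood p n (spike_mean s r t w) x)
       / real (card (spike_prior s b))) powr (1 + h) \<partial>?M) \<le> (1 - h / real b + V / real b powr h) ^ s"
    unfolding average_likelihood_spike[OF b p t] by simp
qed

text \<open>The locations are the powers G^1, ..., G^m: consecutive ones differ by the factor G,
  which damps every inner product by sqrt G. \<open>corr\<close> makes the cross terms small, and
  \<open>few\<close> says that there are enough locations to afford the moment of a single
  one.\<close>

lemma risk_2side_spike_ge: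
  fixes r h V \<rho> :: real and G m :: nat
  assumes b: "0 < b" and p: "s * b \<le> p" and r: "0 \<le> r" and h: "0 < h" "h \<le> 1"
    and V: "(\<integral>z. std_normal_density z * sym_lr r z powr (1 + h) \<partial>lborel) \<le> V"
    and G: "2 \<le> G" and m: "1 \<le> m" "G ^ m < n"
    and \<rho>: "\<rho> \<le> r * sqrt (1 - real G ^ m / real n)"
    and corr: "r\<^sup>2 * (real s)\<^sup>2 / sqrt (real G) \<le> 1 / 9"
    and few: "(1 - h / real b + V / real b powr h) ^ s \<le> (real m / 4) powr h / 16"
  shows "1 / 4 \<le> risk_2side p n \<rho> s"
proof (rule risk_2side_ge)
  fix \<psi> assume \<psi>: "\<psi> \<in> tests p n"
  interpret prob_space "obs_model p n (\<lambda>_. 0)" by (rule prob_space_obs_model)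
  let ?M = "obs_model p n (\<lambda>_. 0)"
  let ?L = "\<lambda>k w. likelihood p n (spike_mean s r (G ^ k) w)"
  have t: "1 \<le> G ^ k" "G ^ k < n" "G ^ k \<le> G ^ m" if "k \<in> {1..m}" for k
  proof -
    show "1 \<le> G ^ k" using G by (simp add: Suc_leI)
    show "G ^ k \<le> G ^ m" using G that by (intro power_increasing) auto
    then show "G ^ k < n" using m(2) by simp
  qed
  have cross: "(\<Sum>q\<in>idx p n. spike_mean s r (G ^ k) w q * spike_mean s r (G ^ k') w' q) \<le> 1 / 9"
    if k: "k \<in> {1..m}" "k' \<in> {1..m}" "k < k'" and w: "w \<in> spike_prior s b" "w' \<in> spike_prior s b" for k k' w w'
  proof -
    have "(\<Sum>q\<in>idx p n. spike_mean s r (G ^ k) w q * spike_mean s r (G ^ k') w' q)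
      \<le> r\<^sup>2 * (real s)\<^sup>2 * sqrt (real (G ^ k) / real (G ^ k'))"
      by (rule spike_mean_inner_le[OF w p]) (use t k G in \<open>auto intro: less_imp_le power_increasing\<close>)
    also have "\<dots> \<le> r\<^sup>2 * (real s)\<^sup>2 * sqrt (1 / real G)"
    proof (intro mult_left_mono real_sqrt_le_mono)
      have "real G ^ (k + 1) \<le> real G ^ k'" using k G by (intro power_increasing) auto
      then show "real (G ^ k) / real (G ^ k') \<le> 1 / real G" using G by (simp add: field_simps)
    qed auto
    also have "\<dots> = r\<^sup>2 * (real s)\<^sup>2 / sqrt (real G)" by (simp add: real_sqrt_divide)
    also note corr
    finally show ?thesis .
  qed
  have cross': "(\<Sum>q\<in>idx p n. spike_mean s r (G ^ k) w q * spike_mean s r (G ^ k') w' q) \<le> 1 / 9"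
    if "k \<in> {1..m}" "k' \<in> {1..m}" "k \<noteq> k'" "w \<in> spike_prior s b" "w' \<in> spike_prior s b" for k k' w w'
    using cross[of k k' w w'] cross[of k' k w' w] that by (cases "k < k'") (auto simp: mult.commute)
  \<comment> \<open>The constant 1/9 in \<open>corr\<close> is chosen for this: exp (-1/9) \<ge>
    8/9.\<close>
  have exp9: "exp (1 / 9 :: real) \<le> 9 / 8"
    using exp_ge_add_one_self[of "- (1 / 9) :: real"] by (simp add: exp_minus field_simps)
  have "\<exists>k\<in>{1..m}. \<exists>w\<in>spike_prior s b. 1 / 4 \<le> expectation \<psi> + expectation (\<lambda>x. ?L k w x * (1 - \<psi> x))"
  proof (rule mixture_testing_bound[where h=h])
    show "integrable ?M (\<lambda>x. ?L k w x * ?L k' w' x)" for k w k' w'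
      unfolding likelihood_mult using likelihood_integral(1) by simp
    show "expectation (\<lambda>x. ?L k w x * ?L k' w' x) \<le> 9 / 8"
      if "k \<in> {1..m}" "w \<in> spike_prior s b" "k' \<in> {1..m}" "w' \<in> spike_prior s b" "k \<noteq> k'" for k w k' w'
    proof -
      have "expectation (\<lambda>x. ?L k w x * ?L k' w' x)
        = exp (\<Sum>q\<in>idx p n. spike_mean s r (G ^ k) w q * spike_mean s r (G ^ k') w' q)"
        unfolding likelihood_mult using likelihood_integral by simp
      also have "\<dots> \<le> exp (1 / 9)" using cross'[of k k' w w'] that by simp
      finally show ?thesis using exp9 by simp
    qed
    show "integrable ?M (\<lambda>x. ((\<Sum>w\<in>spike_prior s b. ?L k w x) / real (card (spike_prior s b))) powr (1 + h))"
      if "k \<in> {1..m}" for k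
      using t[OF that] by (intro spike_moment(1)[OF b p _ _ r h V]) auto
    show "expectation (\<lambda>x. ((\<Sum>w\<in>spike_prior s b. ?L k w x) / real (card (spike_prior s b))) powr (1 + h))
        \<le> (real (card {1..m}) / 4) powr h / 16" if "k \<in> {1..m}" for k
      using spike_moment(2)[OF b p t(1)[OF that] less_imp_le[OF t(2)[OF that]] r h V] few by simp
    show "\<psi> \<in> borel_measurable ?M"
      using \<psi> by (simp add: tests_def measurable_cong_sets[OF sets_obs_model refl])
    show "\<psi> x \<in> {0, 1}" if "x \<in> space ?M" for x
      using \<psi> that unfolding tests_def by (auto simp: space_obs_model space_PiM)
  qed (use m h b likelihood_nonneg likelihood_integral finite_spike_prior spike_prior_nonempty in auto)
  then obtain k w where k: "k \<in> {1..m}" and w: "w \<in> spike_prior s b"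
    and ge: "1 / 4 \<le> expectation \<psi> + expectation (\<lambda>x. ?L k w x * (1 - \<psi> x))" by blast
  show "\<exists>\<theta>\<in>Theta1_2side p n \<rho> s. 1 / 4 \<le> integral\<^sup>L (obs_model p n (\<lambda>_. 0)) \<psi> + integral\<^sup>L (obs_model p n \<theta>) (\<lambda>x. 1 - \<psi> x)"
  proof
    have "\<rho> \<le> r * sqrt (1 - real (G ^ k) / real n)"
    proof -
      have "real (G ^ k) \<le> real G ^ m" using t(3)[OF k] by (metis of_nat_le_iff of_nat_power)
      then have "r * sqrt (1 - real G ^ m / real n) \<le> r * sqrt (1 - real (G ^ k) / real n)"
        using r by (intro mult_left_mono real_sqrt_le_mono diff_left_mono divide_right_mono) auto
      then show ?thesis using \<rho> by simp
    qed
    then show "spike_mean s r (G ^ k) w \<in> Theta1_2side p n \<rho> s"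
      using t[OF k] r by (intro spike_mean_in_Theta1[OF w p]) auto
    have "(\<lambda>x. 1 - \<psi> x) \<in> borel_measurable ?M"
      using \<psi> by (auto simp: tests_def measurable_cong_sets[OF sets_obs_model refl])
    from integral_obs_model[OF this] ge
    show "1 / 4 \<le> integral\<^sup>L (obs_model p n (\<lambda>_. 0)) \<psi> + integral\<^sup>L (obs_model p n (spike_mean s r (G ^ k) w)) (\<lambda>x. 1 - \<psi> x)"
      by simp
  qed
qed

section \<open>Asymptotic regimes: upper bound\<close>

lemma filterlim_nat_powr_at_top: "0 < c \<Longrightarrow> filterlim (\<lambda>p. real p powr c) at_top sequentially"
  by real_asymp

lemma eventually_powr_le:
  fixes c d C :: real
  assumes "c < d"
  shows "\<forall>\<^sub>F p in sequentially. C * real p powr c \<le> real p powr d"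
proof -
  have "filterlim (\<lambda>p. real p powr (d - c)) at_top sequentially"
    using assms by (intro filterlim_nat_powr_at_top) simp
  then have "\<forall>\<^sub>F p in sequentially. C \<le> real p powr (d - c)"
    by (simp add: filterlim_at_top)
  then show ?thesis
    using eventually_gt_at_top[of 0]
  proof eventually_elim
    case (elim p)
    have "C * real p powr c \<le> real p powr (d - c) * real p powr c"
      using elim by (intro mult_right_mono) auto
    then show ?case by (simp flip: powr_add)
  qed
qed

lemma eventually_ln_le_powr:
  fixes d C :: real
  assumes "0 < d"
  shows "\<forall>\<^sub>F p in sequentially. C * ln (real p) \<le> real p powr d"
proof -
  have "\<forall>\<^sub>F p in sequentially. (\<bar>C\<bar> * 2 / d) * real p powr (d / 2) \<le> real p powr d"
    using assms by (intro eventually_powr_le) simp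
  then show ?thesis
    using eventually_ge_at_top[of 1]
  proof eventually_elim
    case (elim p)
    have "C * ln (real p) \<le> \<bar>C\<bar> * ln (real p)" using elim by (intro mult_right_mono) auto
    also have "\<dots> \<le> \<bar>C\<bar> * (real p powr (d / 2) / (d / 2))"
      using elim assms by (intro mult_left_mono ln_powr_bound) auto
    also have "\<dots> = (\<bar>C\<bar> * 2 / d) * real p powr (d / 2)" by simp
    finally show ?case using elim by linarith
  qed
qed

lemma eventually_asymp_equiv_bounds:
  fixes f g :: "nat \<Rightarrow> real"
  assumes fg: "f \<sim>[at_top] g" and g: "\<forall>\<^sub>F p in sequentially. 0 < g p" and e: "0 < e"
  shows "\<forall>\<^sub>F p in sequentially. (1 - e) * g p \<le> f p \<and> f p \<le> (1 + e) * g p"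
proof -
  have "((\<lambda>p. f p / g p) \<longlongrightarrow> 1) sequentially"
    by (rule asymp_equivD_strong[OF fg]) (use g in \<open>auto elim: eventually_mono\<close>)
  then have "\<forall>\<^sub>F p in sequentially. dist (f p / g p) 1 < e" using e by (rule tendstoD)
  then show ?thesis
    using g
  proof eventually_elim
    case (elim p)
    then have "1 - e \<le> f p / g p" "f p / g p \<le> 1 + e" by (auto simp: dist_real_def abs_less_iff)
    then show ?case using elim by (auto simp: field_simps)
  qed
qed

text \<open>As ln x = ln |x| for negative x, a positive triple logarithm could come from negative inner
  logarithms; this is excluded because ln (ln n) is never below -1 for a natural number n.\<close>

lemma ln_eq_exp_of_triple_ln:
  assumes "0 < ln (ln (ln (real n)))"
  shows "ln (real n) = exp (exp (ln (ln (ln (real n)))))"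
proof -
  have n: "2 \<le> n"
  proof (rule ccontr)
    assume "\<not> 2 \<le> n"
    then have "n = 0 \<or> n = 1" by auto
    then show False using assms by auto
  qed
  have "ln (1 / 2) \<le> ln (ln (real n))"
  proof (rule ln_mono)
    have "1 / 2 \<le> ln (2 :: real)" using ln2_ge_two_thirds by simp
    also have "\<dots> \<le> ln (real n)" using n by simp
    finally show "1 / 2 \<le> ln (real n)" .
  qed (use n in auto)
  then have "- 1 \<le> ln (ln (real n))" using ln_2_less_1 by (simp add: ln_div)
  moreover have "1 < \<bar>ln (ln (real n))\<bar>"
  proof (rule ccontr)
    assume "\<not> ?thesis"
    then have "ln \<bar>ln (ln (real n))\<bar> \<le> 0" by (cases "ln (ln (real n)) = 0") auto
    then show False using assms by (simp add: abs_if ln_minus split: if_splits)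
  qed
  ultimately have "1 < ln (ln (real n))" by linarith
  then have "exp (ln (ln (ln (real n)))) = ln (ln (real n))" by simp
  moreover have "exp (ln (ln (real n))) = ln (real n)" using n by simp
  ultimately show ?thesis by simp
qed

text \<open>A relative error in the triple logarithm is an additive error in the exponent of p, so
  three logarithms can be inverted at the price of an arbitrarily small d.\<close>

lemma ln_n_bounds:
  fixes n :: "nat \<Rightarrow> nat"
  assumes a: "0 < a" and n: "(\<lambda>p. ln (ln (ln (real (n p))))) \<sim>[at_top] (\<lambda>p. a * ln (real p))"
    and d: "0 < d"
  shows "\<forall>\<^sub>F p in sequentially. exp (real p powr (a - d)) \<le> ln (real (n p)) \<and> ln (real (n p)) \<le> exp (real p powr (a + d))"
proof -
  have pos: "\<forall>\<^sub>F p in sequentially. 0 < a * ln (real p)"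
    using eventually_gt_at_top[of 1] by (rule eventually_mono) (use a in auto)
  \<comment> \<open>The cap 1/2 keeps the triple logarithm positive, as its inversion
    requires.\<close>
  define e where "e = min (d / a) (1 / 2)"
  have e: "0 < e" "e * a \<le> d" "e \<le> 1 / 2" using a d by (auto simp: e_def min_def field_simps)
  show ?thesis
    using eventually_asymp_equiv_bounds[OF n pos e(1)] pos eventually_gt_at_top[of 1]
  proof eventually_elim
    case (elim p)
    let ?l = "ln (ln (ln (real (n p))))"
    have "0 < (1 - e) * (a * ln (real p))" using elim e a by (intro mult_pos_pos) auto
    then have l: "0 < ?l" using elim by linarith
    have "(a - d) * ln (real p) \<le> ?l" "?l \<le> (a + d) * ln (real p)"
    proof -
      have le: "e * a * ln (real p) \<le> d * ln (real p)" using e elim by (intro mult_right_mono) auto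
      have "(a - d) * ln (real p) = a * ln (real p) - d * ln (real p)" by (rule left_diff_distrib)
      also have "\<dots> \<le> a * ln (real p) - e * a * ln (real p)" using le by (rule diff_left_mono)
      also have "\<dots> = (1 - e) * (a * ln (real p))" by algebra
      also have "\<dots> \<le> ?l" using elim by blast
      finally show "(a - d) * ln (real p) \<le> ?l" .
      have "?l \<le> (1 + e) * (a * ln (real p))" using elim by blast
      also have "\<dots> = a * ln (real p) + e * a * ln (real p)" by algebra
      also have "\<dots> \<le> a * ln (real p) + d * ln (real p)" using le by (rule add_left_mono)
      also have "\<dots> = (a + d) * ln (real p)" by algebra
      finally show "?l \<le> (a + d) * ln (real p)" .
    qed
    then have "real p powr (a - d) \<le> exp ?l" "exp ?l \<le> real p powr (a + d)"
      using elim by (simp_all add: powr_def)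
    then show ?case
      by (subst (1 2) ln_eq_exp_of_triple_ln[OF l]) simp
  qed
qed

lemma s_bounds:
  fixes s :: "nat \<Rightarrow> nat"
  assumes s: "(\<lambda>p. real (s p)) \<sim>[at_top] (\<lambda>p. real p powr (1 - \<beta>))" and b: "0 < \<beta>"
  shows "\<forall>\<^sub>F p in sequentially. real p powr (1 - \<beta>) / 2 \<le> real (s p) \<and> real (s p) \<le> 2 * real p powr (1 - \<beta>) \<and> s p \<le> p \<and> 1 < p"
proof -
  have pos: "\<forall>\<^sub>F p in sequentially. 0 < real p powr (1 - \<beta>)"
    using eventually_gt_at_top[of 0] by (auto elim!: eventually_mono)
  have "\<forall>\<^sub>F p in sequentially. 2 * real p powr (1 - \<beta>) \<le> real p powr 1"
    using b by (intro eventually_powr_le) simp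
  have "\<forall>\<^sub>F p in sequentially. (1 - 1 / 2) * real p powr (1 - \<beta>) \<le> real (s p) \<and> real (s p) \<le> (1 + 1 / 2) * real p powr (1 - \<beta>)"
    using eventually_asymp_equiv_bounds[OF s pos, of "1 / 2"] by simp
  then show ?thesis
    using \<open>\<forall>\<^sub>F p in sequentially. 2 * real p powr (1 - \<beta>) \<le> real p powr 1\<close> pos eventually_gt_at_top[of 1]
  proof eventually_elim
    case (elim p)
    then have "real (s p) \<le> real p" by (simp add: powr_one)
    then show ?case using elim by auto
  qed
qed

section \<open>From Chernoff exponents to vanishing risk\<close>

lemma risk_tendsto_0I:
  fixes n s :: "nat \<Rightarrow> nat" and \<rho> g h :: "nat \<Rightarrow> real"
  assumes a: "0 < a" and n: "(\<lambda>p. ln (ln (ln (real (n p))))) \<sim>[at_top] (\<lambda>p. a * ln (real p))"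
    and s: "\<forall>\<^sub>F p in sequentially. s p \<le> p"
    and L: "0 < L" and \<eta>: "0 < \<eta>"
    and g: "\<forall>\<^sub>F p in sequentially. real p powr (a + \<eta>) \<le> C * g p" and C: "0 < C"
    and h: "h \<longlonglongrightarrow> 0"
    and le: "\<forall>\<^sub>F p in sequentially. 2 \<le> n p \<longrightarrow> risk_2side p (n p) (\<rho> p) (s p) \<le> (2 * ln (real (n p)) / L + 2) * exp (- g p) + h p"
  shows "(\<lambda>p. risk_2side p (n p) (\<rho> p) (s p)) \<longlonglongrightarrow> 0"
proof (rule tendsto_sandwich)
  note nb = ln_n_bounds[OF a n, of "\<eta> / 2"]
  have n2: "\<forall>\<^sub>F p in sequentially. 2 \<le> n p"
    using nb
  proof (rule eventually_mono)
    fix p assume "exp (real p powr (a - \<eta> / 2)) \<le> ln (real (n p)) \<and> ln (real (n p)) \<le> exp (real p powr (a + \<eta> / 2))"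
    then have "ln (real (n p)) > 0" using exp_gt_zero[of "real p powr (a - \<eta> / 2)"] by linarith
    then show "2 \<le> n p" by (cases "n p = 0 \<or> n p = 1") auto
  qed (use \<eta> in simp)
  show "\<forall>\<^sub>F p in sequentially. 0 \<le> risk_2side p (n p) (\<rho> p) (s p)"
    using n2 s by eventually_elim (intro risk_2side_nonneg Theta1_2side_nonempty)
  \<comment> \<open>Gives g \<ge> 2x with x = p^(a + \<eta>/2): one x pays for ln n \<le> exp x, the
    other one is left over for convergence.\<close>
  have dom: "\<forall>\<^sub>F p in sequentially. (2 * C) * real p powr (a + \<eta> / 2) \<le> real p powr (a + \<eta>)"
    using \<eta> by (intro eventually_powr_le) simp
  show "\<forall>\<^sub>F p in sequentially. risk_2side p (n p) (\<rho> p) (s p) \<le> (2 / L + 2) * exp (- (real p powr (a + \<eta> / 2))) + h p"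
    using nb[OF half_gt_zero[OF \<eta>]] n2 le g dom
  proof eventually_elim
    case (elim p)
    let ?x = "real p powr (a + \<eta> / 2)"
    have "C * (2 * ?x) \<le> C * g p" using elim by simp
    then have gx: "2 * ?x \<le> g p" using C by simp
    have "risk_2side p (n p) (\<rho> p) (s p) \<le> (2 * ln (real (n p)) / L + 2) * exp (- g p) + h p"
      using elim by simp
    also have "(2 * ln (real (n p)) / L + 2) * exp (- g p) \<le> (2 * exp ?x / L + 2 * exp ?x) * exp (- (2 * ?x))"
    proof (rule mult_mono)
      show "2 * ln (real (n p)) / L + 2 \<le> 2 * exp ?x / L + 2 * exp ?x"
        using elim L by (intro add_mono divide_right_mono) auto
      show "exp (- g p) \<le> exp (- (2 * ?x))" using gx by simp
    qed (use L in auto)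
    also have "\<dots> = (2 / L + 2) * (exp ?x * exp (- (2 * ?x)))" by (simp add: algebra_simps)
    also have "exp ?x * exp (- (2 * ?x)) = exp (- ?x)" by (simp flip: exp_add)
    finally show ?case by simp
  qed
  have "filterlim (\<lambda>p. real p powr (a + \<eta> / 2)) at_top sequentially"
    using a \<eta> by (intro filterlim_nat_powr_at_top) simp
  then have "(\<lambda>p. exp (- (real p powr (a + \<eta> / 2)))) \<longlonglongrightarrow> 0"
    by (intro filterlim_compose[OF exp_at_bot]) (simp add: filterlim_uminus_at_top[symmetric])
  from tendsto_add[OF tendsto_mult_right_zero[OF this, of "2 / L + 2"] h]
  show "(\<lambda>p. (2 / L + 2) * exp (- (real p powr (a + \<eta> / 2))) + h p) \<longlonglongrightarrow> 0" by simp
qed simp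

text \<open>A Bernstein-type choice of parameters: the critical count is halfway between the null
  mean q and q + E, and both errors use the same Chernoff parameter c. Its two branches produce the
  linear and the quadratic exponent.\<close>

lemma risk_2side_count_le':
  fixes p n s :: nat and e \<tau> \<rho> \<Delta> Q :: real
  assumes n: "2 \<le> n" and s: "s \<le> p" and e: "0 < e" and \<tau>: "0 \<le> \<tau>" and \<rho>: "0 \<le> \<rho>"
    and \<Delta>: "0 \<le> \<Delta>" "\<And>m. \<rho> / sqrt (1 + e) \<le> \<bar>m\<bar> \<Longrightarrow> exceed_prob 0 \<tau> + \<Delta> \<le> exceed_prob m \<tau>"
    and Q: "0 < Q" "real p * exceed_prob 0 \<tau> \<le> Q"
  defines "g \<equiv> min (real s * \<Delta>) ((real s * \<Delta>)\<^sup>2 / Q) / 32"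
  shows "risk_2side p n \<rho> s \<le> (2 * ln (real n) / ln (1 + e) + 2) * exp (- g) + exp (- g)"
proof -
  define E where "E = real s * \<Delta>"
  \<comment> \<open>Of the order of the optimal E/Q, but capped at 1/8 so that exponentials can be
    expanded to second order. Each quadratic correction, c^2 q and c^2 E, is then at most cE/8; of
    the main term cE/2 at least cE/4 survives, which is \<open>g\<close>.\<close>
  define c where "c = min (1 / 8) (E / (8 * Q))"
  define q where "q = real p * exceed_prob 0 \<tau>"
  define k where "k = q + E / 2"
  have E: "0 \<le> E" using \<Delta> by (simp add: E_def)
  have c: "0 \<le> c" "c \<le> 1 / 8" "c * Q \<le> E / 8"
    using E Q by (auto simp: c_def min_def field_simps)
  have cg: "c * E / 4 = g"
  proof (cases "E \<le> Q")
    case True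
    then have "c = E / (8 * Q)" "E * E \<le> E * Q" using Q E by (auto simp: c_def min_def field_simps mult_left_mono)
    moreover have "min E (E\<^sup>2 / Q) = E\<^sup>2 / Q" using calculation Q by (simp add: min_def power2_eq_square field_simps)
    ultimately show ?thesis unfolding g_def E_def[symmetric] by (simp add: power2_eq_square)
  next
    case False
    then have "c = 1 / 8" "E * Q \<le> E * E" using Q E by (auto simp: c_def min_def field_simps mult_left_mono)
    moreover have "min E (E\<^sup>2 / Q) = E" using calculation Q by (simp add: min_def power2_eq_square field_simps)
    ultimately show ?thesis unfolding g_def E_def[symmetric] by simp
  qed
  have q: "0 \<le> q" "q \<le> Q" using Q exceed_prob_nonneg by (auto simp: q_def)
  have cq: "c * c * q \<le> c * E / 8"
  proof -
    have "c * c * q \<le> c * (c * Q)" using q c by (simp add: mult.assoc mult_left_mono)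
    also have "\<dots> \<le> c * (E / 8)" using c by (intro mult_left_mono) auto
    finally show ?thesis by simp
  qed
  have cE: "c * c * E \<le> c * E / 8"
    using mult_right_mono[OF c(2), of "c * E"] c E by (simp add: mult_ac)
  have null: "q * (exp c - 1) - c * k \<le> - g"
  proof -
    have "exp c \<le> 1 + c + c\<^sup>2" using c by (intro exp_bound) auto
    then have "q * (exp c - 1) \<le> q * (c + c * c)" using q by (intro mult_left_mono) (auto simp: power2_eq_square)
    moreover have "q * (c + c * c) - c * k = c * c * q - c * E / 2" by (simp add: k_def algebra_simps)
    ultimately show ?thesis using cq mult_nonneg_nonneg[OF c(1) E] cg by linarith
  qed
  have alt: "c * k - (q + E) * (1 - exp (- c)) \<le> - g"
  proof -
    have "exp (- c) \<le> 1 / (1 + c)"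
      using exp_ge_add_one_self[of c] c by (simp add: exp_minus inverse_eq_divide frac_le)
    also have "\<dots> \<le> 1 - c + c * c"
    proof -
      have "1 \<le> (1 - c + c * c) * (1 + c)" using c by (simp add: algebra_simps)
      then show ?thesis using c by (simp add: divide_le_eq)
    qed
    finally have "(q + E) * (c - c * c) \<le> (q + E) * (1 - exp (- c))"
      using q E by (intro mult_left_mono) auto
    then show ?thesis using cq cE unfolding k_def cg[symmetric] by (simp add: algebra_simps)
  qed
  have "risk_2side p n \<rho> s \<le> (2 * ln (real n) / ln (1 + e) + 2) * exp (q * (exp c - 1) - c * k)
      + exp (c * k - (q + E) * (1 - exp (- c)))"
    unfolding q_def E_def by (rule risk_2side_count_le[OF n s e \<tau> \<rho> c(1) c(1) \<Delta>])
  also have "\<dots> \<le> (2 * ln (real n) / ln (1 + e) + 2) * exp (- g) + exp (- g)"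
    using null alt n e by (intro add_mono mult_left_mono) (auto intro!: divide_nonneg_nonneg add_nonneg_nonneg)
  finally show ?thesis .
qed

lemma risk_count_tendsto_0:
  fixes n s :: "nat \<Rightarrow> nat" and \<rho> \<tau> \<Delta> Q :: "nat \<Rightarrow> real"
  assumes a: "0 < a" and n: "(\<lambda>p. ln (ln (ln (real (n p))))) \<sim>[at_top] (\<lambda>p. a * ln (real p))"
    and s: "\<forall>\<^sub>F p in sequentially. s p \<le> p" and e: "0 < e" and \<eta>: "0 < \<eta>"
    and ev: "\<forall>\<^sub>F p in sequentially. 0 \<le> \<tau> p \<and> 0 \<le> \<rho> p \<and> 0 \<le> \<Delta> p \<and> 0 < Q p \<and> real p * exceed_prob 0 (\<tau> p) \<le> Q p \<and>
      (\<forall>m. \<rho> p / sqrt (1 + e) \<le> \<bar>m\<bar> \<longrightarrow> exceed_prob 0 (\<tau> p) + \<Delta> p \<le> exceed_prob m (\<tau> p))"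
    and E: "\<forall>\<^sub>F p in sequentially. real p powr (a + \<eta>) \<le> real (s p) * \<Delta> p"
      "\<forall>\<^sub>F p in sequentially. Q p * real p powr (a + \<eta>) \<le> (real (s p) * \<Delta> p)\<^sup>2"
  shows "(\<lambda>p. risk_2side p (n p) (\<rho> p) (s p)) \<longlonglongrightarrow> 0"
proof -
  let ?g = "\<lambda>p. min (real (s p) * \<Delta> p) ((real (s p) * \<Delta> p)\<^sup>2 / Q p) / 32"
  have g: "\<forall>\<^sub>F p in sequentially. real p powr (a + \<eta>) \<le> 32 * ?g p"
    using ev E by eventually_elim (auto simp: field_simps)
  have "filterlim (\<lambda>p. real p powr (a + \<eta>)) at_top sequentially"
    using a \<eta> by (intro filterlim_nat_powr_at_top) simp
  then have "filterlim (\<lambda>p. 32 * ?g p) at_top sequentially"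
    by (rule filterlim_at_top_mono) (rule g)
  then have "filterlim (\<lambda>p. (1 / 32) * (32 * ?g p)) at_top sequentially"
    by (rule filterlim_tendsto_pos_mult_at_top[OF tendsto_const, rotated]) simp
  then have "filterlim ?g at_top sequentially" by simp
  then have h: "(\<lambda>p. exp (- ?g p)) \<longlonglongrightarrow> 0"
    by (intro filterlim_compose[OF exp_at_bot]) (simp only: filterlim_uminus_at_top[symmetric])
  have le: "\<forall>\<^sub>F p in sequentially. 2 \<le> n p \<longrightarrow> risk_2side p (n p) (\<rho> p) (s p)
      \<le> (2 * ln (real (n p)) / ln (1 + e) + 2) * exp (- ?g p) + exp (- ?g p)"
    using ev s by eventually_elim (auto intro!: risk_2side_count_le' e)
  show ?thesis
    by (rule risk_tendsto_0I[OF a n s _ \<eta> g _ h le]) (use e in auto)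
qed

text \<open>With expected gain p^d and expected null count p^f, the linear and the quadratic
  Chernoff exponent become d and 2d - f. A regime is thereby reduced to two inequalities against
  a.\<close>

lemma risk_count_powr_tendsto_0:
  fixes n s :: "nat \<Rightarrow> nat" and \<rho> \<tau> \<Delta> Q :: "nat \<Rightarrow> real" and C d f :: real
  assumes a: "0 < a" and n: "(\<lambda>p. ln (ln (ln (real (n p))))) \<sim>[at_top] (\<lambda>p. a * ln (real p))"
    and s: "\<forall>\<^sub>F p in sequentially. s p \<le> p" and e: "0 < e"
    and ev: "\<forall>\<^sub>F p in sequentially. 0 \<le> \<tau> p \<and> 0 \<le> \<rho> p \<and> 0 \<le> \<Delta> p \<and> 0 < Q p \<and> real p * exceed_prob 0 (\<tau> p) \<le> Q p \<and>
      (\<forall>m. \<rho> p / sqrt (1 + e) \<le> \<bar>m\<bar> \<longrightarrow> exceed_prob 0 (\<tau> p) + \<Delta> p \<le> exceed_prob m (\<tau> p))"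
    and C: "0 < C" "\<forall>\<^sub>F p in sequentially. C * real p powr d \<le> real (s p) * \<Delta> p"
    and Q: "\<forall>\<^sub>F p in sequentially. Q p \<le> 2 * real p powr f"
    and df: "a < d" "a < 2 * d - f"
  shows "(\<lambda>p. risk_2side p (n p) (\<rho> p) (s p)) \<longlonglongrightarrow> 0"
proof -
  define \<eta> where "\<eta> = min (d - a) (2 * d - f - a) / 2"
  have \<eta>: "0 < \<eta>" "a + \<eta> < d" "f + (a + \<eta>) < 2 * d" using df by (auto simp: \<eta>_def min_def field_simps)
  show ?thesis
  proof (rule risk_count_tendsto_0[OF a n s e \<eta>(1) ev])
    show "\<forall>\<^sub>F p in sequentially. real p powr (a + \<eta>) \<le> real (s p) * \<Delta> p"
      using C(2) eventually_powr_le[OF \<eta>(2), of "1 / C"]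
    proof eventually_elim
      case (elim p)
      then have "real p powr (a + \<eta>) \<le> C * real p powr d" using C(1) by (simp add: field_simps)
      then show ?case using elim by simp
    qed
    show "\<forall>\<^sub>F p in sequentially. Q p * real p powr (a + \<eta>) \<le> (real (s p) * \<Delta> p)\<^sup>2"
      using C(2) Q eventually_powr_le[OF \<eta>(3), of "2 / C\<^sup>2"]
    proof eventually_elim
      case (elim p)
      have "Q p * real p powr (a + \<eta>) \<le> 2 * real p powr f * real p powr (a + \<eta>)"
        using elim by (intro mult_right_mono) auto
      also have "\<dots> = 2 * real p powr (f + (a + \<eta>))" by (simp add: powr_add)
      also have "\<dots> \<le> C\<^sup>2 * real p powr (2 * d)" using elim C(1) by (simp add: field_simps)
      also have "\<dots> = (C * real p powr d)\<^sup>2" by (simp add: power_mult_distrib power2_eq_square flip: powr_add)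
      also have "\<dots> \<le> (real (s p) * \<Delta> p)\<^sup>2" using elim C(1) by (intro power_mono) auto
      finally show ?case .
    qed
  qed
qed

section \<open>Upper bounds in the individual regimes\<close>

lemma half_le_one_minus_exp:
  fixes u :: real
  assumes "0 \<le> u" "u \<le> 1"
  shows "u / 2 \<le> 1 - exp (- u)"
proof -
  have "exp (- u) \<le> 1 / (1 + u)"
    using exp_ge_add_one_self[of u] assms by (simp add: exp_minus inverse_eq_divide frac_le)
  also have "\<dots> \<le> 1 - u / 2"
  proof -
    have "1 \<le> (1 - u / 2) * (1 + u)"
      using assms mult_left_mono[of u 1 u] by (simp add: algebra_simps)
    then show ?thesis using assms by (subst pos_divide_le_eq) auto
  qed
  finally show ?thesis by simp
qed

text \<open>At the constant threshold 1 the gain is quadratic in the signal, hence of order \<rho>^2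
  = p^x with x \<le> 0, while the null count is at most p. The quadratic condition 1 - 2\<beta> + 2x
  > a is exactly \<beta> < \<beta>1. A grid with e = 1 suffices, since constant factors in \<rho>
  are irrelevant.\<close>

lemma upper_bound_dense:
  fixes n s :: "nat \<Rightarrow> nat"
  assumes a: "0 < a" and n: "(\<lambda>p. ln (ln (ln (real (n p))))) \<sim>[at_top] (\<lambda>p. a * ln (real p))"
    and s: "(\<lambda>p. real (s p)) \<sim>[at_top] (\<lambda>p. real p powr (1 - \<beta>))"
    and \<beta>: "0 < \<beta>" "\<beta> < \<beta>1" and dense: "a \<le> 1 - 2 * \<beta>1"
  shows "(\<lambda>p. risk_2side p (n p) (sqrt (real p powr ((a - (1 - 2 * \<beta>1)) / 2))) (s p)) \<longlonglongrightarrow> 0"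
proof -
  define x where "x = (a - (1 - 2 * \<beta>1)) / 2"
  define \<phi> where "\<phi> = std_normal_density 1"
  have \<phi>: "0 < \<phi>" by (simp add: \<phi>_def normal_density_pos)
  note sb = s_bounds[OF s \<beta>(1)]
  have "(\<lambda>p. risk_2side p (n p) (sqrt (real p powr x)) (s p)) \<longlonglongrightarrow> 0"
  proof (rule risk_count_powr_tendsto_0[OF a n, where e=1 and \<tau>="\<lambda>_. 1" and \<Delta>="\<lambda>p. \<phi> / 4 * real p powr x" and Q=real
        and d="1 - \<beta> + x" and f=1 and C="\<phi> / 8"])
    show "\<forall>\<^sub>F p in sequentially. s p \<le> p" using sb by eventually_elim simp
    show "\<forall>\<^sub>F p in sequentially. 0 \<le> (1 :: real) \<and> 0 \<le> sqrt (real p powr x) \<and> 0 \<le> \<phi> / 4 * real p powr x \<and> 0 < real p \<and>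
        real p * exceed_prob 0 1 \<le> real p \<and>
        (\<forall>m. sqrt (real p powr x) / sqrt (1 + 1) \<le> \<bar>m\<bar> \<longrightarrow> exceed_prob 0 1 + \<phi> / 4 * real p powr x \<le> exceed_prob m 1)"
      using sb
    proof eventually_elim
      case (elim p)
      have "exceed_prob 0 1 + \<phi> / 4 * real p powr x \<le> exceed_prob m 1" if m: "sqrt (real p powr x) / sqrt (1 + 1) \<le> \<bar>m\<bar>" for m
      proof -
        let ?u = "real p powr x / 4"
        have "real p powr x \<le> real p powr 0" using elim dense by (intro powr_mono) (auto simp: x_def)
        then have "?u / 2 \<le> 1 - exp (- ?u)" using elim by (intro half_le_one_minus_exp) auto
        also have "\<dots> \<le> 1 - exp (- (m\<^sup>2) / 2)"
        proof -
          have "(sqrt (real p powr x) / sqrt (1 + 1))\<^sup>2 \<le> \<bar>m\<bar>\<^sup>2" by (rule power_mono[OF m]) simp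
          then show ?thesis by (simp add: power_divide)
        qed
        finally have "2 * 1 * \<phi> * (?u / 2) \<le> 2 * 1 * \<phi> * (1 - exp (- (m\<^sup>2) / 2))"
          using \<phi> by (intro mult_left_mono) auto
        then show ?thesis using exceed_prob_gain[of 1 m] by (simp add: \<phi>_def)
      qed
      then show ?case using elim \<phi> exceed_prob_le_1 mult_left_mono[OF exceed_prob_le_1, of "real p" 0 1] by auto
    qed
    show "\<forall>\<^sub>F p in sequentially. \<phi> / 8 * real p powr (1 - \<beta> + x) \<le> real (s p) * (\<phi> / 4 * real p powr x)"
      using sb
    proof eventually_elim
      case (elim p)
      have "(real p powr (1 - \<beta>) / 2) * (\<phi> / 4 * real p powr x) \<le> real (s p) * (\<phi> / 4 * real p powr x)"
        using elim \<phi> by (intro mult_right_mono) auto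
      then show ?case by (simp add: powr_add mult_ac)
    qed
    show "\<forall>\<^sub>F p in sequentially. real p \<le> 2 * real p powr 1"
      using eventually_gt_at_top[of 0] by eventually_elim simp
    have "0 < a" "0 < \<beta>1" using a \<beta> by auto
    then show "a < 1 - \<beta> + x" "a < 2 * (1 - \<beta> + x) - 1" using \<beta> dense by (auto simp: x_def field_simps)
  qed (use \<phi> in auto)
  then show ?thesis by (simp add: x_def)
qed

text \<open>Serves both logarithmic regimes. In units of sqrt(2 log p) the threshold is x and the
  signal x - sqrt y0, so null rows exceed with probability about p^(-x^2) and signal rows with about
  p^(-y0). The last two hypotheses are the linear and quadratic conditions; y0 < x^2 makes the
  signal positive and the null probability negligible against the gain.\<close>

lemma upper_bound_sparse:
  fixes n s :: "nat \<Rightarrow> nat" and x y0 :: real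
  assumes a: "0 < a" and n: "(\<lambda>p. ln (ln (ln (real (n p))))) \<sim>[at_top] (\<lambda>p. a * ln (real p))"
    and s: "(\<lambda>p. real (s p)) \<sim>[at_top] (\<lambda>p. real p powr (1 - \<beta>))"
    and \<beta>: "0 < \<beta>" and x: "0 < x" "0 \<le> y0" "y0 < x\<^sup>2" and y0: "y0 < 1 - \<beta> - a" "2 * y0 < 1 - 2 * \<beta> + x\<^sup>2 - a"
  shows "(\<lambda>p. risk_2side p (n p) (sqrt (2 * (x - sqrt y0)\<^sup>2 * ln (real p))) (s p)) \<longlonglongrightarrow> 0"
proof -
  define Y where "Y = min (x\<^sup>2) (min (1 - \<beta> - a) ((1 - 2 * \<beta> + x\<^sup>2 - a) / 2))"
  have "y0 < Y" using x y0 by (auto simp: Y_def)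
  \<comment> \<open>The slack between y0 and \<open>Y\<close> is spent twice: y0 to z pays for the
    grid approximation, z to y for the crude density bound.\<close>
  then obtain y where y: "y0 < y" "y < Y" using dense by blast
  then obtain z where z: "y0 < z" "z < y" using dense by blast
  have yY: "y < x\<^sup>2" "y < 1 - \<beta> - a" "2 * y < 1 - 2 * \<beta> + x\<^sup>2 - a" using y(2) by (auto simp: Y_def)
  define r r' where "r = x - sqrt y0" and "r' = x - sqrt z"
  have "sqrt z < sqrt (x\<^sup>2)" using z yY by (intro real_sqrt_less_mono) simp
  then have r': "0 < r'" using x by (simp add: r'_def)
  have rr: "r' < r" using z by (simp add: r_def r'_def)
  \<comment> \<open>The grid is just fine enough that the signal r at the true location is still r'
    = x - sqrt z at the nearest grid point.\<close>
  define e where "e = (r / r')\<^sup>2 - 1"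
  have "1 < r / r'" using rr r' by simp
  then have e: "0 < e" by (simp add: e_def one_less_power)
  have sqe: "sqrt (1 + e) = r / r'" using rr r' by (simp add: e_def)
  define c where "c = exp (- 1 / 2) / sqrt (2 * pi)"
  have c: "0 < c" by (simp add: c_def)
  note sb = s_bounds[OF s \<beta>]
  let ?\<tau> = "\<lambda>p. x * sqrt (2 * ln (real p))"
  \<comment> \<open>Makes v \<le> (y - z) log p for v^2 = 2 z log p. The density is evaluated at v +
    1, and the linear term v in (v + 1)^2/2 is thus absorbed by y - z.\<close>
  have lnbig: "\<forall>\<^sub>F p in sequentially. 2 * z / (y - z)\<^sup>2 \<le> ln (real p)" by real_asymp
  have qsmall: "\<forall>\<^sub>F p in sequentially. (4 / c) * real p powr (- (x\<^sup>2)) \<le> real p powr (- y)"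
    using yY by (intro eventually_powr_le) simp
  have q: "exceed_prob 0 (?\<tau> p) \<le> 2 * real p powr (- (x\<^sup>2))" if "1 < p" for p
  proof -
    have "exceed_prob 0 (?\<tau> p) \<le> 2 * exp (- ((?\<tau> p)\<^sup>2) / 2)"
      using x that by (intro exceed_prob_0_le) auto
    also have "(?\<tau> p)\<^sup>2 = 2 * (x\<^sup>2 * ln (real p))" using that by (simp add: power_mult_distrib)
    finally show ?thesis using that by (simp add: powr_def)
  qed
  show ?thesis
    unfolding r_def[symmetric]
  proof (rule risk_count_powr_tendsto_0[OF a n, where e=e and \<tau>="?\<tau>" and \<Delta>="\<lambda>p. c / 2 * real p powr (- y)"
        and Q="\<lambda>p. 2 * real p powr (1 - x\<^sup>2)" and d="1 - \<beta> - y" and f="1 - x\<^sup>2" and C="c / 4"])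
    show "\<forall>\<^sub>F p in sequentially. s p \<le> p" using sb by eventually_elim simp
    show "\<forall>\<^sub>F p in sequentially. 0 \<le> ?\<tau> p \<and> 0 \<le> sqrt (2 * r\<^sup>2 * ln (real p)) \<and> 0 \<le> c / 2 * real p powr (- y) \<and>
        0 < 2 * real p powr (1 - x\<^sup>2) \<and> real p * exceed_prob 0 (?\<tau> p) \<le> 2 * real p powr (1 - x\<^sup>2) \<and>
        (\<forall>m. sqrt (2 * r\<^sup>2 * ln (real p)) / sqrt (1 + e) \<le> \<bar>m\<bar> \<longrightarrow>
           exceed_prob 0 (?\<tau> p) + c / 2 * real p powr (- y) \<le> exceed_prob m (?\<tau> p))"
      using sb lnbig qsmall
    proof eventually_elim
      case (elim p)
      have p: "1 < p" "0 < ln (real p)" using elim by auto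
      have "exceed_prob 0 (?\<tau> p) + c / 2 * real p powr (- y) \<le> exceed_prob m (?\<tau> p)"
        if m: "sqrt (2 * r\<^sup>2 * ln (real p)) / sqrt (1 + e) \<le> \<bar>m\<bar>" for m
      proof -
        define v where "v = sqrt z * sqrt (2 * ln (real p))"
        have z0: "0 < z" using z x by simp
        have v: "0 \<le> v" "v\<^sup>2 = 2 * z * ln (real p)" using z0 p by (auto simp: v_def power_mult_distrib)
        have "sqrt (2 * r\<^sup>2 * ln (real p)) = r * sqrt (2 * ln (real p))"
          using rr r' by (simp add: real_sqrt_mult)
        then have "r' * sqrt (2 * ln (real p)) \<le> \<bar>m\<bar>" using m rr r' by (simp add: sqe mult.commute)
        then have "?\<tau> p \<le> \<bar>m\<bar> + v" by (simp add: v_def r'_def algebra_simps)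
        then have 1: "std_normal_density (v + 1) \<le> exceed_prob m (?\<tau> p)"
          by (rule exceed_prob_ge_density[OF v(1)])
        have "v \<le> (y - z) * ln (real p)"
        proof (rule power2_le_imp_le)
          have "2 * z \<le> (y - z)\<^sup>2 * ln (real p)" using elim z by (simp add: field_simps)
          then have "2 * z * ln (real p) \<le> (y - z)\<^sup>2 * ln (real p) * ln (real p)"
            using p by (intro mult_right_mono) auto
          then show "v\<^sup>2 \<le> ((y - z) * ln (real p))\<^sup>2"
            unfolding v(2) power_mult_distrib by (simp add: power2_eq_square mult_ac)
        qed (use z p in auto)
        then have "- (y * ln (real p)) - 1 / 2 \<le> - ((v + 1)\<^sup>2 / 2)"
          using v(2) by (simp add: power2_eq_square algebra_simps)
        then have "exp (- (y * ln (real p)) - 1 / 2) / sqrt (2 * pi) \<le> std_normal_density (v + 1)"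
          by (simp add: std_normal_density_def divide_right_mono)
        also have "exp (- (y * ln (real p)) - 1 / 2) / sqrt (2 * pi) = c * real p powr (- y)"
          
        proof -
          have "exp (A - 1 / 2) = exp A * exp (- 1 / 2)" for A :: real by (simp flip: exp_add)
          then show ?thesis using p by (simp add: c_def powr_def)
        qed
        finally have 2: "c * real p powr (- y) \<le> std_normal_density (v + 1)" .
        have "exceed_prob 0 (?\<tau> p) \<le> c / 2 * real p powr (- y)"
          using q[OF p(1)] elim c by (simp add: field_simps)
        then show ?thesis using 1 2 by simp
      qed
      moreover have "real p * exceed_prob 0 (?\<tau> p) \<le> 2 * real p powr (1 - x\<^sup>2)"
      proof -
        have "real p * exceed_prob 0 (?\<tau> p) \<le> real p * (2 * real p powr (- (x\<^sup>2)))"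
          using q[OF p(1)] by (intro mult_left_mono) auto
        also have "\<dots> = 2 * real p powr (1 + (- (x\<^sup>2)))" using p by (simp only: powr_add) simp
        finally show ?thesis by simp
      qed
      ultimately show ?case using p x c by auto
    qed
    show "\<forall>\<^sub>F p in sequentially. c / 4 * real p powr (1 - \<beta> - y) \<le> real (s p) * (c / 2 * real p powr (- y))"
      using sb
    proof eventually_elim
      case (elim p)
      have "(real p powr (1 - \<beta>) / 2) * (c / 2 * real p powr (- y)) \<le> real (s p) * (c / 2 * real p powr (- y))"
        using elim c by (intro mult_right_mono) auto
      moreover have "real p powr (1 - \<beta> - y) = real p powr (1 - \<beta>) * real p powr (- y)" by (simp flip: powr_add)
      ultimately show ?case by simp
    qed
    show "a < 1 - \<beta> - y" "a < 2 * (1 - \<beta> - y) - (1 - x\<^sup>2)" using yY by auto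
  qed (use e c in auto)
qed

text \<open>Even the signal count p^(1-\<beta>) may be smaller than p^a here, so a bounded Chernoff
  parameter is not enough. A null exceedance has probability at most 2 exp (-p^z/4), which allows c0
  of order p^z; the exponent c0 k is then of order p^(1-\<beta>+z), and 1 - \<beta> + z = a +
  (\<beta>1 - \<beta>).\<close>

lemma upper_bound_strong:
  fixes n s :: "nat \<Rightarrow> nat"
  assumes a: "0 < a" and n: "(\<lambda>p. ln (ln (ln (real (n p))))) \<sim>[at_top] (\<lambda>p. a * ln (real p))"
    and s: "(\<lambda>p. real (s p)) \<sim>[at_top] (\<lambda>p. real p powr (1 - \<beta>))"
    and \<beta>: "0 < \<beta>" "\<beta> < 1" "\<beta> < \<beta>1" and strong: "1 - \<beta>1 < a"
  shows "(\<lambda>p. risk_2side p (n p) (sqrt (real p powr (a - (1 - \<beta>1)))) (s p)) \<longlonglongrightarrow> 0"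
proof -
  define z where "z = a - (1 - \<beta>1)"
  have z: "0 < z" using strong by (simp add: z_def)
  \<comment> \<open>Half of a lower bound on the exceedance probability of a signal row; the other
    half is reserved for the null probability, which is eventually below \<kappa>.\<close>
  define \<kappa> where "\<kappa> = std_normal_density 1 / 2"
  have \<kappa>: "0 < \<kappa>" by (simp add: \<kappa>_def normal_density_pos)
  define \<eta> where "\<eta> = (\<beta>1 - \<beta>) / 2"
  have \<eta>: "0 < \<eta>" "1 - \<beta> + z = a + 2 * \<eta>" using \<beta> by (auto simp: \<eta>_def z_def)
  define \<tau> where "\<tau> = (\<lambda>p. sqrt (real p powr z) / sqrt 2)"
  \<comment> \<open>The largest tilt for which the tilted null mean p q exp c0 stays at most 2. This
    2 is the correction in the exponent c0 k - 2 below.\<close>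
  define c0 where "c0 = (\<lambda>p. real p powr z / 4 - ln (real p))"
  \<comment> \<open>A quarter of the guaranteed gain s \<kappa>: with c1 = 1 the lower tail has
    exponent at least s \<kappa>/2 - k = k.\<close>
  define k where "k = (\<lambda>p. real (s p) * \<kappa> / 4)"
  note sb = s_bounds[OF s \<beta>(1)]
  have c0: "\<forall>\<^sub>F p in sequentially. 8 * ln (real p) \<le> real p powr z" by (rule eventually_ln_le_powr[OF z])
  have qs: "\<forall>\<^sub>F p in sequentially. 2 * exp (- (real p powr z / 4)) \<le> \<kappa>"
  proof -
    have "filterlim (\<lambda>p. real p powr z) at_top sequentially" by (rule filterlim_nat_powr_at_top[OF z])
    then have "\<forall>\<^sub>F p in sequentially. 4 * ln (2 / \<kappa>) \<le> real p powr z" by (simp add: filterlim_at_top)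
    then show ?thesis
    proof eventually_elim
      case (elim p)
      have "2 * exp (- (real p powr z / 4)) \<le> 2 * exp (- ln (2 / \<kappa>))" using elim by simp
      also have "\<dots> = \<kappa>" using \<kappa> by (simp add: exp_minus)
      finally show ?case .
    qed
  qed
  have "(\<lambda>p. risk_2side p (n p) (sqrt (real p powr z)) (s p)) \<longlonglongrightarrow> 0"
  proof (rule risk_tendsto_0I[OF a n, where L="ln 2" and \<eta>=\<eta> and C=1 and g="\<lambda>p. c0 p * k p - 2" and h="\<lambda>p. exp (- k p)"])
    show "\<forall>\<^sub>F p in sequentially. s p \<le> p" using sb by eventually_elim simp
    have "filterlim (\<lambda>p. real p powr (a + \<eta>)) at_top sequentially"
      using a \<eta> by (intro filterlim_nat_powr_at_top) simp
    then have "\<forall>\<^sub>F p in sequentially. 2 \<le> real p powr (a + \<eta>)" by (simp add: filterlim_at_top)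
    moreover have "\<forall>\<^sub>F p in sequentially. (128 / \<kappa>) * real p powr (a + \<eta>) \<le> real p powr (1 - \<beta> + z)"
      using \<eta> by (intro eventually_powr_le) simp
    ultimately show "\<forall>\<^sub>F p in sequentially. real p powr (a + \<eta>) \<le> 1 * (c0 p * k p - 2)"
      using sb c0
    proof eventually_elim
      case (elim p)
      have lnp: "0 \<le> ln (real p)" using elim by simp
      then have "4 * ln (real p) \<le> real p powr z" "8 * ln (real p) \<le> real p powr z" using elim by linarith+
      then have "(real p powr z / 8) * ((real p powr (1 - \<beta>) / 2) * \<kappa> / 4) \<le> c0 p * k p"
        unfolding k_def c0_def using elim \<kappa> by (intro mult_mono divide_right_mono mult_right_mono) auto
      also have "(real p powr z / 8) * ((real p powr (1 - \<beta>) / 2) * \<kappa> / 4) = real p powr (1 - \<beta> + z) * \<kappa> / 64"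
        by (simp add: powr_add)
      finally have "real p powr (1 - \<beta> + z) * \<kappa> / 64 \<le> c0 p * k p" .
      moreover have "2 * real p powr (a + \<eta>) \<le> real p powr (1 - \<beta> + z) * \<kappa> / 64"
        using elim \<kappa> by (simp add: field_simps)
      ultimately show ?case using elim by simp
    qed
    show "\<forall>\<^sub>F p in sequentially. 2 \<le> n p \<longrightarrow> risk_2side p (n p) (sqrt (real p powr z)) (s p)
        \<le> (2 * ln (real (n p)) / ln 2 + 2) * exp (- (c0 p * k p - 2)) + exp (- k p)"
      using sb c0 qs
    proof eventually_elim
      case (elim p)
      show ?case
      proof
        assume n2: "2 \<le> n p"
        have p: "0 < real p" "0 \<le> ln (real p)" using elim by auto
        have \<tau>2: "(\<tau> p)\<^sup>2 / 2 = real p powr z / 4" "0 \<le> \<tau> p" by (auto simp: \<tau>_def power_divide)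
        have c0p: "0 \<le> c0 p" using elim p unfolding c0_def by linarith
        have q: "exceed_prob 0 (\<tau> p) \<le> 2 * exp (- (real p powr z / 4))"
          using exceed_prob_0_le[OF \<tau>2(2)] by (simp add: \<tau>2(1)[symmetric])
        have gap: "exceed_prob 0 (\<tau> p) + \<kappa> \<le> exceed_prob m (\<tau> p)" if m: "sqrt (real p powr z) / sqrt (1 + 1) \<le> \<bar>m\<bar>" for m
        proof -
          have "std_normal_density (0 + 1) \<le> exceed_prob m (\<tau> p)"
            by (rule exceed_prob_ge_density) (use m in \<open>auto simp: \<tau>_def\<close>)
          then show ?thesis using q elim by (simp add: \<kappa>_def)
        qed
        have "risk_2side p (n p) (sqrt (real p powr z)) (s p) \<le>
          (2 * ln (real (n p)) / ln (1 + 1) + 2) * exp (real p * exceed_prob 0 (\<tau> p) * (exp (c0 p) - 1) - c0 p * k p)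
          + exp (1 * k p - (real p * exceed_prob 0 (\<tau> p) + real (s p) * \<kappa>) * (1 - exp (- 1)))"
          by (rule risk_2side_count_le[OF n2 _ _ \<tau>2(2) _ c0p _ _ gap]) (use elim \<kappa> in auto)
        also have "\<dots> \<le> (2 * ln (real (n p)) / ln 2 + 2) * exp (- (c0 p * k p - 2)) + exp (- k p)"
        proof (intro add_mono mult_mono)
          have "real p * exceed_prob 0 (\<tau> p) * (exp (c0 p) - 1) \<le> real p * (2 * exp (- (real p powr z / 4))) * exp (c0 p)"
            using p q c0p exceed_prob_nonneg by (intro mult_mono) auto
          also have "\<dots> = 2 * real p * exp (- ln (real p))"
            by (simp add: c0_def flip: exp_add)
          also have "\<dots> = 2" using p by (simp add: exp_minus)
          finally show "exp (real p * exceed_prob 0 (\<tau> p) * (exp (c0 p) - 1) - c0 p * k p) \<le> exp (- (c0 p * k p - 2))"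
            by simp
          have "1 / 2 \<le> 1 - exp (- 1 :: real)" using half_le_one_minus_exp[of 1] by simp
          then have "(real (s p) * \<kappa>) * (1 / 2) \<le> (real p * exceed_prob 0 (\<tau> p) + real (s p) * \<kappa>) * (1 - exp (- 1))"
            using p \<kappa> exceed_prob_nonneg by (intro mult_mono add_increasing) auto
          then show "exp (1 * k p - (real p * exceed_prob 0 (\<tau> p) + real (s p) * \<kappa>) * (1 - exp (- 1))) \<le> exp (- k p)"
            by (simp add: k_def mult.commute[of \<kappa>])
        qed (use n2 in auto)
        finally show "risk_2side p (n p) (sqrt (real p powr z)) (s p)
          \<le> (2 * ln (real (n p)) / ln 2 + 2) * exp (- (c0 p * k p - 2)) + exp (- k p)" .
      qed
    qed
    have "filterlim (\<lambda>p. \<kappa> / 8 * real p powr (1 - \<beta>)) at_top sequentially"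
      using \<beta> \<kappa> by (intro filterlim_tendsto_pos_mult_at_top[OF tendsto_const] filterlim_nat_powr_at_top) auto
    then have "filterlim k at_top sequentially"
    proof (rule filterlim_at_top_mono)
      show "\<forall>\<^sub>F p in sequentially. \<kappa> / 8 * real p powr (1 - \<beta>) \<le> k p"
        using sb
      proof eventually_elim
        case (elim p)
        then have "\<kappa> / 4 * (real p powr (1 - \<beta>) / 2) \<le> \<kappa> / 4 * real (s p)" using \<kappa> by (intro mult_left_mono) auto
        then show ?case by (simp add: k_def mult_ac)
      qed
    qed
    then show "(\<lambda>p. exp (- k p)) \<longlonglongrightarrow> 0"
      by (intro filterlim_compose[OF exp_at_bot]) (simp only: filterlim_uminus_at_top[symmetric])
  qed (use \<eta> in auto)
  then show ?thesis by (simp add: z_def)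
qed

section \<open>Asymptotic regimes: lower bound\<close>

lemma one_plus_power_le_exp:
  fixes x :: real
  assumes "- 1 \<le> x"
  shows "(1 + x) ^ k \<le> exp (real k * x)"
proof -
  have "(1 + x) ^ k \<le> exp x ^ k" using assms by (intro power_mono) (auto simp: exp_ge_add_one_self)
  then show ?thesis by (simp add: exp_of_nat_mult)
qed

text \<open>The argument is doubled because the dense lower bound inflates the squared signal by 2.
  Quadratic bounds on exp (v) and exp (-v) control cosh v, and the doubling formula does the
  rest.\<close>

lemma cosh_double_le:
  fixes v :: real
  assumes "0 \<le> v" "v \<le> 1"
  shows "cosh (2 * v) \<le> 1 + 6 * v\<^sup>2"
proof -
  have "exp v \<le> 1 + v + v\<^sup>2" using assms by (intro exp_bound) auto
  moreover have "exp (- v) \<le> 1 - v + v\<^sup>2"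
  proof -
    have "exp (- v) \<le> 1 / (1 + v)"
      using exp_ge_add_one_self[of v] assms by (simp add: exp_minus inverse_eq_divide frac_le)
    also have "\<dots> \<le> 1 - v + v\<^sup>2"
    proof -
      have "0 \<le> v * (v * v)" using assms by simp
      then have "1 \<le> (1 - v + v\<^sup>2) * (1 + v)" by (simp add: power2_eq_square algebra_simps)
      then show ?thesis using assms by (subst pos_divide_le_eq) auto
    qed
    finally show ?thesis .
  qed
  ultimately have c: "cosh v \<le> 1 + v\<^sup>2" by (simp add: cosh_def)
  have "cosh (2 * v) = 2 * (cosh v)\<^sup>2 - 1" by (rule cosh_double_cosh)
  also have "\<dots> \<le> 2 * (1 + v\<^sup>2)\<^sup>2 - 1" using c cosh_real_nonneg[of v] by (intro diff_right_mono mult_left_mono power_mono) auto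
  also have "\<dots> = 1 + 4 * v\<^sup>2 + 2 * (v\<^sup>2 * v\<^sup>2)" by (simp add: power2_eq_square algebra_simps)
  also have "\<dots> \<le> 1 + 4 * v\<^sup>2 + 2 * (v\<^sup>2 * 1)"
    using assms by (intro add_left_mono mult_left_mono) (auto simp: power_le_one)
  finally show ?thesis by simp
qed

text \<open>The base 2^p separates scales exponentially in p but reduces their number only by the
  factor p ln 2, which is absorbed in passing from exponent a - d/2 to a - d. The division by 4
  matches the truncation level m/4.\<close>

lemma eventually_many_scales:
  fixes n :: "nat \<Rightarrow> nat"
  assumes a: "0 < a" and n: "(\<lambda>p. ln (ln (ln (real (n p))))) \<sim>[at_top] (\<lambda>p. a * ln (real p))"
    and d: "0 < d" "d < a"
  shows "\<forall>\<^sub>F p in sequentially. \<exists>m. 1 \<le> m \<and> (2 ^ p) ^ (m + 1) \<le> n p \<and> exp (real p powr (a - d)) \<le> real m / 4"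
proof -
  have 1: "\<forall>\<^sub>F p in sequentially. 2 * real p powr (a - d) \<le> real p powr (a - d / 2)"
    using d by (intro eventually_powr_le) simp
  have 2: "\<forall>\<^sub>F p in sequentially. 3 * ln (real p) \<le> real p powr (a - d)"
    using d by (intro eventually_ln_le_powr) simp
  show ?thesis
    using ln_n_bounds[OF a n half_gt_zero[OF d(1)]] 1 2 eventually_ge_at_top[of 3]
  proof eventually_elim
    case (elim p)
    define X where "X = real p powr (a - d)"
    define w where "w = ln (real (n p)) / (real p * ln 2)"
    \<comment> \<open>One scale fewer than fits, so that the largest location is at most a fraction
      2^(-p) of n. The summand 2 in the bound on \<open>w\<close> below covers this and the
      rounding.\<close>
    define m where "m = nat \<lfloor>w\<rfloor> - 1"
    have p: "3 \<le> real p" using elim by simp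
    have ln2: "0 < ln (2 :: real)" "ln (2 :: real) \<le> 1" using ln_2_less_1 by auto
    have lnn: "0 < ln (real (n p))" using elim exp_gt_zero[of "real p powr (a - d / 2)"] by linarith
    then have n0: "0 < n p" by (cases "n p = 0") auto
    have X: "0 < X" using p by (simp add: X_def)
    have "6 * real p \<le> real p ^ 3"
    proof -
      have "3 * 3 \<le> real p * real p" using p by (intro mult_mono) auto
      then have "6 * real p \<le> (real p * real p) * real p" using p by (intro mult_right_mono) auto
      then show ?thesis by (simp add: power3_eq_cube)
    qed
    also have "\<dots> = exp (3 * ln (real p))" using p by (simp add: powr_def flip: powr_numeral)
    also have "\<dots> \<le> exp X" using elim by (simp add: X_def)
    finally have px: "6 * real p \<le> exp X" .
    have "(4 * exp X + 2) * real p \<le> (4 * exp X + 2 * exp X) * real p" using X p by (intro mult_right_mono) auto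
    also have "\<dots> = 6 * real p * exp X" by simp
    also have "\<dots> \<le> exp X * exp X" using px by (intro mult_right_mono) auto
    also have "\<dots> = exp (2 * X)" by (simp flip: exp_add)
    also have "\<dots> \<le> exp (real p powr (a - d / 2))" using elim by (simp add: X_def)
    also have "\<dots> \<le> ln (real (n p))" using elim by blast
    finally have "4 * exp X + 2 \<le> ln (real (n p)) / real p" using p by (simp add: field_simps)
    also have "\<dots> \<le> w" unfolding w_def using p ln2 lnn by (intro divide_left_mono) auto
    finally have w: "4 * exp X + 2 \<le> w" .
    have eX: "1 \<le> exp X" using X by simp
    have fl: "int (m + 1) = \<lfloor>w\<rfloor>" and m1: "1 \<le> m" using w eX unfolding m_def by linarith+
    have mw: "real (m + 1) \<le> w" "w < real (m + 1) + 1" using fl by linarith+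
    have "ln (real ((2 ^ p) ^ (m + 1))) = real (m + 1) * (real p * ln 2)"
      by (simp add: ln_realpow ln_mult_pos algebra_simps)
    also have "\<dots> \<le> w * (real p * ln 2)" using mw p ln2 by (intro mult_right_mono) auto
    also have "\<dots> = ln (real (n p))" using p ln2 by (simp add: w_def)
    finally have "real ((2 ^ p) ^ (m + 1)) \<le> real (n p)" using n0 by (subst (asm) ln_le_cancel_iff) auto
    then have "(2 ^ p) ^ (m + 1) \<le> n p" by (simp only: of_nat_le_iff)
    moreover have "exp X \<le> real m / 4" using w mw by simp
    ultimately show ?case using m1 unfolding X_def by blast
  qed
qed

text \<open>Common frame of the lower bounds. Inflating the squared signal by 1 + e compensates for
  the factor sqrt(1 - t/n), and the polynomial bound on \<rho>^2 makes scales with ratio 2^p almost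
  orthogonal. A regime only has to supply the order h and a one-row moment V whose block factor
  satisfies \<open>few\<close>.\<close>

lemma risk_eventually_ge:
  fixes n s :: "nat \<Rightarrow> nat" and \<rho> V :: "nat \<Rightarrow> real" and h e d C :: real
  assumes a: "0 < a" and n: "(\<lambda>p. ln (ln (ln (real (n p))))) \<sim>[at_top] (\<lambda>p. a * ln (real p))"
    and s: "(\<lambda>p. real (s p)) \<sim>[at_top] (\<lambda>p. real p powr (1 - \<beta>))"
    and \<beta>: "0 < \<beta>" and h: "0 < h" "h \<le> 1" and e: "0 < e" and d: "0 < d" "d < a"
    and \<rho>: "\<forall>\<^sub>F p in sequentially. 0 \<le> \<rho> p \<and> (\<rho> p)\<^sup>2 \<le> real p powr C"
    and V: "\<forall>\<^sub>F p in sequentially. (\<integral>z. std_normal_density z * sym_lr (\<rho> p * sqrt (1 + e)) z powr (1 + h) \<partial>lborel) \<le> V p"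
    and few: "\<forall>\<^sub>F p in sequentially. \<forall>b. real p powr \<beta> / 4 \<le> b \<longrightarrow> 1 \<le> b \<longrightarrow>
       (1 - h / b + V p / b powr h) ^ s p \<le> exp (real p powr (a - d))"
  shows "\<forall>\<^sub>F p in sequentially. 1 / 4 \<le> risk_2side p (n p) (\<rho> p) (s p)"
proof -
  have d2: "0 < d / 2" "d / 2 < a" using d by auto
  have C1: "\<forall>\<^sub>F p in sequentially. (2 / h) * real p powr (a - d) \<le> real p powr (a - d / 2)"
    using d by (intro eventually_powr_le) simp
  have "filterlim (\<lambda>p. real p powr (a - d)) at_top sequentially"
    using d by (intro filterlim_nat_powr_at_top) simp
  then have C2: "\<forall>\<^sub>F p in sequentially. ln 16 \<le> real p powr (a - d)" by (simp add: filterlim_at_top)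
  have C3: "\<forall>\<^sub>F p in sequentially. (1 / 2 :: real) ^ p \<le> e / (1 + e)"
  proof -
    have "(\<lambda>p. (1 / 2 :: real) ^ p) \<longlonglongrightarrow> 0" by real_asymp
    then have "\<forall>\<^sub>F p in sequentially. (1 / 2 :: real) ^ p < e / (1 + e)"
      using e by (intro order_tendstoD(2)) auto
    then show ?thesis by eventually_elim simp
  qed
  have C4: "\<forall>\<^sub>F p in sequentially. 9 * (1 + e) * (real p powr C * (real p)\<^sup>2) \<le> sqrt (2 ^ p)"
  proof -
    have "\<forall>\<^sub>F p in sequentially. (C + 3) * ln (real p) \<le> real p powr (1 / 2)"
      by (intro eventually_ln_le_powr) simp
    moreover have "\<forall>\<^sub>F p in sequentially. real p powr (1 / 2) \<le> real p * (ln 2 / 2)" by real_asymp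
    moreover have "\<forall>\<^sub>F p in sequentially. 9 * (1 + e) \<le> real p" by real_asymp
    ultimately show ?thesis
      using eventually_gt_at_top[of 0]
    proof eventually_elim
      case (elim p)
      have "9 * (1 + e) * (real p powr C * (real p)\<^sup>2) \<le> real p * (real p powr C * (real p)\<^sup>2)"
        using elim by (intro mult_right_mono) auto
      also have "\<dots> = real p powr (C + 3)" using elim by (simp add: powr_add power2_eq_square power3_eq_cube)
      also have "\<dots> = exp ((C + 3) * ln (real p))" using elim by (simp add: powr_def)
      also have "\<dots> \<le> exp (real p * (ln 2 / 2))" using elim by simp
      also have "\<dots> = sqrt (2 ^ p)"
      proof -
        have "(exp (real p * (ln 2 / 2)))\<^sup>2 = exp (real p * ln 2)" by (simp add: power2_eq_square flip: exp_add)
        also have "\<dots> = 2 ^ p" by (simp add: exp_of_nat_mult)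
        finally show ?thesis by (intro real_sqrt_unique[symmetric]) auto
      qed
      finally show ?case .
    qed
  qed
  show ?thesis
    using s_bounds[OF s \<beta>] eventually_many_scales[OF a n d2] \<rho> V few C1 C2 C3 C4
  proof eventually_elim
    case (elim p)
    then obtain m where m: "1 \<le> m" "(2 ^ p) ^ (m + 1) \<le> n p" "exp (real p powr (a - d / 2)) \<le> real m / 4"
      by blast
    have p: "1 < p" using elim by simp
    \<comment> \<open>The largest length for which s disjoint blocks fit into p rows. Rounding down
      costs at most a factor 2 and s \<le> 2 p^(1-\<beta>) another one, whence the 4 in
      p^\<beta>/4.\<close>
    define b where "b = p div s p"
    have "0 < real p powr (1 - \<beta>) / 2" using p by simp
    then have s0: "0 < real (s p)" using elim by linarith
    then have s0': "0 < s p" by simp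
    have b1: "0 < b" using elim s0' by (simp add: b_def div_greater_zero_iff)
    have sb: "s p * b \<le> p" by (simp add: b_def)
    have "p < s p * (b + 1)"
      using dividend_less_div_times[OF s0', of p] by (simp add: b_def mult.commute)
    also have "\<dots> \<le> s p * (2 * b)" using b1 by (intro mult_left_mono) auto
    finally have "real p \<le> real (s p * (2 * b))" by (simp only: of_nat_le_iff)
    then have "real p \<le> real (s p) * (2 * real b)" by simp
    also have "\<dots> \<le> 2 * real p powr (1 - \<beta>) * (2 * real b)" using elim by (intro mult_right_mono) auto
    finally have "real p powr \<beta> * real p powr (1 - \<beta>) \<le> 4 * real b * real p powr (1 - \<beta>)"
      using p by (simp add: mult_ac flip: powr_add)
    then have bb: "real p powr \<beta> / 4 \<le> real b" using p by simp
    let ?r = "\<rho> p * sqrt (1 + e)"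
    have G: "2 \<le> (2 :: nat) ^ p" using p self_le_power[of "2 :: nat" p] by simp
    have Gm: "(2 ^ p) ^ m * 2 \<le> n p"
    proof -
      have "(2 ^ p) ^ m * 2 \<le> ((2 :: nat) ^ p) ^ m * 2 ^ p" using G by (intro mult_left_mono) auto
      also have "\<dots> = (2 ^ p) ^ (m + 1)" by simp
      also have "\<dots> \<le> n p" by (rule m(2))
      finally show ?thesis .
    qed
    have Gm0: "0 < ((2 :: nat) ^ p) ^ m" by simp
    have Gn: "(2 ^ p) ^ m < n p" using Gm Gm0 by linarith
    show ?case
    proof (rule risk_2side_spike_ge[OF b1 sb _ h _ G m(1) Gn])
      show "0 \<le> ?r" using elim e by simp
      show "(\<integral>z. std_normal_density z * sym_lr ?r z powr (1 + h) \<partial>lborel) \<le> V p" using elim by blast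
      show "\<rho> p \<le> ?r * sqrt (1 - real (2 ^ p) ^ m / real (n p))"
      proof -
        have "real ((2 ^ p) ^ (m + 1)) \<le> real (n p)" using m(2) by (simp only: of_nat_le_iff)
        then have "real (2 ^ p) ^ m * 2 ^ p \<le> real (n p)" by (simp add: mult.commute)
        then have "real (2 ^ p) ^ m / real (n p) \<le> (1 / 2) ^ p"
          using Gn by (simp add: field_simps power_one_over)
        also have "\<dots> \<le> e / (1 + e)" using elim by blast
        finally have "1 - e / (1 + e) \<le> 1 - real (2 ^ p) ^ m / real (n p)" by simp
        then have "(1 + e) * (1 - e / (1 + e)) \<le> (1 + e) * (1 - real (2 ^ p) ^ m / real (n p))"
          using e by (intro mult_left_mono) auto
        moreover have "(1 + e) * (1 - e / (1 + e)) = 1" using e by (simp add: field_simps)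
        ultimately have "1 \<le> sqrt ((1 + e) * (1 - real (2 ^ p) ^ m / real (n p)))" by simp
        then have "\<rho> p * 1 \<le> \<rho> p * sqrt ((1 + e) * (1 - real (2 ^ p) ^ m / real (n p)))"
          using elim by (intro mult_left_mono) auto
        then show ?thesis by (simp add: real_sqrt_mult mult_ac)
      qed
      show "?r\<^sup>2 * (real (s p))\<^sup>2 / sqrt (real (2 ^ p)) \<le> 1 / 9"
      proof -
        have "?r\<^sup>2 * (real (s p))\<^sup>2 = (1 + e) * ((\<rho> p)\<^sup>2 * (real (s p))\<^sup>2)" using e by (simp add: power_mult_distrib)
        also have "\<dots> \<le> (1 + e) * (real p powr C * (real p)\<^sup>2)"
          using elim e by (intro mult_left_mono mult_mono power_mono) auto
        finally have "9 * (?r\<^sup>2 * (real (s p))\<^sup>2) \<le> sqrt (2 ^ p)" using elim by linarith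
        then show ?thesis by (simp add: field_simps)
      qed
      show "(1 - h / real b + V p / real b powr h) ^ s p \<le> (real m / 4) powr h / 16"
      proof -
        have "(1 - h / real b + V p / real b powr h) ^ s p \<le> exp (real p powr (a - d))"
          using elim bb b1 by simp
        \<comment> \<open>The gap between a - d and a - d/2 absorbs both the power h and the factor
          16.\<close>
        also have "\<dots> \<le> exp (h * real p powr (a - d / 2) - ln 16)"
        proof -
          have "2 * real p powr (a - d) \<le> h * real p powr (a - d / 2)" using elim h by (simp add: field_simps)
          then show ?thesis using elim by simp
        qed
        also have "\<dots> = exp (real p powr (a - d / 2)) powr h / 16" by (simp add: exp_diff exp_powr_real mult.commute)
        also have "\<dots> \<le> (real m / 4) powr h / 16"
          using m(3) h by (intro divide_right_mono powr_mono2) auto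
        finally show ?thesis .
      qed
    qed
  qed
qed

text \<open>With squared signal 2v, v = p^x, a block factor exceeds 1 by (cosh (2v) - 1)/b, of order
  v^2/b. Over s blocks the exponent is (1 - \<beta>) - \<beta> + 2x = a - 2(\<beta> - \<beta>1),
  below a.\<close>

lemma lower_bound_dense:
  fixes n s :: "nat \<Rightarrow> nat"
  assumes a: "0 < a" and n: "(\<lambda>p. ln (ln (ln (real (n p))))) \<sim>[at_top] (\<lambda>p. a * ln (real p))"
    and s: "(\<lambda>p. real (s p)) \<sim>[at_top] (\<lambda>p. real p powr (1 - \<beta>))"
    and \<beta>: "0 < \<beta>" "\<beta>1 < \<beta>" and dense: "a \<le> 1 - 2 * \<beta>1"
  shows "\<forall>\<^sub>F p in sequentially. 1 / 4 \<le> risk_2side p (n p) (sqrt (real p powr ((a - (1 - 2 * \<beta>1)) / 2))) (s p)"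
proof -
  define x where "x = (a - (1 - 2 * \<beta>1)) / 2"
  define d where "d = min (a / 2) (\<beta> - \<beta>1)"
  have d: "0 < d" "d < a" "1 - 2 * \<beta> + 2 * x < a - d"
  proof -
    show "0 < d" "d < a" using a \<beta> by (auto simp: d_def)
    have "d \<le> \<beta> - \<beta>1" unfolding d_def by (rule min.cobounded2)
    then have "d < 2 * (\<beta> - \<beta>1)" using \<beta> by argo
    then have "a - 2 * (\<beta> - \<beta>1) < a - d" by simp
    moreover have "1 - 2 * \<beta> + 2 * x = a - 2 * (\<beta> - \<beta>1)" by (simp add: x_def field_simps)
    ultimately show "1 - 2 * \<beta> + 2 * x < a - d" by (simp only:)
  qed
  have dom: "\<forall>\<^sub>F p in sequentially. 48 * real p powr (1 - 2 * \<beta> + 2 * x) \<le> real p powr (a - d)"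
    by (rule eventually_powr_le[OF d(3)])
  have "\<forall>\<^sub>F p in sequentially. 1 / 4 \<le> risk_2side p (n p) (sqrt (real p powr x)) (s p)"
  proof (rule risk_eventually_ge[OF a n s \<beta>(1) zero_less_one order_refl zero_less_one d(1,2), where C=x
        and V="\<lambda>p. cosh (2 * real p powr x)"])
    show "\<forall>\<^sub>F p in sequentially. (\<integral>z. std_normal_density z * sym_lr (sqrt (real p powr x) * sqrt (1 + 1)) z powr (1 + 1) \<partial>lborel)
        \<le> cosh (2 * real p powr x)"
    proof (rule always_eventually, rule allI)
      fix p
      have "(sqrt (real p powr x) * sqrt 2)\<^sup>2 = 2 * real p powr x" by (simp add: power_mult_distrib)
      then show "(\<integral>z. std_normal_density z * sym_lr (sqrt (real p powr x) * sqrt (1 + 1)) z powr (1 + 1) \<partial>lborel)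
        \<le> cosh (2 * real p powr x)"
        using sym_lr_second_moment(2)[of "sqrt (real p powr x) * sqrt 2"] by simp
    qed
    show "\<forall>\<^sub>F p in sequentially. \<forall>b. real p powr \<beta> / 4 \<le> b \<longrightarrow> 1 \<le> b \<longrightarrow>
       (1 - 1 / b + cosh (2 * real p powr x) / b powr 1) ^ s p \<le> exp (real p powr (a - d))"
      using s_bounds[OF s \<beta>(1)] dom
    proof eventually_elim
      case (elim p)
      show ?case
      proof (intro allI impI)
        fix b assume b: "real p powr \<beta> / 4 \<le> b" "1 \<le> b"
        define v where "v = real p powr x"
        have "real p powr x \<le> real p powr 0" using elim dense by (intro powr_mono) (auto simp: x_def)
        then have v: "0 \<le> v" "v \<le> 1" using elim by (auto simp: v_def)
        have p: "0 < real p" using elim by simp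
        have "(1 - 1 / b + cosh (2 * v) / b powr 1) ^ s p = (1 + (cosh (2 * v) - 1) / b) ^ s p"
          using b by (simp add: diff_divide_distrib algebra_simps)
        also have "\<dots> \<le> exp (real (s p) * ((cosh (2 * v) - 1) / b))"
          using b cosh_real_ge_1[of "2 * v"] by (intro one_plus_power_le_exp order.trans[OF _ divide_nonneg_nonneg]) auto
        also have "\<dots> \<le> exp (real p powr (a - d))"
        proof -
          have "real (s p) * ((cosh (2 * v) - 1) / b) \<le> (2 * real p powr (1 - \<beta>)) * ((6 * v\<^sup>2) / (real p powr \<beta> / 4))"
            using elim b v cosh_double_le[OF v] cosh_real_ge_1[of "2 * v"] p
            by (intro mult_mono frac_le) auto
          also have "\<dots> = 48 * (real p powr (1 - \<beta>) * real p powr (- \<beta>) * (real p powr x * real p powr x))"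
            by (simp only: v_def power2_eq_square powr_minus_divide) simp
          also have "\<dots> = 48 * real p powr (1 - \<beta> + - \<beta> + (x + x))"
            by (simp only: powr_add)
          also have "1 - \<beta> + - \<beta> + (x + x) = 1 - 2 * \<beta> + 2 * x" by simp
          finally show ?thesis using elim by simp
        qed
        finally show "(1 - 1 / b + cosh (2 * real p powr x) / b powr 1) ^ s p \<le> exp (real p powr (a - d))"
          by (simp add: v_def)
      qed
    qed
  qed auto
  then show ?thesis by (simp add: x_def)
qed

text \<open>The left-hand side of \<open>small\<close> is the exponent of s V / b^h, with V about
  p^(h(1+h) r^2) and b about p^\<beta>. Strict inequality leaves room for the signal inflation and
  for all constants.\<close>

lemma lower_bound_sparse:
  fixes n s :: "nat \<Rightarrow> nat" and r h :: real
  assumes a: "0 < a" and n: "(\<lambda>p. ln (ln (ln (real (n p))))) \<sim>[at_top] (\<lambda>p. a * ln (real p))"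
    and s: "(\<lambda>p. real (s p)) \<sim>[at_top] (\<lambda>p. real p powr (1 - \<beta>))"
    and \<beta>: "0 < \<beta>" and h: "0 < h" "h \<le> 1" and small: "1 - \<beta> - \<beta> * h + h * (1 + h) * r\<^sup>2 < a"
  shows "\<forall>\<^sub>F p in sequentially. 1 / 4 \<le> risk_2side p (n p) (sqrt (2 * r\<^sup>2 * ln (real p))) (s p)"
proof -
  define gap where "gap = a - (1 - \<beta> - \<beta> * h + h * (1 + h) * r\<^sup>2)"
  have gap: "0 < gap" using small by (simp add: gap_def)
  \<comment> \<open>Inflating the signal raises the exponent by e N, with N the summand h(1+h) r^2.
    The denominator 1 + N keeps this below a quarter of the gap, including when N = 0.\<close>
  define e where "e = gap / (4 * (1 + h * (1 + h) * r\<^sup>2))"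
  define N where "N = h * (1 + h) * r\<^sup>2"
  have N: "0 \<le> N" using h by (simp add: N_def)
  have e: "0 < e" "e * N \<le> gap / 4"
  proof -
    show "0 < e" using gap N unfolding e_def N_def by (intro divide_pos_pos) auto
    have "e * N = gap / 4 * (N / (1 + N))" by (simp add: e_def N_def)
    also have "\<dots> \<le> gap / 4 * 1" using gap N by (intro mult_left_mono) auto
    finally show "e * N \<le> gap / 4" by simp
  qed
  define K where "K = (1 + e) * N"
  define d where "d = min (a / 2) (gap / 2)"
  have d: "0 < d" "d < a" "1 - \<beta> + K - \<beta> * h < a - d"
  proof -
    show "0 < d" "d < a" using a gap by (auto simp: d_def)
    have "1 - \<beta> + K - \<beta> * h = a - gap + e * N" by (simp add: K_def gap_def N_def algebra_simps)
    moreover have "d \<le> gap / 2" by (simp add: d_def)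
    ultimately show "1 - \<beta> + K - \<beta> * h < a - d" using e(2) gap by simp
  qed
  have dom: "\<forall>\<^sub>F p in sequentially. 16 * real p powr (1 - \<beta> + K - \<beta> * h) \<le> real p powr (a - d)"
    by (rule eventually_powr_le[OF d(3)])
  show ?thesis
  proof (rule risk_eventually_ge[OF a n s \<beta> h e(1) d(1,2), where C=1 and V="\<lambda>p. 2 * real p powr K"])
    have "\<forall>\<^sub>F p in sequentially. (2 * r\<^sup>2) * ln (real p) \<le> real p powr 1"
      by (rule eventually_ln_le_powr) simp
    then show "\<forall>\<^sub>F p in sequentially. 0 \<le> sqrt (2 * r\<^sup>2 * ln (real p)) \<and> (sqrt (2 * r\<^sup>2 * ln (real p)))\<^sup>2 \<le> real p powr 1"
      using eventually_gt_at_top[of 1] by eventually_elim auto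
    show "\<forall>\<^sub>F p in sequentially. (\<integral>z. std_normal_density z * sym_lr (sqrt (2 * r\<^sup>2 * ln (real p)) * sqrt (1 + e)) z powr (1 + h) \<partial>lborel)
        \<le> 2 * real p powr K"
      using eventually_gt_at_top[of 1]
    proof eventually_elim
      case (elim p)
      let ?R = "sqrt (2 * r\<^sup>2 * ln (real p)) * sqrt (1 + e)"
      have "?R\<^sup>2 = 2 * r\<^sup>2 * ln (real p) * (1 + e)" using elim e by (simp add: power_mult_distrib)
      then have "h * (1 + h) * ?R\<^sup>2 / 2 = K * ln (real p)" by (simp add: K_def N_def)
      moreover have "0 \<le> ?R" using elim e by simp
      ultimately show ?case using sym_lr_moment(2)[of ?R h] h elim by (simp add: powr_def)
    qed
    show "\<forall>\<^sub>F p in sequentially. \<forall>b. real p powr \<beta> / 4 \<le> b \<longrightarrow> 1 \<le> b \<longrightarrow>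
       (1 - h / b + 2 * real p powr K / b powr h) ^ s p \<le> exp (real p powr (a - d))"
      using s_bounds[OF s \<beta>] dom
    proof eventually_elim
      case (elim p)
      show ?case
      proof (intro allI impI)
        fix b assume b: "real p powr \<beta> / 4 \<le> b" "1 \<le> b"
        have p: "0 < real p" using elim by simp
        have "h / b \<le> 1" using b h by simp
        then have "(1 - h / b + 2 * real p powr K / b powr h) ^ s p \<le> (1 + 2 * real p powr K / b powr h) ^ s p"
          using b h by (intro power_mono add_nonneg_nonneg) auto
        also have "\<dots> \<le> exp (real (s p) * (2 * real p powr K / b powr h))"
          using b by (intro one_plus_power_le_exp order.trans[OF _ divide_nonneg_nonneg]) auto
        also have "\<dots> \<le> exp (real p powr (a - d))"
        proof -
          have "(real p powr \<beta>) powr h / 4 \<le> (real p powr \<beta>) powr h / 4 powr h"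
            using h powr_mono[of h 1 "4 :: real"] by (intro divide_left_mono) auto
          also have "\<dots> = (real p powr \<beta> / 4) powr h" by (simp add: powr_divide)
          also have "\<dots> \<le> b powr h" using b h by (intro powr_mono2) auto
          finally have bh: "real p powr (\<beta> * h) / 4 \<le> b powr h" by (simp add: powr_powr)
          have "real (s p) * (2 * real p powr K / b powr h) \<le> (2 * real p powr (1 - \<beta>)) * (2 * real p powr K / (real p powr (\<beta> * h) / 4))"
          proof (rule mult_mono)
            have "0 < real p powr (\<beta> * h) / 4" "0 < b powr h" using p b by auto
            then show "2 * real p powr K / b powr h \<le> 2 * real p powr K / (real p powr (\<beta> * h) / 4)"
              by (intro divide_left_mono[OF bh] mult_pos_pos) auto
          qed (use elim in auto)
          also have "\<dots> = 16 * (real p powr (1 - \<beta>) * real p powr K * real p powr (- (\<beta> * h)))"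
            by (simp only: powr_minus_divide) simp
          also have "\<dots> = 16 * real p powr (1 - \<beta> + K + - (\<beta> * h))"
            by (simp only: powr_add)
          also have "1 - \<beta> + K + - (\<beta> * h) = 1 - \<beta> + K - \<beta> * h" by simp
          finally show ?thesis using elim by simp
        qed
        finally show "(1 - h / b + 2 * real p powr K / b powr h) ^ s p \<le> exp (real p powr (a - d))" .
      qed
    qed
  qed
qed

text \<open>The total signal energy s \<rho>^2, of order p^(a - (\<beta> - \<beta>1)), is already
  below p^a. Hence each block factor may be bounded by the moment of a single row, giving up what
  averaging over the block would gain.\<close>

lemma lower_bound_strong:
  fixes n s :: "nat \<Rightarrow> nat"
  assumes a: "0 < a" and n: "(\<lambda>p. ln (ln (ln (real (n p))))) \<sim>[at_top] (\<lambda>p. a * ln (real p))"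
    and s: "(\<lambda>p. real (s p)) \<sim>[at_top] (\<lambda>p. real p powr (1 - \<beta>))"
    and \<beta>: "0 < \<beta>" "\<beta>1 < \<beta>" and strong: "1 - \<beta>1 < a"
  shows "\<forall>\<^sub>F p in sequentially. 1 / 4 \<le> risk_2side p (n p) (sqrt (real p powr (a - (1 - \<beta>1)))) (s p)"
proof -
  define z where "z = a - (1 - \<beta>1)"
  have z: "0 < z" using strong by (simp add: z_def)
  define d where "d = min (a / 2) ((\<beta> - \<beta>1) / 2)"
  have d: "0 < d" "d < a" "1 - \<beta> + z < a - d"
  proof -
    show "0 < d" "d < a" using a \<beta> by (auto simp: d_def)
    have "d \<le> (\<beta> - \<beta>1) / 2" unfolding d_def by (rule min.cobounded2)
    then show "1 - \<beta> + z < a - d" using \<beta> unfolding z_def by argo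
  qed
  have dom: "\<forall>\<^sub>F p in sequentially. 6 * real p powr (1 - \<beta> + z) \<le> real p powr (a - d)"
    by (rule eventually_powr_le[OF d(3)])
  have "\<forall>\<^sub>F p in sequentially. 1 / 4 \<le> risk_2side p (n p) (sqrt (real p powr z)) (s p)"
  proof (rule risk_eventually_ge[OF a n s \<beta>(1) zero_less_one order_refl zero_less_one d(1,2), where C=z
        and V="\<lambda>p. exp (2 * real p powr z)"])
    show "\<forall>\<^sub>F p in sequentially. (\<integral>y. std_normal_density y * sym_lr (sqrt (real p powr z) * sqrt (1 + 1)) y powr (1 + 1) \<partial>lborel)
        \<le> exp (2 * real p powr z)"
    proof (rule always_eventually, rule allI)
      fix p
      have "(sqrt (real p powr z) * sqrt 2)\<^sup>2 = 2 * real p powr z" by (simp add: power_mult_distrib)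
      moreover have "cosh (2 * real p powr z) \<le> exp (2 * real p powr z)" by (simp add: cosh_def)
      ultimately show "(\<integral>y. std_normal_density y * sym_lr (sqrt (real p powr z) * sqrt (1 + 1)) y powr (1 + 1) \<partial>lborel)
        \<le> exp (2 * real p powr z)"
        using sym_lr_second_moment(2)[of "sqrt (real p powr z) * sqrt 2"] by simp
    qed
    show "\<forall>\<^sub>F p in sequentially. \<forall>b. real p powr \<beta> / 4 \<le> b \<longrightarrow> 1 \<le> b \<longrightarrow>
       (1 - 1 / b + exp (2 * real p powr z) / b powr 1) ^ s p \<le> exp (real p powr (a - d))"
      using s_bounds[OF s \<beta>(1)] dom
    proof eventually_elim
      case (elim p)
      show ?case
      proof (intro allI impI)
        fix b assume b: "real p powr \<beta> / 4 \<le> b" "1 \<le> b"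
        define u where "u = real p powr z"
        have u: "1 \<le> u" using elim z by (simp add: u_def ge_one_powr_ge_zero)
        have "1 - 1 / b + exp (2 * u) / b powr 1 = 1 + (exp (2 * u) - 1) / b"
          using b by (simp add: diff_divide_distrib)
        \<comment> \<open>Dividing by 1 instead of b replaces the block average by a single
          row.\<close>
        also have "\<dots> \<le> 1 + (exp (2 * u) - 1) / 1"
          using b u by (intro add_left_mono divide_left_mono) auto
        finally have "(1 - 1 / b + exp (2 * u) / b powr 1) ^ s p \<le> exp (2 * u) ^ s p"
          using b by (intro power_mono) (auto intro!: add_nonneg_nonneg)
        also have "\<dots> = exp (real (s p) * (2 * u))" by (simp add: exp_of_nat_mult)
        also have "\<dots> \<le> exp (real p powr (a - d))"
        proof -
          have "real (s p) * (2 * u) \<le> (2 * real p powr (1 - \<beta>)) * (2 * u)"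
            using elim u by (intro mult_right_mono) auto
          also have "\<dots> = 4 * real p powr (1 - \<beta> + z)" by (simp add: u_def powr_add)
          also have "\<dots> \<le> 6 * real p powr (1 - \<beta> + z)" by simp
          also have "\<dots> \<le> real p powr (a - d)" using elim by blast
          finally show ?thesis by (simp only: exp_le_cancel_iff)
        qed
        finally show "(1 - 1 / b + exp (2 * real p powr z) / b powr 1) ^ s p \<le> exp (real p powr (a - d))"
          by (simp add: u_def)
      qed
    qed
  qed auto
  then show ?thesis by (simp add: z_def)
qed

section \<open>Case distinction over the regimes\<close>

theorem theorem2:
  fixes a \<beta>1 \<beta> :: real and n s :: "nat \<Rightarrow> nat"
  assumes "a > 0" and "0 < \<beta>1" "\<beta>1 < 1" and "0 < \<beta>" "\<beta> < 1"
    and "(\<lambda>p. ln (ln (ln (real (n p))))) \<sim>[at_top] (\<lambda>p. a * ln (real p))"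
    and "(\<lambda>p. real (s p)) \<sim>[at_top] (\<lambda>p. real p powr (1 - \<beta>))"
  shows "(\<beta> > \<beta>1 \<longrightarrow> \<not> ((\<lambda>p. risk_2side p (n p) (rho_star a \<beta>1 p) (s p)) \<longlonglongrightarrow> 0))
       \<and> (\<beta> < \<beta>1 \<longrightarrow> ((\<lambda>p. risk_2side p (n p) (rho_star a \<beta>1 p) (s p)) \<longlonglongrightarrow> 0))"
proof -
  note a = assms(1) and b1 = assms(2,3) and b = assms(4,5) and n = assms(6) and s = assms(7)
  let ?R = "\<lambda>p. risk_2side p (n p) (rho_star a \<beta>1 p) (s p)"
  have "(\<beta>1 < \<beta> \<longrightarrow> (\<forall>\<^sub>F p in sequentially. 1 / 4 \<le> ?R p)) \<and> (\<beta> < \<beta>1 \<longrightarrow> ?R \<longlonglongrightarrow> 0)"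
  proof -
    consider (dense) "a \<le> 1 - 2 * \<beta>1" | (moderate) "1 - 2 * \<beta>1 < a" "a \<le> 1 - 4 * \<beta>1 / 3"
      | (sparse) "1 - 4 * \<beta>1 / 3 < a" "a \<le> 1 - \<beta>1" | (strong) "1 - \<beta>1 < a"
      by linarith
    then show ?thesis
    proof cases
      case dense
      have rho: "rho_star a \<beta>1 = (\<lambda>p. sqrt (real p powr ((a - (1 - 2 * \<beta>1)) / 2)))"
        using dense by (simp add: rho_star_def rho_star_sq_def fun_eq_iff)
      show ?thesis
        unfolding rho using lower_bound_dense[OF a n s b(1) _ dense] upper_bound_dense[OF a n s b(1) _ dense] by blast
    next
      case moderate
      define c where "c = a - (1 - 2 * \<beta>1)"
      have c: "0 < c" using moderate by (simp add: c_def)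
      \<comment> \<open>The rate is written as 2 r^2 log p with r^2 = c/2, the form shared by both
        logarithmic regimes.\<close>
      have rho: "rho_star a \<beta>1 = (\<lambda>p. sqrt (2 * (sqrt (c / 2))\<^sup>2 * ln (real p)))"
        using moderate c by (simp add: rho_star_def rho_star_sq_def fun_eq_iff c_def)
      have "\<forall>\<^sub>F p in sequentially. 1 / 4 \<le> ?R p" if "\<beta>1 < \<beta>"
      proof -
        have "1 - \<beta> - \<beta> * 1 + 1 * (1 + 1) * (sqrt (c / 2))\<^sup>2 = 1 - 2 * \<beta> + c" using c by simp
        also have "\<dots> < a" using that unfolding c_def by argo
        finally show ?thesis
          unfolding rho by (rule lower_bound_sparse[OF a n s b(1) zero_less_one order_refl])
      qed
      moreover have "?R \<longlonglongrightarrow> 0" if lt: "\<beta> < \<beta>1"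
      proof -
        \<comment> \<open>Threshold x = 2r and y0 = r^2, so that x - sqrt y0 = r. The first
          inequality is the linear condition, where the regime boundary 1 - 4\<beta>1/3 enters; the
          quadratic one below is just \<beta> < \<beta>1.\<close>
        have "c / 2 < 1 - \<beta> - a" using moderate lt unfolding c_def by argo
        moreover have sq: "(2 * sqrt (c / 2))\<^sup>2 = 2 * c" using c by (simp add: power_mult_distrib)
        moreover have "2 * (c / 2) < 1 - 2 * \<beta> + 2 * c - a" using lt unfolding c_def by argo
        ultimately have "(\<lambda>p. risk_2side p (n p) (sqrt (2 * (2 * sqrt (c / 2) - sqrt (c / 2))\<^sup>2 * ln (real p))) (s p)) \<longlonglongrightarrow> 0"
          using c by (intro upper_bound_sparse[OF a n s b(1)]) (simp_all only: sq, simp_all)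
        then show ?thesis unfolding rho by simp
      qed
      ultimately show ?thesis by blast
    next
      case sparse
      define x where "x = sqrt (1 - a)"
      define y where "y = sqrt (1 - a - \<beta>1)"
      have a1: "0 < 1 - a" using sparse b1 by linarith
      have x: "0 < x" "x\<^sup>2 = 1 - a" using a1 by (auto simp: x_def)
      have y: "0 \<le> y" "y\<^sup>2 = 1 - a - \<beta>1" using sparse by (auto simp: y_def)
      \<comment> \<open>Equivalent to a \<ge> 1 - 4\<beta>1/3; this is what makes the order h = y/(x
        - y) at most 1.\<close>
      have yx: "2 * y \<le> x"
        by (rule power2_le_imp_le) (use x y sparse in \<open>auto simp: power_mult_distrib\<close>)
      have rho: "rho_star a \<beta>1 = (\<lambda>p. sqrt (2 * (x - y)\<^sup>2 * ln (real p)))"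
        using sparse b1 by (simp add: rho_star_def rho_star_sq_def fun_eq_iff x_def y_def)
      have "\<forall>\<^sub>F p in sequentially. 1 / 4 \<le> ?R p" if lt: "\<beta>1 < \<beta>"
      proof (cases "y = 0")
        case True
        \<comment> \<open>At y = 0 the minimiser degenerates to h = 0, which is not an admissible
          order. A small positive h works because \<beta> - \<beta>1 pays for the term h^2
          \<beta>1.\<close>
        define h where "h = min 1 (\<beta> - \<beta>1)"
        have h: "0 < h" "h \<le> 1" "h \<le> \<beta> - \<beta>1" using lt by (auto simp: h_def)
        have eq: "a = 1 - \<beta>1" "(x - y)\<^sup>2 = \<beta>1" using True x y by auto
        have "h * (h * \<beta>1) \<le> (\<beta> - \<beta>1) * (1 * 1)" using h b1 by (intro mult_mono) auto
        moreover have "0 < h * (\<beta> - \<beta>1)" using h lt by simp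
        ultimately have "1 - \<beta> - \<beta> * h + h * (1 + h) * (x - y)\<^sup>2 < a"
          unfolding eq by (simp add: algebra_simps)
        then show ?thesis unfolding rho by (rule lower_bound_sparse[OF a n s b(1) h(1,2)])
      next
        case False
        then have y0: "0 < y" using y by simp
        define r where "r = x - y"
        have r: "y \<le> r" "0 < r" using yx y0 by (auto simp: r_def)
        \<comment> \<open>At \<beta> = \<beta>1 the exponent has derivative -\<beta>1 + r^2 + 2 h
          r^2 in h, which vanishes at y/r since \<beta>1 = r (r + 2y). Its value there is 1 -
          \<beta>1 - y^2 = a, so any \<beta> > \<beta>1 falls strictly below a.\<close>
        define h where "h = y / r"
        have h: "0 < h" "h \<le> 1" "h * r = y" using y0 r by (auto simp: h_def)
        have b1r: "\<beta>1 = r * (r + 2 * y)" using x y by (simp add: r_def power2_eq_square algebra_simps)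
        have "\<beta>1 * h = (h * r) * (r + 2 * y)" unfolding b1r by algebra
        then have bh: "\<beta>1 * h = y * (r + 2 * y)" by (simp only: h(3))
        have "h * (1 + h) * r\<^sup>2 = (h * r) * (r + h * r)" by algebra
        then have hr: "h * (1 + h) * r\<^sup>2 = y * (r + y)" by (simp only: h(3))
        have "\<beta>1 * h < \<beta> * h" using lt h by (intro mult_strict_right_mono)
        moreover have "y * (r + y) = \<beta>1 * h - y\<^sup>2" unfolding bh by algebra
        ultimately have "1 - \<beta> - \<beta> * h + h * (1 + h) * r\<^sup>2 < a" unfolding hr y(2) using lt by simp
        then show ?thesis unfolding rho r_def[symmetric] by (rule lower_bound_sparse[OF a n s b(1) h(1,2)])
      qed
      \<comment> \<open>With x^2 = 1 - a and y0 = 1 - a - \<beta>1 the linear and quadratic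
        conditions coincide, and both say \<beta> < \<beta>1.\<close>
      moreover have "?R \<longlonglongrightarrow> 0" if lt: "\<beta> < \<beta>1"
        using upper_bound_sparse[OF a n s b(1) x(1), of "1 - a - \<beta>1"] sparse lt b1
        unfolding rho y_def by (simp add: x(2))
      ultimately show ?thesis by blast
    next
      case strong
      have rho: "rho_star a \<beta>1 = (\<lambda>p. sqrt (real p powr (a - (1 - \<beta>1))))"
        using strong b1 by (simp add: rho_star_def rho_star_sq_def fun_eq_iff)
      show ?thesis
        unfolding rho using lower_bound_strong[OF a n s b(1) _ strong] upper_bound_strong[OF a n s b _ strong] by blast
    qed
  qed
  moreover have "\<not> ?R \<longlonglongrightarrow> 0" if "\<forall>\<^sub>F p in sequentially. 1 / 4 \<le> ?R p"
  proof
    assume "?R \<longlonglongrightarrow> 0"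
    then have "\<forall>\<^sub>F p in sequentially. ?R p < 1 / 4" by (rule order_tendstoD(2)) simp
    with that have "\<forall>\<^sub>F p in sequentially. False" by eventually_elim simp
    then show False by simp
  qed
  ultimately show ?thesis by blast
qed

end
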